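(* Let $\mathbb{D}\subset\mathbb{R}^2$ be the open unit disk and let $\Lambda_1:=\frac{6\pi}{3\pi-8}$. Then for all $\lambda\ge\Lambda_1$ \[ \mathcal{N}^{\mathrm N}_{\mathbb{D}}(\lambda)\ge\frac{\lambda^2}{4}. \]
   Context: For a bounded domain $\Omega\subset\mathbb{R}^d$ with Lipschitz boundary, let $0=\mu_1(\Omega)\le\mu_2(\Omega)\le\dots$ be the eigenvalues, enumerated with multiplicity, of the Neumann Laplacian: $-\Delta u=\mu u$ in $\Omega$, $\partial_n u=0$ on $\partial\Omega$. The counting function is $\mathcal{N}^{\mathrm N}_\Omega(\lambda):=\#\{n:\mu_n(\Omega)\le\lambda^2\}$. *)

theory Defs
  imports "HOL-Analysis.Analysis"
begin

primrec continuously_differentiable :: "nat \<Rightarrow> ('a::euclidean_space \<Rightarrow> real) \<Rightarrow> bool" where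
  "continuously_differentiable 0 f \<longleftrightarrow> continuous_on UNIV f"
| "continuously_differentiable (Suc k) f \<longleftrightarrow>
     (\<forall>x. f differentiable (at x)) \<and>
     (\<forall>b\<in>Basis. continuously_differentiable k (\<lambda>x. frechet_derivative f (at x) b))"

definition test_functions :: "'a::euclidean_space set \<Rightarrow> ('a \<Rightarrow> real) set" where
  "test_functions \<Omega> =
     {\<phi>. (\<forall>k. continuously_differentiable k \<phi>) \<and>
         compact (closure {x. \<phi> x \<noteq> 0}) \<and> closure {x. \<phi> x \<noteq> 0} \<subseteq> \<Omega>}"

definition square_integrable ::
    "'a::euclidean_space set \<Rightarrow> ('a \<Rightarrow> 'b::euclidean_space) \<Rightarrow> bool" where
  "square_integrable \<Omega> f \<longleftrightarrow>
     f \<in> borel_measurable (lebesgue_on \<Omega>) \<and>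
     integrable (lebesgue_on \<Omega>) (\<lambda>x. (norm (f x))\<^sup>2)"

definition weak_gradient ::
    "'a::euclidean_space set \<Rightarrow> ('a \<Rightarrow> real) \<Rightarrow> ('a \<Rightarrow> 'a) \<Rightarrow> bool" where
  "weak_gradient \<Omega> u g \<longleftrightarrow>
     (\<forall>\<phi>\<in>test_functions \<Omega>. \<forall>b\<in>Basis.
        (LINT x|lebesgue_on \<Omega>. u x * frechet_derivative \<phi> (at x) b) =
        - (LINT x|lebesgue_on \<Omega>. (g x \<bullet> b) * \<phi> x))"

text \<open>Elements of $H^1(\Omega)$ are presented as a representative function together with a
  representative of its weak gradient, which is unique only almost everywhere.\<close>

definition H1_with_gradient ::
    "'a::euclidean_space set \<Rightarrow> ('a \<Rightarrow> real) \<Rightarrow> ('a \<Rightarrow> 'a) \<Rightarrow> bool" where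
  "H1_with_gradient \<Omega> u g \<longleftrightarrow>
     square_integrable \<Omega> u \<and> square_integrable \<Omega> g \<and> weak_gradient \<Omega> u g"

text \<open>On a Lipschitz domain the problem $-\Delta u = \mu u$ in $\Omega$, $\partial_n u = 0$ on
  $\partial\Omega$ is understood in the usual variational sense:
  $\int_\Omega \nabla u\cdot\nabla v = \mu \int_\Omega u v$ for every $v \in H^1(\Omega)$.
  The boundary condition is the natural one, encoded by testing against all of $H^1(\Omega)$.\<close>

definition neumann_eigenspace :: "'a::euclidean_space set \<Rightarrow> real \<Rightarrow> ('a \<Rightarrow> real) set" where
  "neumann_eigenspace \<Omega> \<mu> =
     {u. \<exists>g. H1_with_gradient \<Omega> u g \<and>
            (\<forall>v h. H1_with_gradient \<Omega> v h \<longrightarrow>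
               (LINT x|lebesgue_on \<Omega>. g x \<bullet> h x) = \<mu> * (LINT x|lebesgue_on \<Omega>. u x * v x))}"

definition ae_independent ::
    "'a::euclidean_space set \<Rightarrow> nat \<Rightarrow> (nat \<Rightarrow> 'a \<Rightarrow> real) \<Rightarrow> bool" where
  "ae_independent \<Omega> k u \<longleftrightarrow>
     (\<forall>c :: nat \<Rightarrow> real.
        (AE x in lebesgue_on \<Omega>. (\<Sum>i<k. c i * u i x) = 0) \<longrightarrow> (\<forall>i<k. c i = 0))"

text \<open>The multiplicity is the dimension of the eigenspace modulo almost everywhere equality;
  it is \<open>0\<close> exactly when \<open>\<mu>\<close> is not an eigenvalue.\<close>

definition neumann_multiplicity :: "'a::euclidean_space set \<Rightarrow> real \<Rightarrow> enat" where
  "neumann_multiplicity \<Omega> \<mu> =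
     Sup {enat k | k. \<exists>u. (\<forall>i<k. u i \<in> neumann_eigenspace \<Omega> \<mu>) \<and> ae_independent \<Omega> k u}"

text \<open>The \<open>n\<close>-th eigenvalue (\<open>n \<ge> 1\<close>) in the increasing enumeration with multiplicity: the
  least \<open>t\<close> such that the eigenvalues in \<open>(-\<infinity>, t]\<close> have total multiplicity at least \<open>n\<close>.
  The value is extended real only so that it is meaningful for arbitrary \<open>\<Omega>\<close>, without first
  proving that the spectrum is discrete and infinite.\<close>

definition neumann_eigenvalue :: "'a::euclidean_space set \<Rightarrow> nat \<Rightarrow> ereal" where
  "neumann_eigenvalue \<Omega> n =
     Inf {ereal t | t. enat n \<le> (\<Sum>\<^sub>\<infinity>\<mu>\<in>{..t}. neumann_multiplicity \<Omega> \<mu>)}"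

text \<open>Cardinality is taken in \<open>[0, \<infinity>]\<close>, so that an infinite set does not silently count as
  empty.\<close>

definition neumann_counting :: "'a::euclidean_space set \<Rightarrow> real \<Rightarrow> ennreal" where
  "neumann_counting \<Omega> \<Lambda> =
     emeasure (count_space UNIV) {n. 1 \<le> n \<and> neumann_eigenvalue \<Omega> n \<le> ereal (\<Lambda>\<^sup>2)}"

definition unit_disk :: "(real^2) set" where
  "unit_disk = ball 0 1"

definition Lambda1 :: real where
  "Lambda1 = 6 * pi / (3 * pi - 8)"

end

theory Submission
  imports Defs "HOL-Real_Asymp.Real_Asymp"
begin

text \<open>Only a lower bound on the number of eigenvalues is needed, so it suffices to exhibit
  eigenfunctions: \<open>J\<^sub>m (\<lambda> r) cos (m \<theta>)\<close> and \<open>J\<^sub>m (\<lambda> r) sin (m \<theta>)\<close> with \<open>J\<^sub>m' \<lambda> = 0\<close>. A multiple of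
  \<open>x J\<^sub>m' x\<close>, viewed as a function of the phase \<open>s = (x\<^sup>2 - m\<^sup>2)\<^sup>1\<^sup>/\<^sup>2 - m arccos (m / x)\<close>, solves an equation
  \<open>v'' + (1 - Q) v = 0\<close> with \<open>Q > 0\<close>, so by Sturm comparison its zeros are at least \<open>\<pi>\<close> apart in \<open>s\<close>. Their
  position for large \<open>s\<close> is governed by a phase which is the same for all \<open>m\<close> up to multiples of \<open>\<pi> / 2\<close>, and which
  the sign of \<open>J\<^sub>0\<close> at a few points confines well enough. Going down from infinity, \<open>J\<^sub>m'\<close> has at least
  \<open>n\<close> zeros up to \<open>\<Lambda>\<close> as soon as the phase of \<open>\<Lambda>\<close> is at least \<open>(n - 149/200) \<pi>\<close>. The resulting lattice points are
  counted row by row; as the boundary curve is convex, the trapezoidal rule compares the count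
  with the enclosed area \<open>\<Lambda>\<^sup>2 / 4\<close>.\<close>

section \<open>Smooth functions\<close>

text \<open>The constant \<open>Lambda1\<close> is tied to the last estimate. Rounding down costs up
  to one point in each row of the lattice, about \<open>\<Lambda> / pi\<close> in all, which has the
  same order as the surplus of the trapezoidal sum. That surplus comes from the first row, where the
  inequality is governed by \<open>1 / pi + c / \<Lambda>\<close> with c the phase constant. For c =
  3/4 and \<Lambda> = \<open>Lambda1\<close> this is exactly 3/8, because
  \<open>1 / Lambda1 = 1 / 2 - 4 / (3 * pi)\<close>. On the Bessel side the obstacle is that the
  Sturm inequality bounds the gaps only from below. It therefore yields many zeros up to \<Lambda>
  only when started from a point further up where the count is already known; infinity is such a
  point for every m at once. The count there passes from m to m + 1 by Rolle's theorem and one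
  asymptotic zero. It is fixed at m = 0, where the opposite inequality holds: consecutive zeros of
  J_0 are at most pi apart, so they can be followed upwards from three explicit ones.\<close>

definition smooth :: "('a::euclidean_space \<Rightarrow> real) \<Rightarrow> bool" where
  "smooth f \<longleftrightarrow> (\<forall>k. continuously_differentiable k f)"

lemma continuously_differentiable_SucD:
  "continuously_differentiable (Suc k) f \<Longrightarrow> continuously_differentiable k f"
proof (induction k arbitrary: f)
  case 0
  then show ?case
    by (auto intro!: continuous_at_imp_continuous_on differentiable_imp_continuous_within)
qed auto

lemma smoothD:
  assumes "smooth f"
  shows "f differentiable (at x)" "b \<in> Basis \<Longrightarrow> smooth (\<lambda>x. frechet_derivative f (at x) b)"
    "continuous_on S f"
proof -
  show "f differentiable (at x)" "b \<in> Basis \<Longrightarrow> smooth (\<lambda>x. frechet_derivative f (at x) b)"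
    using assms continuously_differentiable.simps(2) unfolding smooth_def by blast+
  have "continuously_differentiable 0 f" using assms unfolding smooth_def by blast
  then show "continuous_on S f" by (auto intro: continuous_on_subset)
qed

lemma smooth_has_derivative:
  "smooth f \<Longrightarrow> (f has_derivative frechet_derivative f (at x)) (at x)"
  using smoothD(1) frechet_derivative_works by blast

lemma frechet_derivativeI: "(f has_derivative f') (at x) \<Longrightarrow> frechet_derivative f (at x) = f'"
  using frechet_derivative_at by metis

lemma continuously_differentiable_const: "continuously_differentiable k (\<lambda>x. c)"
  by (induction k arbitrary: c) (auto)

lemma smooth_const: "smooth (\<lambda>x. c)"
  by (simp add: smooth_def continuously_differentiable_const)

lemma continuously_differentiable_add:
  "continuously_differentiable k f \<Longrightarrow> continuously_differentiable k g \<Longrightarrow>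
     continuously_differentiable k (\<lambda>x. f x + g x)"
proof (induction k arbitrary: f g)
  case (Suc k)
  have D: "frechet_derivative (\<lambda>x. f x + g x) (at x) =
      (\<lambda>b. frechet_derivative f (at x) b + frechet_derivative g (at x) b)" for x
    using Suc.prems by (intro frechet_derivativeI has_derivative_add) (auto simp flip: frechet_derivative_works)
  show ?case using Suc unfolding continuously_differentiable.simps D by (auto intro: Suc.IH)
qed (auto intro: continuous_intros)

lemma continuously_differentiable_mult:
  "continuously_differentiable k f \<Longrightarrow> continuously_differentiable k g \<Longrightarrow>
     continuously_differentiable k (\<lambda>x. f x * g x)"
proof (induction k arbitrary: f g)
  case (Suc k)
  have D: "frechet_derivative (\<lambda>x. f x * g x) (at x) =
      (\<lambda>b. f x * frechet_derivative g (at x) b + frechet_derivative f (at x) b * g x)" for x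
    using Suc.prems by (intro frechet_derivativeI has_derivative_mult) (auto simp flip: frechet_derivative_works)
  have "continuously_differentiable k f" "continuously_differentiable k g"
    using Suc.prems continuously_differentiable_SucD by blast+
  then show ?case using Suc unfolding continuously_differentiable.simps D
    by (auto intro!: Suc.IH continuously_differentiable_add)
qed (auto intro: continuous_intros)

lemma smooth_add: "smooth f \<Longrightarrow> smooth g \<Longrightarrow> smooth (\<lambda>x. f x + g x)"
  and smooth_mult: "smooth f \<Longrightarrow> smooth g \<Longrightarrow> smooth (\<lambda>x. f x * g x)"
  by (auto simp: smooth_def continuously_differentiable_add continuously_differentiable_mult)

lemma smooth_inner: "smooth (\<lambda>x. x \<bullet> a)"
proof -
  have D: "frechet_derivative (\<lambda>x. x \<bullet> a) (at x) = (\<lambda>b. b \<bullet> a)" for x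
    by (intro frechet_derivativeI) (auto intro!: derivative_eq_intros)
  have "continuously_differentiable k (\<lambda>x. x \<bullet> a)" for k
  proof (cases k)
    case 0
    then show ?thesis by (auto intro: continuous_intros)
  next
    case (Suc k')
    then show ?thesis unfolding Suc continuously_differentiable.simps D
      by (auto intro!: continuously_differentiable_const derivative_intros)
  qed
  then show ?thesis by (simp add: smooth_def)
qed

lemma smooth_sum: "(\<And>i. i \<in> I \<Longrightarrow> smooth (f i)) \<Longrightarrow> smooth (\<lambda>x. \<Sum>i\<in>I. f i x)"
  by (induction I rule: infinite_finite_induct) (auto intro: smooth_const smooth_add)

lemma smooth_norm_sq: "smooth (\<lambda>x. x \<bullet> x)"
  by (subst euclidean_inner) (intro smooth_sum smooth_mult smooth_inner)

text \<open>The successor function on the index type plays the role of differentiation.\<close>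

lemma smooth_compose:
  fixes \<psi> :: "'i \<Rightarrow> real \<Rightarrow> real"
  assumes \<psi>: "\<And>i t. (\<psi> i has_real_derivative \<psi> (next i) t) (at t)" and f: "smooth f"
  shows "smooth (\<lambda>x. \<psi> i (f x))"
proof -
  have "continuously_differentiable k (\<lambda>x. \<psi> i (f x))" for k
  proof (induction k arbitrary: i)
    case 0
    have "continuous_on UNIV (\<psi> i)" 
      using \<psi> DERIV_isCont continuous_at_imp_continuous_on by blast
    then show ?case using smoothD(3)[OF f] continuous_on_compose2
      by (auto intro: continuous_on_compose2)
  next
    case (Suc k)
    have H: "((\<lambda>x. \<psi> i (f x)) has_derivative (\<lambda>b. \<psi> (next i) (f x) * frechet_derivative f (at x) b)) (at x)" for x
      using has_derivative_compose[OF smooth_has_derivative[OF f], of "\<psi> i" "(*) (\<psi> (next i) (f x))" x] \<psi>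
      unfolding has_field_derivative_def by simp
    show ?case
      unfolding continuously_differentiable.simps frechet_derivativeI[OF H]
      using H f smoothD(2)[OF f] Suc
      by (auto simp: differentiable_def smooth_def intro!: continuously_differentiable_mult)
  qed
  then show ?thesis by (simp add: smooth_def)
qed

section \<open>A smooth cutoff\<close>

text \<open>The flat function exp(-1/t) with a polynomial in 1/t as extra factor. The family is
  closed under differentiation, so the polynomial can serve as the index in
  \<open>smooth_compose\<close>.\<close>

definition flat_exp :: "real poly \<Rightarrow> real \<Rightarrow> real" where
  "flat_exp p t = (if t > 0 then poly p (1/t) * exp (-(1/t)) else 0)"

lemma poly_exp_tendsto_0: "((\<lambda>s::real. poly p s * exp (-s)) \<longlongrightarrow> 0) at_top"
proof -
  have "((\<lambda>s. \<Sum>i\<le>degree p. coeff p i * (s ^ i / exp s)) \<longlongrightarrow> (\<Sum>i\<le>degree p. coeff p i * 0)) at_top"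
    by (intro tendsto_intros tendsto_power_div_exp_0)
  then show ?thesis
    by (simp add: poly_altdef exp_minus sum_distrib_left sum_divide_distrib field_simps)
qed

text \<open>In s = 1/t, differentiation of p(s) exp(-s) with respect to t replaces p by s^2 (p -
  p'). At t = 0 the right difference quotient is s p(s) exp(-s), which tends to 0 as s
  grows.\<close>

lemma flat_exp_deriv:
  "(flat_exp p has_real_derivative flat_exp ([:0,0,1:] * (p - pderiv p)) t) (at t)"
proof -
  consider "t > 0" | "t < 0" | "t = 0" by linarith
  then show ?thesis
  proof cases
    case 1
    have "((\<lambda>t. poly p (1/t) * exp (-(1/t))) has_real_derivative
        flat_exp ([:0,0,1:] * (p - pderiv p)) t) (at t)"
      using 1 by (auto intro!: derivative_eq_intros DERIV_chain'[where f = "\<lambda>t. 1/t" and g="poly p"] poly_DERIV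
          simp: flat_exp_def field_simps power2_eq_square)
    then show ?thesis
      by (rule has_field_derivative_transform_within_open[where S = "{0<..}"])
        (use 1 in \<open>auto simp: flat_exp_def\<close>)
  next
    case 2
    have "((\<lambda>t. 0) has_real_derivative flat_exp ([:0,0,1:] * (p - pderiv p)) t) (at t)"
      using 2 by (simp add: flat_exp_def)
    then show ?thesis
      by (rule has_field_derivative_transform_within_open[where S = "{..<0}"])
        (use 2 in \<open>auto simp: flat_exp_def\<close>)
  next
    case 3
    have "((\<lambda>s::real. poly ([:0,1:] * p) s * exp (-s)) \<longlongrightarrow> 0) at_top"
      by (rule poly_exp_tendsto_0)
    then have "((\<lambda>t. poly ([:0,1:] * p) (inverse t) * exp (- inverse t)) \<longlongrightarrow> 0) (at_right 0)"
      by (rule filterlim_compose) (rule filterlim_inverse_at_top_right)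
    then have r: "((\<lambda>t. flat_exp p t / t) \<longlongrightarrow> 0) (at_right 0)"
      by (rule Lim_transform_eventually)
        (auto simp: eventually_at_filter flat_exp_def field_simps)
    have l: "((\<lambda>t. flat_exp p t / t) \<longlongrightarrow> 0) (at_left 0)"
      by (rule tendsto_eventually) (auto simp: eventually_at_filter flat_exp_def)
    from l r have "((\<lambda>t. flat_exp p t / t) \<longlongrightarrow> 0) (at 0)"
      by (rule filterlim_split_at)
    then show ?thesis using 3 by (simp add: has_field_derivative_iff flat_exp_def)
  qed
qed

text \<open>For n > 0 the argument is positive exactly when |x|^2 < 1 - 1/n, which keeps the support
  inside the open ball. At each interior point it tends to infinity with n, so the cutoff tends to 1
  there.\<close>

definition cutoff :: "nat \<Rightarrow> 'a::euclidean_space \<Rightarrow> real" where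
  "cutoff n x = flat_exp 1 (real n * (1 - x \<bullet> x) - 1)"

lemma smooth_cutoff: "smooth (cutoff n)"
proof -
  have "smooth (\<lambda>x::'a. (real n - 1) + (- real n) * (x \<bullet> x))"
    by (intro smooth_add smooth_mult smooth_const smooth_norm_sq)
  from smooth_compose[where \<psi> = flat_exp, OF flat_exp_deriv this, of 1]
  show ?thesis by (simp add: cutoff_def[abs_def] algebra_simps)
qed

lemma cutoff_deriv:
  "(cutoff n has_derivative
     (\<lambda>b. flat_exp [:0,0,1:] (real n * (1 - x \<bullet> x) - 1) * (- 2 * real n * (x \<bullet> b)))) (at x)"
proof -
  have 1: "((\<lambda>x. real n * (1 - x \<bullet> x) - 1) has_derivative (\<lambda>b. - 2 * real n * (x \<bullet> b))) (at x)"
    by (auto intro!: derivative_eq_intros simp: inner_commute algebra_simps)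
  show ?thesis
    using has_derivative_compose[OF 1, of "flat_exp 1" "(*) (flat_exp [:0,0,1:] (real n * (1 - x \<bullet> x) - 1))"]
      flat_exp_deriv[of 1 "real n * (1 - x \<bullet> x) - 1"]
    unfolding has_field_derivative_def cutoff_def[abs_def] by simp
qed

lemma cutoff_nonneg: "0 \<le> cutoff n x" and cutoff_le_1: "cutoff n x \<le> 1"
  by (auto simp: cutoff_def flat_exp_def)

lemma cutoff_nonzeroD:
  fixes x :: "'a::euclidean_space"
  assumes "cutoff n x \<noteq> 0" shows "n > 0" "norm x \<le> sqrt (1 - 1 / n)"
proof -
  have *: "real n * (1 - x \<bullet> x) - 1 > 0" using assms by (auto simp: cutoff_def flat_exp_def split: if_splits)
  then show n: "n > 0" by (cases n) auto
  have "x \<bullet> x \<le> 1 - 1/n" using * n by (simp add: field_simps)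
  then show "norm x \<le> sqrt (1 - 1 / n)" by (simp add: norm_eq_sqrt_inner)
qed

lemma tendsto_cutoff:
  assumes "norm x < 1" shows "(\<lambda>n. cutoff n x) \<longlonglongrightarrow> 1"
proof -
  have "x \<bullet> x < 1" using assms by (simp add: norm_eq_sqrt_inner)
  then have lim: "filterlim (\<lambda>n. real n * (1 - x \<bullet> x) - 1) at_top sequentially"
    by real_asymp
  have "(\<lambda>n. exp (- (1 / (real n * (1 - x \<bullet> x) - 1)))) \<longlonglongrightarrow> 1"
    using \<open>x \<bullet> x < 1\<close> by real_asymp
  moreover have "\<forall>\<^sub>F n in sequentially. exp (- (1 / (real n * (1 - x \<bullet> x) - 1))) = cutoff n x"
    using filterlim_at_top_dense[THEN iffD1, OF lim, rule_format, of 0]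
    by eventually_elim (auto simp: cutoff_def flat_exp_def)
  ultimately show ?thesis by (rule Lim_transform_eventually)
qed

text \<open>The slope of the cutoff grows like n near the sphere, but it will meet a factor of size
  s = 1 - |x|^2. With r = 1/(n s - 1) the product is (r + r^2) exp(-r), bounded uniformly in n and
  s, as dominated convergence requires.\<close>

lemma cutoff_slope_bound:
  assumes "0 < (s::real)"
  shows "\<bar>flat_exp [:0,0,1:] (real n * s - 1) * (real n * s)\<bar> \<le> 4"
proof (cases "real n * s - 1 > 0")
  case True
  define t where "t = real n * s - 1"
  define r where "r = 1 / t"
  have r: "r > 0" and t: "t > 0" using True by (auto simp: t_def r_def)
  have e: "exp r \<ge> 1 + r + r^2/2" using exp_lower_Taylor_quadratic[of r] r by simp
  have "flat_exp [:0,0,1:] (real n * s - 1) * (real n * s) = r^2 * exp (-r) * (t + 1)"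
    using t by (simp add: flat_exp_def r_def t_def power2_eq_square)
  also have "\<dots> = (r + r^2) * exp (-r)" using t by (simp add: r_def field_simps power2_eq_square)
  also have "\<dots> = (r + r^2) / exp r" by (simp add: exp_minus divide_inverse)
  finally have eq: "flat_exp [:0,0,1:] (real n * s - 1) * (real n * s) = (r + r^2) / exp r" .
  have "r + r^2 \<le> 4 * (1 + r + r^2/2)" using r by (simp add: power2_eq_square)
  also have "\<dots> \<le> 4 * exp r" using e by simp
  finally have "(r + r^2) / exp r \<le> 4" by (simp add: field_simps)
  moreover have "(r + r^2) / exp r \<ge> 0" using r by simp
  ultimately show ?thesis unfolding eq by simp
qed (simp add: flat_exp_def)

lemma tendsto_cutoff_slope:
  assumes "0 < (s::real)"
  shows "(\<lambda>n. flat_exp [:0,0,1:] (real n * s - 1) * (real n * s)) \<longlonglongrightarrow> 0"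
proof -
  have lim: "filterlim (\<lambda>n. real n * s - 1) at_top sequentially"
    using assms by real_asymp
  have "(\<lambda>n. (1 / (real n * s - 1)^2) * exp (- (1 / (real n * s - 1))) * (real n * s)) \<longlonglongrightarrow> 0"
    using assms by real_asymp
  moreover have "\<forall>\<^sub>F n in sequentially. (1 / (real n * s - 1)^2) * exp (- (1 / (real n * s - 1))) * (real n * s)
      = flat_exp [:0,0,1:] (real n * s - 1) * (real n * s)"
    using filterlim_at_top_dense[THEN iffD1, OF lim, rule_format, of 0]
    by eventually_elim (auto simp: flat_exp_def power2_eq_square)
  ultimately show ?thesis by (rule Lim_transform_eventually)
qed

section \<open>Weak solutions of the Neumann problem\<close>

lemma integrable_lborel_compact_support:
  fixes f :: "'a::euclidean_space \<Rightarrow> real"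
  assumes "continuous_on UNIV f" "\<And>x. x \<notin> cball 0 R \<Longrightarrow> f x = 0"
  shows "integrable lborel f"
proof -
  have "integrable lborel (\<lambda>x. indicator (cball 0 R) x *\<^sub>R f x)"
    using assms(1) by (intro borel_integrable_compact) (auto intro: continuous_on_subset)
  moreover have "(\<lambda>x. indicator (cball 0 R) x *\<^sub>R f x) = f"
    using assms(2) by (intro ext) (metis indicator_simps scaleR_one scaleR_zero_left)
  ultimately show ?thesis by simp
qed

lemma integrable_lborel_bounded_support:
  fixes f :: "'a::euclidean_space \<Rightarrow> real"
  shows "integrable lborel (\<lambda>x. M * indicator (cball (0::'a) R) x :: real)"
proof -
  have "emeasure lborel (cball (0::'a) R) < \<infinity>"
    by (intro emeasure_bounded_finite bounded_cball)
  then show ?thesis by (intro integrable_mult_right integrable_real_indicator) auto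
qed

text \<open>Both integrals in the difference quotient agree by translation invariance of Lebesgue
  measure.\<close>

lemma integral_directional_derivative_eq_0:
  fixes F :: "'a::euclidean_space \<Rightarrow> real"
  assumes F: "\<And>x. (F has_derivative F' x) (at x)"
    and cont: "continuous_on UNIV (\<lambda>x. F' x b)"
    and supp: "\<And>x. x \<notin> cball 0 R \<Longrightarrow> F x = 0"
  shows "integral\<^sup>L lborel (\<lambda>x. F' x b) = 0"
proof -
  define R' where "R' = \<bar>R\<bar> + norm b"
  have contF: "continuous_on UNIV F"
    using F by (meson continuous_at_imp_continuous_on has_derivative_continuous)
  have R: "x \<in> cball 0 R'" if "x + t *\<^sub>R b \<in> cball 0 R" "0 \<le> t" "t \<le> 1" for x t
  proof -
    have "norm x \<le> norm (x + t *\<^sub>R b) + norm (t *\<^sub>R b)"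
      using norm_triangle_ineq4[of "x + t *\<^sub>R b" "t *\<^sub>R b"] by simp
    also have "norm (t *\<^sub>R b) \<le> norm b" using that by (simp add: mult_left_le_one_le)
    finally show ?thesis using that by (simp add: R'_def)
  qed
  have path: "((\<lambda>t. F (x + t *\<^sub>R b)) has_real_derivative F' (x + t *\<^sub>R b) b) (at t)" for x t
  proof -
    have "((\<lambda>t. x + t *\<^sub>R b) has_derivative (\<lambda>h. h *\<^sub>R b)) (at t)"
      by (auto intro!: derivative_eq_intros)
    from has_derivative_compose[OF this F] 
    have "((\<lambda>t. F (x + t *\<^sub>R b)) has_derivative (\<lambda>h. F' (x + t *\<^sub>R b) (h *\<^sub>R b))) (at t)" .
    moreover have "F' (x + t *\<^sub>R b) (h *\<^sub>R b) = F' (x + t *\<^sub>R b) b * h" for h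
      using has_derivative_bounded_linear[OF F] by (simp add: linear_simps(5) bounded_linear.linear linear_cmul)
    ultimately show ?thesis unfolding has_field_derivative_def by (simp add: mult.commute[of _ "F' _ _"])
  qed
  have "compact ((\<lambda>x. F' x b) ` cball 0 (R' + norm b))"
    by (intro compact_continuous_image continuous_on_subset[OF cont]) auto
  then obtain M where M: "\<And>x. x \<in> cball 0 (R' + norm b) \<Longrightarrow> \<bar>F' x b\<bar> \<le> M"
    using compact_imp_bounded bounded_real by (metis image_eqI)
  define D where "D n x = (F (x + (1 / Suc n) *\<^sub>R b) - F x) * Suc n" for n :: nat and x
  have M0: "M \<ge> 0" using M[of 0] by (auto simp: R'_def)
  have bound: "\<bar>D n x\<bar> \<le> M * indicator (cball 0 R') x" for n x
  proof (cases "x \<in> cball 0 R'")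
    case True
    have "0 < 1 / real (Suc n)" by simp
    then obtain z where z: "0 < z" "z < 1 / Suc n"
      "F (x + (1 / Suc n) *\<^sub>R b) - F (x + 0 *\<^sub>R b) = (1 / Suc n - 0) * F' (x + z *\<^sub>R b) b"
      using MVT2[of 0 "1 / Suc n" "\<lambda>t. F (x + t *\<^sub>R b)" "\<lambda>t. F' (x + t *\<^sub>R b) b"] path by blast
    have "z \<le> 1" using z(2) by (smt (verit) divide_le_eq_1 of_nat_Suc of_nat_0_le_iff)
    then have "norm (x + z *\<^sub>R b) \<le> R' + norm b"
      using True z(1) norm_triangle_ineq[of x "z *\<^sub>R b"] mult_right_mono[of z 1 "norm b"] by simp
    moreover have "D n x = F' (x + z *\<^sub>R b) b" using z(3) by (simp add: D_def)
    ultimately show ?thesis using M True by simp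
  next
    case False
    then have "x + (1 / Suc n) *\<^sub>R b \<notin> cball 0 R" "x + 0 *\<^sub>R b \<notin> cball 0 R"
      using R[of x "1 / Suc n"] R[of x 0] by (auto simp: field_simps)
    then show ?thesis using supp False by (simp add: D_def)
  qed
  have intF: "integrable lborel F"
    using contF supp by (rule integrable_lborel_compact_support)
  have intFt: "integrable lborel (\<lambda>x. F (x + c))" for c
  proof -
    have "integrable (distr lborel borel ((+) c)) F" using intF by (simp add: lborel_distr_plus)
    from integrable_distr[OF _ this] show ?thesis by (simp add: add.commute)
  qed
  have "integral\<^sup>L lborel (\<lambda>x. F (c + x)) = integral\<^sup>L lborel F" for c
    using intF by (subst lborel_distr_plus[of c, symmetric], subst integral_distr) auto
  then have eq: "integral\<^sup>L lborel (\<lambda>x. F (x + c)) = integral\<^sup>L lborel F" for c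
    by (subst add.commute)
  have "integral\<^sup>L lborel (D n) = 0" for n
    unfolding D_def using intF intFt eq by simp
  moreover have "(\<lambda>n. integral\<^sup>L lborel (D n)) \<longlonglongrightarrow> integral\<^sup>L lborel (\<lambda>x. F' x b)"
  proof (rule integral_dominated_convergence)
    show "integrable lborel (\<lambda>x. M * indicator (cball (0::'a) R') x :: real)"
      by (rule integrable_lborel_bounded_support)
    show "(\<lambda>x. F' x b) \<in> borel_measurable lborel"
      using cont by (simp add: borel_measurable_continuous_onI)
    show "D n \<in> borel_measurable lborel" for n
      unfolding D_def using intF intFt by measurable
    show "AE x in lborel. (\<lambda>n. D n x) \<longlonglongrightarrow> F' x b"
    proof (rule AE_I2)
      fix x
      have "(\<lambda>h. (F (x + h *\<^sub>R b) - F x) / h) \<midarrow>0\<rightarrow> F' x b"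
        using path[of x 0] by (simp add: DERIV_def)
      moreover have "filterlim (\<lambda>n. 1 / real (Suc n)) (at 0) sequentially"
        by real_asymp
      ultimately have "(\<lambda>n. (F (x + (1 / real (Suc n)) *\<^sub>R b) - F x) / (1 / real (Suc n))) \<longlonglongrightarrow> F' x b"
        by (rule filterlim_compose)
      then show "(\<lambda>n. D n x) \<longlonglongrightarrow> F' x b" by (simp add: D_def)
    qed
    show "AE x in lborel. norm (D n x) \<le> M * indicator (cball 0 R') x" for n
      using bound by simp
  qed
  ultimately show ?thesis by (simp add: LIMSEQ_const_iff)
qed

lemma test_functionsD:
  assumes "\<phi> \<in> test_functions \<Omega>"
  shows "smooth \<phi>" "\<And>x. x \<notin> \<Omega> \<Longrightarrow> \<phi> x = 0" "\<exists>R. \<forall>x. x \<notin> cball 0 R \<longrightarrow> \<phi> x = 0"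
    "\<And>x. x \<notin> \<Omega> \<Longrightarrow> frechet_derivative \<phi> (at x) b = 0"
proof -
  have *: "smooth \<phi>" "compact (closure {x. \<phi> x \<noteq> 0})" "closure {x. \<phi> x \<noteq> 0} \<subseteq> \<Omega>"
    using assms by (auto simp: test_functions_def smooth_def)
  show "smooth \<phi>" by (rule *)
  show "\<phi> x = 0" if "x \<notin> \<Omega>" for x using * that closure_subset[of "{x. \<phi> x \<noteq> 0}"] by auto
  obtain R where "closure {x. \<phi> x \<noteq> 0} \<subseteq> cball 0 R"
    using bounded_subset_ballD[OF compact_imp_bounded[OF *(2)], of 0] ball_subset_cball by blast
  then show "\<exists>R. \<forall>x. x \<notin> cball 0 R \<longrightarrow> \<phi> x = 0"
    using closure_subset[of "{x. \<phi> x \<noteq> 0}"] by blast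
  show "frechet_derivative \<phi> (at x) b = 0" if "x \<notin> \<Omega>" for x
  proof -
    have "((\<lambda>x. 0) has_derivative (\<lambda>_. 0)) (at x)" by simp
    then have "(\<phi> has_derivative (\<lambda>_. 0)) (at x)"
      by (rule has_derivative_transform_within_open[where s = "- closure {x. \<phi> x \<noteq> 0}"])
        (use that * closure_subset[of "{x. \<phi> x \<noteq> 0}"] in auto)
    then show ?thesis by (simp add: frechet_derivativeI)
  qed
qed

lemma integral_lebesgue_on_eq_lborel:
  fixes f :: "'a::euclidean_space \<Rightarrow> real"
  assumes "\<Omega> \<in> sets lebesgue" "f \<in> borel_measurable borel" "\<And>x. x \<notin> \<Omega> \<Longrightarrow> f x = 0"
  shows "(LINT x|lebesgue_on \<Omega>. f x) = integral\<^sup>L lborel f"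
proof -
  have "(LINT x|lebesgue_on \<Omega>. f x) = (LINT x|lebesgue. indicator \<Omega> x *\<^sub>R f x)"
    using assms(1) by (simp add: integral_restrict_space)
  also have "\<dots> = (LINT x|lebesgue. f x)"
    using assms(3) by (intro Bochner_Integration.integral_cong) (auto simp: indicator_def)
  also have "\<dots> = integral\<^sup>L lborel f"
    using assms(2) by (intro integral_completion) auto
  finally show ?thesis .
qed

text \<open>The product of u with a test function has compact support even though u has not, so the
  integral of its partial derivative vanishes and no boundary term appears.\<close>

lemma weak_gradient_smooth:
  fixes u :: "'a::euclidean_space \<Rightarrow> real"
  assumes u: "smooth u" and \<Omega>: "\<Omega> \<in> sets lebesgue"
    and g: "\<And>x b. b \<in> Basis \<Longrightarrow> g x \<bullet> b = frechet_derivative u (at x) b"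
  shows "weak_gradient \<Omega> u g"
  unfolding weak_gradient_def
proof (intro ballI)
  fix \<phi> and b :: 'a assume \<phi>: "\<phi> \<in> test_functions \<Omega>" and b: "b \<in> Basis"
  note T = test_functionsD[OF \<phi>]
  obtain R where R: "\<And>x. x \<notin> cball 0 R \<Longrightarrow> \<phi> x = 0" using T(3) by blast
  obtain S where S: "\<And>x. x \<notin> cball 0 S \<Longrightarrow> frechet_derivative \<phi> (at x) b = 0"
  proof -
    have "frechet_derivative \<phi> (at x) b = 0" if x: "x \<notin> cball 0 R" for x
    proof -
      have "((\<lambda>x. 0) has_derivative (\<lambda>_. 0)) (at x)" by simp
      then have "(\<phi> has_derivative (\<lambda>_. 0)) (at x)"
        by (rule has_derivative_transform_within_open[where s = "- cball 0 R"])
          (use x R in auto)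
      then show ?thesis by (simp add: frechet_derivativeI)
    qed
    then show ?thesis using that by blast
  qed
  let ?du = "\<lambda>x. frechet_derivative u (at x) b" and ?d\<phi> = "\<lambda>x. frechet_derivative \<phi> (at x) b"
  have c: "continuous_on UNIV u" "continuous_on UNIV \<phi>" "continuous_on UNIV ?du" "continuous_on UNIV ?d\<phi>"
    using u T(1) b smoothD(2,3) by blast+
  have "integral\<^sup>L lborel (\<lambda>x. u x * ?d\<phi> x + ?du x * \<phi> x) = 0"
    by (rule integral_directional_derivative_eq_0[where F = "\<lambda>x. u x * \<phi> x" and
        F' = "\<lambda>x b. u x * frechet_derivative \<phi> (at x) b + frechet_derivative u (at x) b * \<phi> x"
          and R = R])
      (use u T(1) R c in \<open>auto intro!: has_derivative_mult smooth_has_derivative continuous_intros\<close>)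
  moreover have "integrable lborel (\<lambda>x. u x * ?d\<phi> x)"
    by (rule integrable_lborel_compact_support[where R = S]) (use c S in \<open>auto intro!: continuous_intros\<close>)
  moreover have "integrable lborel (\<lambda>x. ?du x * \<phi> x)"
    by (rule integrable_lborel_compact_support[where R = R]) (use c R in \<open>auto intro!: continuous_intros\<close>)
  ultimately have eq: "integral\<^sup>L lborel (\<lambda>x. u x * ?d\<phi> x) = - integral\<^sup>L lborel (\<lambda>x. ?du x * \<phi> x)"
    by simp
  have "(LINT x|lebesgue_on \<Omega>. u x * ?d\<phi> x) = integral\<^sup>L lborel (\<lambda>x. u x * ?d\<phi> x)"
    using T c by (intro integral_lebesgue_on_eq_lborel \<Omega>)
      (auto intro!: borel_measurable_continuous_onI continuous_intros)
  moreover have "(LINT x|lebesgue_on \<Omega>. ?du x * \<phi> x) = integral\<^sup>L lborel (\<lambda>x. ?du x * \<phi> x)"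
    using T c by (intro integral_lebesgue_on_eq_lborel \<Omega>)
      (auto intro!: borel_measurable_continuous_onI continuous_intros)
  ultimately show "(LINT x|lebesgue_on \<Omega>. u x * ?d\<phi> x) = - (LINT x|lebesgue_on \<Omega>. (g x \<bullet> b) * \<phi> x)"
    using eq g[OF b] by simp
qed

section \<open>Integrability on the unit ball\<close>

lemma finite_measure_ball: "finite_measure (lebesgue_on (ball (0::'a::euclidean_space) 1))"
proof (rule finite_measureI)
  have "emeasure lborel (ball (0::'a) 1) < \<infinity>" by (intro emeasure_bounded_finite bounded_ball)
  then show "emeasure (lebesgue_on (ball (0::'a) 1)) (space (lebesgue_on (ball 0 1))) \<noteq> \<infinity>"
    by (simp add: emeasure_restrict_space)
qed

lemma integrable_on_ball_bounded:
  fixes f :: "'a::euclidean_space \<Rightarrow> real"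
  assumes "continuous_on UNIV f"
  shows "integrable (lebesgue_on (ball 0 1)) f"
proof -
  have "compact (f ` cball 0 1)"
    by (intro compact_continuous_image continuous_on_subset[OF assms]) auto
  then obtain M where "\<And>x. x \<in> cball 0 1 \<Longrightarrow> \<bar>f x\<bar> \<le> M"
    using compact_imp_bounded bounded_real by (metis image_eqI)
  moreover have "f \<in> borel_measurable (lebesgue_on (ball 0 1))"
    using assms by (intro continuous_imp_measurable_on_sets_lebesgue continuous_on_subset[OF assms]) auto
  ultimately show ?thesis
    by (intro finite_measure.integrable_const_bound[OF finite_measure_ball, where B = M]) auto
qed

lemma square_integrable_continuous:
  fixes f :: "'a::euclidean_space \<Rightarrow> 'b::euclidean_space"
  assumes "continuous_on UNIV f" shows "square_integrable (ball 0 1) f"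
proof -
  have "f \<in> borel_measurable (lebesgue_on (ball 0 1))"
    using assms by (intro continuous_imp_measurable_on_sets_lebesgue continuous_on_subset[OF assms]) auto
  moreover have "integrable (lebesgue_on (ball 0 1)) (\<lambda>x. (norm (f x))\<^sup>2)"
    by (intro integrable_on_ball_bounded continuous_intros assms)
  ultimately show ?thesis by (simp add: square_integrable_def)
qed

lemma square_integrable_imp_integrable:
  fixes f :: "'a::euclidean_space \<Rightarrow> 'b::euclidean_space"
  assumes "square_integrable (ball 0 1) f"
  shows "integrable (lebesgue_on (ball 0 1)) f"
proof (rule Bochner_Integration.integrable_bound)
  show "integrable (lebesgue_on (ball (0::'a) 1)) (\<lambda>x. 1 + (norm (f x))\<^sup>2)"
    using assms finite_measure.integrable_const[OF finite_measure_ball, of "1::real"]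
    by (auto simp: square_integrable_def)
  show "f \<in> borel_measurable (lebesgue_on (ball 0 1))"
    using assms by (simp add: square_integrable_def)
  have "y \<le> 1 + y\<^sup>2" for y :: real
    using sum_squares_ge_zero[of "y - 1/2" 0] by (simp add: power2_eq_square algebra_simps)
  then show "AE x in lebesgue_on (ball 0 1). norm (f x) \<le> norm (1 + (norm (f x))\<^sup>2)"
    by (simp add: abs_of_nonneg)
qed

lemma cutoff_mult_test_function:
  assumes "smooth f"
  shows "(\<lambda>x. cutoff n x * f x) \<in> test_functions (ball 0 1)"
proof -
  have "{x. cutoff n x * f x \<noteq> 0} \<subseteq> cball 0 (sqrt (1 - 1 / n))"
    using cutoff_nonzeroD(2) by (auto simp: cball_def)
  then have 1: "closure {x. cutoff n x * f x \<noteq> 0} \<subseteq> cball 0 (sqrt (1 - 1 / n))"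
    by (rule closure_minimal) auto
  have 2: "closure {x. cutoff n x * f x \<noteq> 0} \<subseteq> ball 0 1"
  proof (cases "n > 0")
    case True
    then have "sqrt (1 - 1 / n) < 1" by (simp add: real_sqrt_lt_1_iff)
    then have "cball (0::'a) (sqrt (1 - 1 / n)) \<subseteq> ball 0 1" by (simp add: cball_subset_ball_iff)
    with 1 show ?thesis by (rule subset_trans)
  next
    \<comment> \<open>For n = 0 the argument of \<open>flat_exp\<close> is -1 everywhere, so the
      cutoff vanishes identically.\<close>
    case False
    then have "{x. cutoff n x * f x \<noteq> 0} = {}"
      using cutoff_nonzeroD(1)[of n] by (metis (mono_tags, lifting) Collect_empty_eq mult_zero_left)
    then show ?thesis by simp
  qed
  have "compact (closure {x. cutoff n x * f x \<noteq> 0})"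
    using 1 bounded_subset[OF bounded_cball] by (auto simp: compact_eq_bounded_closed)
  with 2 smooth_mult[OF smooth_cutoff assms] show ?thesis
    by (simp add: test_functions_def smooth_def)
qed

text \<open>The weak equation is tested with the cut-off field \<open>cutoff n\<close> times the gradient of \<open>u\<close>; since the
  radial derivative of \<open>u\<close> vanishes to first order on the sphere, the term in which the cutoff is
  differentiated tends to \<open>0\<close>, so that no boundary traces are needed.\<close>

lemma neumann_eigenspaceI:
  fixes u :: "'a::euclidean_space \<Rightarrow> real"
  assumes u: "smooth u"
    and g: "\<And>x b. b \<in> Basis \<Longrightarrow> g x \<bullet> b = frechet_derivative u (at x) b"
    and lap: "\<And>x. (\<Sum>b\<in>Basis. frechet_derivative (\<lambda>x. g x \<bullet> b) (at x) b) = - \<mu> * u x"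
    and rad: "\<And>x. x \<in> ball 0 1 \<Longrightarrow> \<bar>x \<bullet> g x\<bar> \<le> K * (1 - x \<bullet> x)"
  shows "u \<in> neumann_eigenspace (ball 0 1) \<mu>"
proof -
  let ?L = "lebesgue_on (ball (0::'a) 1)"
  have sg: "smooth (\<lambda>x. g x \<bullet> b)" if "b \<in> Basis" for b
    using smoothD(2)[OF u that] that by (simp add: g)
  have "continuous_on UNIV (\<lambda>x. \<Sum>b\<in>Basis. (g x \<bullet> b) *\<^sub>R b)"
    by (intro continuous_intros smoothD(3)[OF sg])
  then have cg: "continuous_on UNIV g" by (simp add: euclidean_representation)
  have cu: "continuous_on UNIV u" using u by (rule smoothD)
  have H1u: "H1_with_gradient (ball 0 1) u g"
    unfolding H1_with_gradient_def using cu cg weak_gradient_smooth[OF u _ g, of "ball 0 1"]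
    by (auto intro: square_integrable_continuous)
  have "(LINT x|?L. g x \<bullet> h x) = \<mu> * (LINT x|?L. u x * v x)"
    if vh: "H1_with_gradient (ball 0 1) v h" for v h
  proof -
    have iv: "integrable ?L v" and ih: "integrable ?L h"
      using vh square_integrable_imp_integrable by (auto simp: H1_with_gradient_def)
    have mv[measurable]: "v \<in> borel_measurable ?L" and mh[measurable]: "h \<in> borel_measurable ?L"
      using iv ih by auto
    have bdd: "\<exists>M. \<forall>x\<in>ball 0 1. norm (f x) \<le> M" if "continuous_on UNIV f" for f :: "'a \<Rightarrow> 'b::euclidean_space"
    proof -
      have "compact (f ` cball 0 1)"
        by (intro compact_continuous_image continuous_on_subset[OF that]) auto
      then obtain M where "\<forall>y\<in>f ` cball 0 1. norm y \<le> M"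
        using compact_imp_bounded bounded_iff by metis
      then show ?thesis by (intro exI[of _ M]) auto
    qed
    obtain Mu where Mu: "\<And>x. x \<in> ball 0 1 \<Longrightarrow> \<bar>u x\<bar> \<le> Mu" using bdd[OF cu] by (metis real_norm_def)
    obtain Mg where Mg: "\<And>x. x \<in> ball 0 1 \<Longrightarrow> norm (g x) \<le> Mg" using bdd[OF cg] by blast
    have meas: "f \<in> borel_measurable ?L" if "continuous_on UNIV f" for f :: "'a \<Rightarrow> 'b::euclidean_space"
      by (intro continuous_imp_measurable_on_sets_lebesgue continuous_on_subset[OF that]) auto
    have [measurable]: "u \<in> borel_measurable ?L" "g \<in> borel_measurable ?L" "cutoff n \<in> borel_measurable ?L" for n
      using meas cu cg smoothD(3) smooth_cutoff by blast+
    \<comment> \<open>The gradient of the cutoff paired with g. As the cutoff is radial, this is a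
      multiple of \<open>x \<bullet> g x\<close>, which \<open>rad\<close> controls.\<close>
    define S where "S n x = flat_exp [:0,0,1:] (real n * (1 - x \<bullet> x) - 1) * (- 2 * real n * (x \<bullet> g x))" for n x
    have dc: "frechet_derivative (cutoff n) (at x) b =
        flat_exp [:0,0,1:] (real n * (1 - x \<bullet> x) - 1) * (- 2 * real n * (x \<bullet> b))" for n x and b :: 'a
      using frechet_derivativeI[OF cutoff_deriv] by metis
    have S_eq: "S n x = (\<Sum>b\<in>Basis. frechet_derivative (cutoff n) (at x) b * (g x \<bullet> b))" for n x
      unfolding dc S_def euclidean_inner[of x "g x"] by (simp add: sum_distrib_left mult_ac)
    have cS: "continuous_on UNIV (S n)" for n
      unfolding S_eq[abs_def] by (intro continuous_intros smoothD(3)[OF sg] smoothD(3)[OF smoothD(2)[OF smooth_cutoff]])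
    have [measurable]: "S n \<in> borel_measurable ?L" for n
      by (rule meas) (rule cS)
    have S_bound: "\<bar>S n x\<bar> \<le> 8 * \<bar>K\<bar>" and S_lim: "(\<lambda>n. S n x) \<longlonglongrightarrow> 0"
      if x: "x \<in> ball 0 1" for n x
    proof -
      have s: "1 - x \<bullet> x > 0" using x by (simp add: norm_eq_sqrt_inner)
      define T where "T n = flat_exp [:0,0,1:] (real n * (1 - x \<bullet> x) - 1) * (real n * (1 - x \<bullet> x))" for n
      have le: "\<bar>S n x\<bar> \<le> 2 * \<bar>K\<bar> * \<bar>T n\<bar>" for n
      proof -
        have "\<bar>x \<bullet> g x\<bar> \<le> \<bar>K\<bar> * (1 - x \<bullet> x)"
          using rad[OF x] s by (smt (verit) mult_right_mono)
        then have "\<bar>flat_exp [:0,0,1:] (real n * (1 - x \<bullet> x) - 1)\<bar> * (2 * real n) * \<bar>x \<bullet> g x\<bar> \<le>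
            \<bar>flat_exp [:0,0,1:] (real n * (1 - x \<bullet> x) - 1)\<bar> * (2 * real n) * (\<bar>K\<bar> * (1 - x \<bullet> x))"
          by (intro mult_left_mono) auto
        then show ?thesis using s by (simp add: S_def T_def abs_mult mult_ac)
      qed
      have "\<bar>T n\<bar> \<le> 4" unfolding T_def by (rule cutoff_slope_bound[OF s])
      then have "2 * \<bar>K\<bar> * \<bar>T n\<bar> \<le> 2 * \<bar>K\<bar> * 4" by (intro mult_left_mono) auto
      with le[of n] show "\<bar>S n x\<bar> \<le> 8 * \<bar>K\<bar>" by simp
      have "T \<longlonglongrightarrow> 0" unfolding T_def by (rule tendsto_cutoff_slope[OF s])
      then have "(\<lambda>n. 2 * \<bar>K\<bar> * \<bar>T n\<bar>) \<longlonglongrightarrow> 2 * \<bar>K\<bar> * \<bar>0\<bar>" by (intro tendsto_intros)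
      then have "(\<lambda>n. 2 * \<bar>K\<bar> * \<bar>T n\<bar>) \<longlonglongrightarrow> 0" by simp
      then show "(\<lambda>n. S n x) \<longlonglongrightarrow> 0"
        by (rule Lim_null_comparison[rotated]) (use le in auto)
    qed
    have space: "space ?L = ball 0 1" by simp
    have intd: "integrable ?L (\<lambda>x. v x * f x)" if f: "continuous_on UNIV f" for f :: "'a \<Rightarrow> real"
    proof -
      obtain M where M: "\<And>x. x \<in> ball 0 1 \<Longrightarrow> \<bar>f x\<bar> \<le> M" using bdd[OF f] by (metis real_norm_def)
      show ?thesis
        by (rule Bochner_Integration.integrable_bound[where f = "\<lambda>x. M * v x"])
          (use iv meas[OF f] M in \<open>auto simp: abs_mult mult.commute[of "\<bar>v _\<bar>"] intro!: AE_I2 mult_right_mono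
             order_trans[OF M abs_ge_self]\<close>)
    qed
    have inth: "integrable ?L (\<lambda>x. (h x \<bullet> b) * f x)" if f: "continuous_on UNIV f" for b and f :: "'a \<Rightarrow> real"
    proof -
      obtain M where M: "\<And>x. x \<in> ball 0 1 \<Longrightarrow> \<bar>f x\<bar> \<le> M" using bdd[OF f] by (metis real_norm_def)
      show ?thesis
        by (rule Bochner_Integration.integrable_bound[where f = "\<lambda>x. M * (h x \<bullet> b)"])
          (use ih meas[OF f] M in \<open>auto simp: abs_mult mult.commute[of "\<bar>h _ \<bullet> b\<bar>"] intro!: AE_I2 mult_right_mono
             order_trans[OF M abs_ge_self]\<close>)
    qed
    \<comment> \<open>The weak gradient identity of v is applied to each component of the cut-off
      field and summed; by \<open>lap\<close> the divergence of that field is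
      \<open>S n x - \<mu> * (cutoff n x * u x)\<close>.\<close>
    have main: "(LINT x|?L. v x * (S n x - \<mu> * (cutoff n x * u x))) = - (LINT x|?L. cutoff n x * (h x \<bullet> g x))" for n
    proof -
      have D: "frechet_derivative (\<lambda>x. cutoff n x * (g x \<bullet> b)) (at x) b =
          cutoff n x * frechet_derivative (\<lambda>x. g x \<bullet> b) (at x) b
            + frechet_derivative (cutoff n) (at x) b * (g x \<bullet> b)" if "b \<in> Basis" for b x
        using frechet_derivativeI[OF has_derivative_mult[OF smooth_has_derivative[OF smooth_cutoff]
              smooth_has_derivative[OF sg[OF that]]]] by metis
      have sD: "smooth (\<lambda>x. cutoff n x * (g x \<bullet> b))" if "b \<in> Basis" for b
        by (intro smooth_mult smooth_cutoff sg that)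
      have "(LINT x|?L. v x * frechet_derivative (\<lambda>x. cutoff n x * (g x \<bullet> b)) (at x) b) =
          - (LINT x|?L. (h x \<bullet> b) * (cutoff n x * (g x \<bullet> b)))" if "b \<in> Basis" for b
        using vh cutoff_mult_test_function[OF sg[OF that]] that
        unfolding H1_with_gradient_def weak_gradient_def by blast
      then have "(\<Sum>b\<in>Basis. (LINT x|?L. v x * frechet_derivative (\<lambda>x. cutoff n x * (g x \<bullet> b)) (at x) b)) =
          - (\<Sum>b\<in>Basis. (LINT x|?L. (h x \<bullet> b) * (cutoff n x * (g x \<bullet> b))))"
        by (simp add: sum_negf)
      moreover have "(\<Sum>b\<in>Basis. (LINT x|?L. v x * frechet_derivative (\<lambda>x. cutoff n x * (g x \<bullet> b)) (at x) b)) =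
          (LINT x|?L. (\<Sum>b\<in>Basis. v x * frechet_derivative (\<lambda>x. cutoff n x * (g x \<bullet> b)) (at x) b))"
        by (rule Bochner_Integration.integral_sum[symmetric]) (intro intd smoothD(3)[OF smoothD(2)[OF sD]])
      moreover have "(\<Sum>b\<in>Basis. v x * frechet_derivative (\<lambda>x. cutoff n x * (g x \<bullet> b)) (at x) b) =
          v x * (S n x - \<mu> * (cutoff n x * u x))" for x
      proof -
        have "(\<Sum>b\<in>Basis. v x * frechet_derivative (\<lambda>x. cutoff n x * (g x \<bullet> b)) (at x) b) =
          v x * (cutoff n x * (\<Sum>b\<in>Basis. frechet_derivative (\<lambda>x. g x \<bullet> b) (at x) b) + S n x)"
          unfolding S_eq by (simp add: D sum_distrib_left sum.distrib algebra_simps)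
        then show ?thesis by (simp add: lap algebra_simps)
      qed
      moreover have "(\<Sum>b\<in>Basis. (LINT x|?L. (h x \<bullet> b) * (cutoff n x * (g x \<bullet> b)))) =
          (LINT x|?L. (\<Sum>b\<in>Basis. (h x \<bullet> b) * (cutoff n x * (g x \<bullet> b))))"
        by (rule Bochner_Integration.integral_sum[symmetric]) (intro inth smoothD(3)[OF sD])
      moreover have "(\<Sum>b\<in>Basis. (h x \<bullet> b) * (cutoff n x * (g x \<bullet> b))) = cutoff n x * (h x \<bullet> g x)" for x
        unfolding euclidean_inner[of "h x" "g x"] by (simp add: sum_distrib_left mult_ac)
      ultimately show ?thesis by simp
    qed
    \<comment> \<open>Both sides of \<open>main\<close> pass to the limit by dominated convergence;
      here the bound on \<open>S n\<close> is uniform in n, and \<open>S n\<close> tends to 0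
      pointwise.\<close>
    have "(\<lambda>n. LINT x|?L. v x * (S n x - \<mu> * (cutoff n x * u x))) \<longlonglongrightarrow> (LINT x|?L. v x * (0 - \<mu> * (1 * u x)))"
    proof (rule integral_dominated_convergence)
      show "integrable ?L (\<lambda>x. \<bar>v x\<bar> * (8 * \<bar>K\<bar> + \<bar>\<mu>\<bar> * Mu))" using iv by auto
      show "AE x in ?L. (\<lambda>n. v x * (S n x - \<mu> * (cutoff n x * u x))) \<longlonglongrightarrow> v x * (0 - \<mu> * (1 * u x))"
        by (rule AE_I2) (intro tendsto_intros S_lim tendsto_cutoff; simp)
      show "AE x in ?L. norm (v x * (S n x - \<mu> * (cutoff n x * u x))) \<le> \<bar>v x\<bar> * (8 * \<bar>K\<bar> + \<bar>\<mu>\<bar> * Mu)" for n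
      proof (rule AE_I2)
        fix x assume "x \<in> space ?L"
        then have x: "x \<in> ball 0 1" by simp
        have "\<bar>cutoff n x * u x\<bar> \<le> 1 * Mu" unfolding abs_mult
          using Mu[OF x] cutoff_nonneg[of n x] cutoff_le_1[of n x] by (intro mult_mono) auto
        then have "\<bar>\<mu> * (cutoff n x * u x)\<bar> \<le> \<bar>\<mu>\<bar> * Mu" unfolding abs_mult[of \<mu>] by (intro mult_left_mono) auto
        then have "\<bar>S n x - \<mu> * (cutoff n x * u x)\<bar> \<le> 8 * \<bar>K\<bar> + \<bar>\<mu>\<bar> * Mu"
          using S_bound[OF x, of n] by linarith
        then show "norm (v x * (S n x - \<mu> * (cutoff n x * u x))) \<le> \<bar>v x\<bar> * (8 * \<bar>K\<bar> + \<bar>\<mu>\<bar> * Mu)"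
          by (simp add: abs_mult mult_left_mono)
      qed
    qed measurable
    moreover have "(\<lambda>n. - (LINT x|?L. cutoff n x * (h x \<bullet> g x))) \<longlonglongrightarrow> - (LINT x|?L. 1 * (h x \<bullet> g x))"
    proof (intro tendsto_minus integral_dominated_convergence)
      show "integrable ?L (\<lambda>x. norm (h x) * Mg)" using ih by auto
      show "AE x in ?L. (\<lambda>n. cutoff n x * (h x \<bullet> g x)) \<longlonglongrightarrow> 1 * (h x \<bullet> g x)"
        by (rule AE_I2) (intro tendsto_mult tendsto_const tendsto_cutoff; simp)
      show "AE x in ?L. norm (cutoff n x * (h x \<bullet> g x)) \<le> norm (h x) * Mg" for n
      proof (rule AE_I2)
        fix x assume "x \<in> space ?L"
        then have x: "x \<in> ball 0 1" by simp
        have "\<bar>h x \<bullet> g x\<bar> \<le> norm (h x) * norm (g x)" by (rule Cauchy_Schwarz_ineq2)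
        also have "\<dots> \<le> norm (h x) * Mg" using Mg[OF x] by (intro mult_left_mono) auto
        finally have "\<bar>cutoff n x\<bar> * \<bar>h x \<bullet> g x\<bar> \<le> 1 * (norm (h x) * Mg)"
          using cutoff_nonneg[of n x] cutoff_le_1[of n x] by (intro mult_mono) auto
        then show "norm (cutoff n x * (h x \<bullet> g x)) \<le> norm (h x) * Mg" by (simp add: abs_mult)
      qed
    qed measurable
    ultimately have "(LINT x|?L. v x * (0 - \<mu> * (1 * u x))) = - (LINT x|?L. 1 * (h x \<bullet> g x))"
      unfolding main by (rule LIMSEQ_unique)
    moreover have "(LINT x|?L. v x * (0 - \<mu> * (1 * u x))) = - \<mu> * (LINT x|?L. u x * v x)"
      by (subst integral_mult_right_zero[symmetric]) (simp add: mult_ac)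
    ultimately show ?thesis by (simp add: inner_commute)
  qed
  with H1u show ?thesis by (auto simp: neumann_eigenspace_def)
qed

section \<open>Bessel functions\<close>

text \<open>The Bessel-Clifford function C_m: J_m(x) = (x/2)^m C_m(-x^2/4). It is entire and
  differentiation merely raises m, so modes built from it are smooth at the centre of the
  disk.\<close>

definition bessel_clifford :: "nat \<Rightarrow> real \<Rightarrow> real" where
  "bessel_clifford m t = (\<Sum>k. 1 / (fact k * fact (k + m)) * t ^ k)"

lemma summable_bessel_clifford: "summable (\<lambda>k. 1 / (fact k * fact (k + m)) * (t::real) ^ k)"
proof (rule summable_comparison_test')
  show "summable (\<lambda>k. \<bar>t\<bar> ^ k /\<^sub>R fact k)" using summable_exp_generic[of "\<bar>t\<bar>"] .
  show "norm (1 / (fact k * fact (k + m)) * t ^ k) \<le> \<bar>t\<bar> ^ k /\<^sub>R fact k" if "k \<ge> 0" for k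
  proof -
    have "(1::real) / (fact k * fact (k + m)) \<le> 1 / fact k"
      using fact_ge_1[of "k+m"] by (intro divide_left_mono) auto
    then have "1 / (fact k * fact (k + m)) * \<bar>t\<bar> ^ k \<le> 1 / fact k * \<bar>t\<bar> ^ k"
      by (intro mult_right_mono) auto
    then show ?thesis by (simp add: abs_mult power_abs divide_inverse)
  qed
qed

lemma bessel_clifford_deriv [derivative_intros]:
  "(bessel_clifford m has_real_derivative bessel_clifford (Suc m) t) (at t)"
proof -
  have "((\<lambda>t. \<Sum>k. 1 / (fact k * fact (k + m)) * t ^ k) has_real_derivative
      (\<Sum>k. diffs (\<lambda>k. 1 / (fact k * fact (k + m))) k * t ^ k)) (at t)"
    by (rule termdiffs_strong_converges_everywhere) (rule summable_bessel_clifford)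
  moreover have "diffs (\<lambda>k. 1 / (fact k * fact (k + m)) :: real) k = 1 / (fact k * fact (k + Suc m))" for k
    by (simp add: diffs_def field_simps del: of_nat_Suc)
  ultimately show ?thesis unfolding bessel_clifford_def[abs_def] by simp
qed

lemma continuous_on_bessel_clifford: "continuous_on S (bessel_clifford m)"
  using bessel_clifford_deriv DERIV_isCont continuous_at_imp_continuous_on by blast

lemma bessel_clifford_0: "bessel_clifford m 0 = 1 / fact m"
  using powser_zero[of "\<lambda>k. 1 / (fact k * fact (k + m)) :: real"] by (simp add: bessel_clifford_def)

text \<open>Coefficientwise, 1/(k! (k+m)!) is (m+1+k)/(k! (k+m+1)!), and the part with the factor k
  is a shifted copy of the series of C_(m+2). Since raising m is differentiation, this is also the
  differential equation of C_m.\<close>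

lemma bessel_clifford_rec:
  "bessel_clifford m t = (real m + 1) * bessel_clifford (m + 1) t + t * bessel_clifford (m + 2) t"
proof -
  have "(\<lambda>k. t * (1 / (fact k * fact (k + (m + 2))) * t ^ k)) sums (t * bessel_clifford (m + 2) t)"
    unfolding bessel_clifford_def by (intro sums_mult summable_sums summable_bessel_clifford)
  moreover have "(\<lambda>k. t * (1 / (fact k * fact (k + (m + 2))) * t ^ k)) =
      (\<lambda>k. real (Suc k) / (fact (Suc k) * fact (Suc k + (m + 1))) * t ^ Suc k)"
    by (intro ext) (simp add: field_simps del: of_nat_Suc)
  ultimately have "(\<lambda>k. real k / (fact k * fact (k + (m + 1))) * t ^ k) sums (t * bessel_clifford (m + 2) t)"
    using sums_Suc_iff[of "\<lambda>k. real k / (fact k * fact (k + (m + 1))) * t ^ k"] by simp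
  moreover have "(\<lambda>k. (real m + 1) * (1 / (fact k * fact (k + (m + 1))) * t ^ k))
      sums ((real m + 1) * bessel_clifford (m + 1) t)"
    unfolding bessel_clifford_def by (intro sums_mult summable_sums summable_bessel_clifford)
  ultimately have "(\<lambda>k. (real m + 1) * (1 / (fact k * fact (k + (m + 1))) * t ^ k) + real k / (fact k * fact (k + (m + 1))) * t ^ k)
     sums ((real m + 1) * bessel_clifford (m + 1) t + t * bessel_clifford (m + 2) t)"
    by (intro sums_add)
  moreover have "(real m + 1) * (1 / (fact k * fact (k + (m + 1))) * t ^ k) + real k / (fact k * fact (k + (m + 1))) * t ^ k
     = 1 / (fact k * fact (k + m)) * t ^ k" for k
  proof -
    have "fact (k + (m + 1)) = (real m + 1 + real k) * fact (k + m)" by (simp add: algebra_simps)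
    moreover have "real m + 1 + real k \<noteq> 0" by linarith
    ultimately show ?thesis by (simp add: divide_simps) (simp add: algebra_simps)
  qed
  ultimately show ?thesis by (simp add: bessel_clifford_def sums_iff)
qed

section \<open>Separated solutions on the disk\<close>

definition to_complex :: "real^2 \<Rightarrow> complex" where
  "to_complex x = Complex (x $ 1) (x $ 2)"

definition harmonic :: "complex \<Rightarrow> nat \<Rightarrow> real^2 \<Rightarrow> real" where
  "harmonic a m x = Re (a * to_complex x ^ m)"

lemma bounded_linear_to_complex: "bounded_linear to_complex"
proof -
  have "to_complex = (\<lambda>x. of_real (x $ 1) + \<i> * of_real (x $ 2))"
    by (auto simp: to_complex_def complex_eq_iff)
  moreover have "bounded_linear (\<lambda>x::real^2. complex_of_real (x $ 1) + \<i> * of_real (x $ 2))"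
    by (intro bounded_linear_add bounded_linear_const_mult bounded_linear_of_real[THEN bounded_linear_compose]
          bounded_linear_vec_nth)
  ultimately show ?thesis by simp
qed

text \<open>The complex coefficient absorbs the direction of differentiation, so all derivatives
  stay in the family. For m = 0 the factor \<open>of_nat m\<close> makes the truncated exponent
  harmless.\<close>

lemma harmonic_has_derivative:
  "(harmonic a m has_derivative (\<lambda>b. harmonic (of_nat m * a * to_complex b) (m - 1) x)) (at x)"
  unfolding harmonic_def[abs_def]
  by (auto intro!: derivative_eq_intros bounded_linear.has_derivative[OF bounded_linear_to_complex]
      bounded_linear.has_derivative[OF bounded_linear_Re] simp: mult_ac)

lemma smooth_harmonic: "smooth (harmonic a m)"
proof -
  have "continuously_differentiable k (harmonic a m)" for k
  proof (induction k arbitrary: a m)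
    case 0
    show ?case using harmonic_has_derivative 
      by (auto intro!: continuous_at_imp_continuous_on has_derivative_continuous)
  next
    case (Suc k)
    then show ?case using harmonic_has_derivative[of a m]
      by (auto simp: frechet_derivativeI[OF harmonic_has_derivative] differentiable_def)
  qed
  then show ?thesis by (simp add: smooth_def)
qed

lemma sum_Basis_2: "(\<Sum>b\<in>(Basis :: (real^2) set). f b) = f (axis 1 1) + f (axis 2 1)"
proof -
  have "(Basis :: (real^2) set) = {axis 1 1, axis 2 1}"
    by (auto simp: Basis_vec_def UNIV_2)
  moreover have "axis 1 1 \<noteq> (axis 2 1 :: real^2)" by (simp add: axis_eq_axis)
  then have "sum f {axis 1 1, axis 2 1} = f (axis 1 1) + f (axis 2 1)"
    by (subst sum.insert) auto
  ultimately show ?thesis by (rule ssubst)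
qed

lemma inner_2: "(x :: real^2) \<bullet> y = x $ 1 * y $ 1 + x $ 2 * y $ 2"
  by (simp add: inner_vec_def sum_2)

text \<open>For \<kappa> = \<lambda>^2/4 with \<lambda> > 0 this is a constant multiple of
  J_m(\<lambda> r) times a trigonometric function of m \<theta>. Written in \<kappa>, the family
  also contains the constants, at m = 0 and \<kappa> = 0.\<close>

definition disk_mode :: "complex \<Rightarrow> nat \<Rightarrow> real \<Rightarrow> real^2 \<Rightarrow> real" where
  "disk_mode a m \<kappa> x = harmonic a m x * bessel_clifford m (- \<kappa> * (x \<bullet> x))"

lemma bessel_clifford_norm_sq_has_derivative:
  "((\<lambda>x::real^2. bessel_clifford m (- \<kappa> * (x \<bullet> x))) has_derivative
     (\<lambda>b. bessel_clifford (Suc m) (- \<kappa> * (x \<bullet> x)) * (- 2 * \<kappa> * (x \<bullet> b)))) (at x)"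
proof -
  have 1: "((\<lambda>x. - \<kappa> * (x \<bullet> x)) has_derivative (\<lambda>b. - 2 * \<kappa> * (x \<bullet> b))) (at x)"
    by (auto intro!: derivative_eq_intros simp: inner_commute)
  from has_derivative_compose[OF 1, of "bessel_clifford m" "(*) (bessel_clifford (Suc m) (- \<kappa> * (x \<bullet> x)))"]
  show ?thesis using bessel_clifford_deriv unfolding has_field_derivative_def by simp
qed

lemma smooth_bessel_clifford_norm_sq: "smooth (\<lambda>x::real^2. bessel_clifford m (- \<kappa> * (x \<bullet> x)))"
  by (rule smooth_compose[where \<psi> = bessel_clifford, OF bessel_clifford_deriv])
    (intro smooth_mult smooth_const smooth_norm_sq)

lemma smooth_disk_mode: "smooth (disk_mode a m \<kappa>)"
  unfolding disk_mode_def[abs_def]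
  by (intro smooth_mult smooth_harmonic smooth_bessel_clifford_norm_sq)

lemma disk_mode_has_derivative:
  "(disk_mode a m \<kappa> has_derivative
     (\<lambda>b. harmonic (of_nat m * a * to_complex b) (m - 1) x * bessel_clifford m (- \<kappa> * (x \<bullet> x))
        + harmonic a m x * (bessel_clifford (Suc m) (- \<kappa> * (x \<bullet> x)) * (- 2 * \<kappa> * (x \<bullet> b))))) (at x)"
  unfolding disk_mode_def[abs_def]
  by (rule has_derivative_eq_rhs[OF has_derivative_mult[OF harmonic_has_derivative bessel_clifford_norm_sq_has_derivative]])
    (simp add: fun_eq_iff)

lemma harmonic_euler:
  "x $ 1 * harmonic (of_nat m * a * to_complex (axis 1 1)) (m - 1) x +
   x $ 2 * harmonic (of_nat m * a * to_complex (axis 2 1)) (m - 1) x = real m * harmonic a m x"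
proof (cases m)
  case (Suc k)
  have "of_real (x $ 1) * (of_nat m * a * to_complex (axis 1 1) * to_complex x ^ k) +
     of_real (x $ 2) * (of_nat m * a * to_complex (axis 2 1) * to_complex x ^ k) =
     of_nat m * (a * to_complex x ^ k) * (of_real (x $ 1) * to_complex (axis 1 1) + of_real (x $ 2) * to_complex (axis 2 1))"
    by (simp add: algebra_simps)
  also have "of_real (x $ 1) * to_complex (axis 1 1) + of_real (x $ 2) * to_complex (axis 2 1) = to_complex x"
    by (simp add: to_complex_def complex_eq_iff axis_def)
  finally have "of_real (x $ 1) * (of_nat m * a * to_complex (axis 1 1) * to_complex x ^ k) +
     of_real (x $ 2) * (of_nat m * a * to_complex (axis 2 1) * to_complex x ^ k) = of_real (real m) * (a * to_complex x ^ m)"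
    by (simp add: Suc mult_ac)
  from arg_cong[OF this, of Re] show ?thesis
    by (simp add: harmonic_def Suc del: of_nat_Suc)
qed (simp add: harmonic_def)

definition disk_mode_gradient :: "complex \<Rightarrow> nat \<Rightarrow> real \<Rightarrow> real^2 \<Rightarrow> real^2" where
  "disk_mode_gradient a m \<kappa> x = (\<Sum>b\<in>Basis. frechet_derivative (disk_mode a m \<kappa>) (at x) b *\<^sub>R b)"

lemma disk_mode_gradient_inner:
  assumes "b \<in> Basis"
  shows "disk_mode_gradient a m \<kappa> x \<bullet> b =
      harmonic (of_nat m * a * to_complex b) (m - 1) x * bessel_clifford m (- \<kappa> * (x \<bullet> x))
        + harmonic a m x * (bessel_clifford (Suc m) (- \<kappa> * (x \<bullet> x)) * (- 2 * \<kappa> * (x \<bullet> b)))"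
  using assms unfolding disk_mode_gradient_def frechet_derivativeI[OF disk_mode_has_derivative]
  by (simp only: inner_sum_left_Basis)

lemma disk_mode_radial:
  "x \<bullet> disk_mode_gradient a m \<kappa> x =
     harmonic a m x * (real m * bessel_clifford m (- \<kappa> * (x \<bullet> x))
       - 2 * \<kappa> * (x \<bullet> x) * bessel_clifford (Suc m) (- \<kappa> * (x \<bullet> x)))"
proof -
  have "x \<bullet> disk_mode_gradient a m \<kappa> x =
      (\<Sum>b\<in>Basis. (x \<bullet> b) * (disk_mode_gradient a m \<kappa> x \<bullet> b))"
    by (rule euclidean_inner)
  also have "\<dots> = (x $ 1 * harmonic (of_nat m * a * to_complex (axis 1 1)) (m - 1) x +
       x $ 2 * harmonic (of_nat m * a * to_complex (axis 2 1)) (m - 1) x) * bessel_clifford m (- \<kappa> * (x \<bullet> x))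
     + harmonic a m x * (bessel_clifford (Suc m) (- \<kappa> * (x \<bullet> x)) * (- 2 * \<kappa> * (x $ 1 * x $ 1 + x $ 2 * x $ 2)))"
    by (simp add: disk_mode_gradient_inner sum_Basis_2 inner_axis del: minus_mult_minus mult_minus_left) (simp add: algebra_simps)
  finally show ?thesis unfolding harmonic_euler inner_2[symmetric] by (simp add: algebra_simps)
qed

text \<open>Product rule for the Laplacian: the harmonic factor contributes nothing because 1 +
  \<i>^2 = 0, the mixed term is reduced by Euler's identity for homogeneous functions, and the sum
  of the rest is the recurrence for C_m.\<close>

lemma disk_mode_laplacian:
  "(\<Sum>b\<in>Basis. frechet_derivative (\<lambda>x. disk_mode_gradient a m \<kappa> x \<bullet> b) (at x) b) = - (4 * \<kappa>) * disk_mode a m \<kappa> x"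
proof -
  let ?C = "\<lambda>m. bessel_clifford m (- \<kappa> * (x \<bullet> x))"
  let ?H = "\<lambda>b. harmonic (of_nat m * a * to_complex b) (m - 1) x"
  let ?H2 = "\<lambda>b. harmonic (of_nat (m - 1) * (of_nat m * a * to_complex b) * to_complex b) (m - 1 - 1) x"
  have D: "frechet_derivative (\<lambda>x. disk_mode_gradient a m \<kappa> x \<bullet> b) (at x) b =
     (?H b * (?C (Suc m) * (- 2 * \<kappa> * (x \<bullet> b))) + ?H2 b * ?C m) +
     (harmonic a m x * (?C (Suc m) * (- 2 * \<kappa> * (b \<bullet> b)) + (?C (Suc (Suc m)) * (- 2 * \<kappa> * (x \<bullet> b))) * (- 2 * \<kappa> * (x \<bullet> b)))
       + ?H b * (?C (Suc m) * (- 2 * \<kappa> * (x \<bullet> b))))" if b: "b \<in> Basis" for b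
  proof -
    have lin: "((\<lambda>x. - 2 * \<kappa> * (x \<bullet> b)) has_derivative (\<lambda>h. - 2 * \<kappa> * (h \<bullet> b))) (at x)"
      by (auto intro!: derivative_eq_intros)
    show ?thesis
      unfolding disk_mode_gradient_inner[OF b]
      by (subst frechet_derivativeI[OF has_derivative_add[OF
            has_derivative_mult[OF harmonic_has_derivative bessel_clifford_norm_sq_has_derivative]
            has_derivative_mult[OF harmonic_has_derivative
              has_derivative_mult[OF bessel_clifford_norm_sq_has_derivative lin]]]]) simp
  qed
  have H2: "?H2 (axis 1 1) + ?H2 (axis 2 1) = 0"
    by (simp add: harmonic_def to_complex_def axis_def)
  have "(\<Sum>b\<in>Basis. frechet_derivative (\<lambda>x. disk_mode_gradient a m \<kappa> x \<bullet> b) (at x) b) =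
     (?H2 (axis 1 1) + ?H2 (axis 2 1)) * ?C m
     + 2 * ?C (Suc m) * (- 2 * \<kappa>) * (x $ 1 * ?H (axis 1 1) + x $ 2 * ?H (axis 2 1))
     + harmonic a m x * (2 * ?C (Suc m) * (- 2 * \<kappa>) + ?C (Suc (Suc m)) * (4 * \<kappa>^2) * (x $ 1 * x $ 1 + x $ 2 * x $ 2))"
    unfolding sum_Basis_2 by (subst (1 2) D) (auto simp: inner_axis axis_in_Basis_iff algebra_simps power2_eq_square)
  also have "\<dots> = - (4 * \<kappa>) * harmonic a m x * ((real m + 1) * ?C (m + 1) + (- \<kappa> * (x \<bullet> x)) * ?C (m + 2))"
    unfolding H2 harmonic_euler inner_2[symmetric] by (simp add: algebra_simps power2_eq_square)
  finally show ?thesis unfolding bessel_clifford_rec[symmetric] by (simp add: disk_mode_def)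
qed

text \<open>In terms of the Bessel function \<open>J\<^sub>m\<close> this says \<open>\<lambda> J\<^sub>m' \<lambda> = 0\<close> for \<open>\<lambda> = 2 \<surd>\<kappa>\<close>, except that \<open>\<kappa> = 0\<close>
  is admitted only for \<open>m = 0\<close>.\<close>

definition neumann_condition :: "nat \<Rightarrow> real \<Rightarrow> bool" where
  "neumann_condition m \<kappa> \<longleftrightarrow> real m * bessel_clifford m (- \<kappa>) = 2 * \<kappa> * bessel_clifford (Suc m) (- \<kappa>)"

lemma disk_mode_neumann_eigenspace:
  assumes "neumann_condition m \<kappa>"
  shows "disk_mode a m \<kappa> \<in> neumann_eigenspace unit_disk (4 * \<kappa>)"
proof -
  \<comment> \<open>Here r stands for |x|^2, and \<open>\<psi>\<close> is the radial factor in
    \<open>disk_mode_radial\<close>. The Neumann condition is \<open>\<psi> 1 = 0\<close>, so the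
    mean value theorem gives decay proportional to 1 - r.\<close>
  define \<psi> where "\<psi> r = real m * bessel_clifford m (- \<kappa> * r) - 2 * \<kappa> * r * bessel_clifford (Suc m) (- \<kappa> * r)" for r
  define \<psi>' where "\<psi>' r = real m * (bessel_clifford (Suc m) (- \<kappa> * r) * (- \<kappa>)) -
      (2 * \<kappa> * bessel_clifford (Suc m) (- \<kappa> * r) + 2 * \<kappa> * r * (bessel_clifford (Suc (Suc m)) (- \<kappa> * r) * (- \<kappa>)))" for r
  have d: "(\<psi> has_real_derivative \<psi>' r) (at r)" for r
    unfolding \<psi>_def \<psi>'_def
    by (auto intro!: derivative_eq_intros DERIV_chain2[OF bessel_clifford_deriv] simp: algebra_simps)
  have "continuous_on {0..1} \<psi>'"
    unfolding \<psi>'_def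
    by (intro continuous_intros continuous_on_compose2[OF continuous_on_bessel_clifford[of UNIV]]) auto
  then have "compact (\<psi>' ` {0..1})" by (intro compact_continuous_image) auto
  then obtain K where K: "\<And>r. r \<in> {0..1} \<Longrightarrow> \<bar>\<psi>' r\<bar> \<le> K"
    using compact_imp_bounded bounded_real by (metis image_eqI)
  have \<psi>1: "\<psi> 1 = 0" using assms by (simp add: \<psi>_def neumann_condition_def)
  have \<psi>_bound: "\<bar>\<psi> r\<bar> \<le> K * (1 - r)" if r: "0 \<le> r" "r < 1" for r
  proof -
    obtain z where z: "r < z" "z < 1" "\<psi> 1 - \<psi> r = (1 - r) * \<psi>' z"
      using MVT2[of r 1 \<psi> \<psi>'] r d by blast
    then have "\<bar>\<psi> r\<bar> = \<bar>\<psi>' z\<bar> * (1 - r)" using \<psi>1 r by (simp add: abs_mult flip: abs_minus_cancel[of "\<psi> r"])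
    also have "\<dots> \<le> K * (1 - r)" using K[of z] r z by (intro mult_right_mono) auto
    finally show ?thesis .
  qed
  have K0: "K \<ge> 0" using K[of 0] by auto
  show ?thesis unfolding unit_disk_def
  proof (rule neumann_eigenspaceI[where g = "disk_mode_gradient a m \<kappa>"])
    show "smooth (disk_mode a m \<kappa>)" by (rule smooth_disk_mode)
    show "disk_mode_gradient a m \<kappa> x \<bullet> b = frechet_derivative (disk_mode a m \<kappa>) (at x) b" if "b \<in> Basis" for x b
      using that unfolding disk_mode_gradient_def by (simp only: inner_sum_left_Basis)
    show "(\<Sum>b\<in>Basis. frechet_derivative (\<lambda>x. disk_mode_gradient a m \<kappa> x \<bullet> b) (at x) b) = - (4 * \<kappa>) * disk_mode a m \<kappa> x" for x
      by (rule disk_mode_laplacian)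
    show "\<bar>x \<bullet> disk_mode_gradient a m \<kappa> x\<bar> \<le> (cmod a * K) * (1 - x \<bullet> x)" if x: "x \<in> ball 0 1" for x
    proof -
      have xx: "0 \<le> x \<bullet> x" "x \<bullet> x < 1" using x by (auto simp: norm_eq_sqrt_inner)
      have "cmod (to_complex x) = norm x"
        by (simp add: to_complex_def cmod_def norm_eq_sqrt_inner inner_2 power2_eq_square)
      then have "cmod (to_complex x) ^ m \<le> 1" using x by (simp add: power_le_one)
      then have "\<bar>harmonic a m x\<bar> \<le> cmod a * 1"
        unfolding harmonic_def by (intro order_trans[OF abs_Re_le_cmod]) (simp add: norm_mult norm_power mult_left_le)
      then have "\<bar>harmonic a m x\<bar> * \<bar>\<psi> (x \<bullet> x)\<bar> \<le> (cmod a * 1) * (K * (1 - x \<bullet> x))"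
        using \<psi>_bound[OF xx] by (intro mult_mono) auto
      then show ?thesis unfolding disk_mode_radial by (simp add: \<psi>_def abs_mult mult_ac)
    qed
  qed
qed

section \<open>Independence of the modes and multiplicity\<close>

lemma continuous_AE_eq_0:
  fixes f :: "'a::euclidean_space \<Rightarrow> real"
  assumes "continuous_on UNIV f" "AE x in lebesgue_on (ball c r). f x = 0" "x \<in> ball c r"
  shows "f x = 0"
proof (rule ccontr)
  assume "f x \<noteq> 0"
  define S where "S = ball c r \<inter> {x. f x \<noteq> 0}"
  have "open {x. f x \<noteq> 0}" using assms(1) by (intro open_Collect_neq continuous_on_const)
  then have "open S" "S \<noteq> {}" using assms(3) \<open>f x \<noteq> 0\<close> by (auto simp: S_def)
  have "AE x in lebesgue. x \<in> ball c r \<longrightarrow> f x = 0"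
    using assms(2) by (simp add: AE_restrict_space_iff)
  then obtain N where "{x. \<not> (x \<in> ball c r \<longrightarrow> f x = 0)} \<subseteq> N" "N \<in> null_sets lebesgue"
    by (auto elim!: AE_E3 simp: eventually_ae_filter)
  then have "negligible S"
    by (intro negligible_subset[of N S]) (auto simp: S_def negligible_iff_null_sets)
  with open_not_negligible[OF \<open>open S\<close> \<open>S \<noteq> {}\<close>] show False by simp
qed

text \<open>Multiplication by - \<i> exchanges real and imaginary part, so the flag selects the sine
  mode.\<close>

definition mode_coeff :: "bool \<Rightarrow> complex" where
  "mode_coeff p = (if p then - \<i> else 1)"

text \<open>The sine mode of order 0 is the zero function and has to be left out.\<close>

definition disk_modes :: "real \<Rightarrow> (nat \<times> bool) set" where
  "disk_modes \<kappa> = {(m, p). neumann_condition m \<kappa> \<and> (p \<longrightarrow> m \<noteq> 0)}"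

lemma disk_mode_polar:
  "disk_mode (mode_coeff p) m \<kappa> (vector [t * cos \<theta>, t * sin \<theta>]) =
     t ^ m * (if p then sin (m * \<theta>) else cos (m * \<theta>)) * bessel_clifford m (- \<kappa> * t\<^sup>2)"
proof -
  have "to_complex (vector [t * cos \<theta>, t * sin \<theta>]) = of_real t * cis \<theta>"
    by (simp add: to_complex_def complex_eq_iff)
  moreover have "vector [t * cos \<theta>, t * sin \<theta>] \<bullet> (vector [t * cos \<theta>, t * sin \<theta>] :: real^2) = t\<^sup>2"
    by (simp add: inner_2 power2_eq_square algebra_simps flip: distrib_left)
  ultimately show ?thesis
    by (auto simp: disk_mode_def harmonic_def mode_coeff_def power_mult_distrib Complex.DeMoivre simp flip: of_real_power)
qed

text \<open>A nontrivial combination is excluded by its lowest order term at the origin.\<close>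

lemma disk_modes_independent:
  assumes I: "finite I" "I \<subseteq> disk_modes \<kappa>"
    and z: "\<And>x. x \<in> unit_disk \<Longrightarrow> (\<Sum>(m, p)\<in>I. c (m, p) * disk_mode (mode_coeff p) m \<kappa> x) = 0"
    and "i \<in> I"
  shows "c i = 0"
proof (rule ccontr)
  assume "c i \<noteq> 0"
  define P where "P m \<longleftrightarrow> (\<exists>p. (m, p) \<in> I \<and> c (m, p) \<noteq> 0)" for m
  have "P (fst i)" using \<open>i \<in> I\<close> \<open>c i \<noteq> 0\<close> by (cases i) (auto simp: P_def)
  then obtain m0 where m0: "P m0" and least: "\<And>m. m < m0 \<Longrightarrow> \<not> P m"
    using exists_least_iff[of P] by blast
  define tr where "tr p m \<theta> = (if p then sin (real m * \<theta>) else cos (real m * \<theta>))" for p m \<theta>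
  have lim0: "(\<Sum>(m, p)\<in>I. if m = m0 then c (m, p) * tr p m \<theta> / fact m else 0) = 0" for \<theta>
  proof -
    \<comment> \<open>The terms of the combination on a ray, divided by \<open>t ^ m0\<close>.
      Orders below \<open>m0\<close> have zero coefficients, so the truncated exponent does no harm,
      and at t = 0 only the order \<open>m0\<close> survives.\<close>
    define f where "f t i = (case i of (m, p) \<Rightarrow> c (m, p) * (t ^ (m - m0) * tr p m \<theta> * bessel_clifford m (- \<kappa> * t\<^sup>2)))"
      for t :: real and i
    have f0: "sum (f t) I = 0" if t: "0 < t" "t < 1" for t
    proof -
      have "vector [t * cos \<theta>, t * sin \<theta>] \<in> unit_disk"
      proof -
        have "vector [t * cos \<theta>, t * sin \<theta>] \<bullet> (vector [t * cos \<theta>, t * sin \<theta>] :: real^2) = t\<^sup>2"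
          by (simp add: inner_2 power2_eq_square algebra_simps flip: distrib_left)
        then show ?thesis using t by (simp add: unit_disk_def norm_eq_sqrt_inner)
      qed
      from z[OF this] have "0 = (\<Sum>(m, p)\<in>I. c (m, p) * (t ^ m * tr p m \<theta> * bessel_clifford m (- \<kappa> * t\<^sup>2)))"
        by (simp only: disk_mode_polar tr_def)
      also have "\<dots> = (\<Sum>i\<in>I. t ^ m0 * f t i)"
      proof (rule sum.cong)
        fix i assume "i \<in> I"
        obtain m p where i: "i = (m, p)" by (cases i)
        show "(case i of (m, p) \<Rightarrow> c (m, p) * (t ^ m * tr p m \<theta> * bessel_clifford m (- \<kappa> * t\<^sup>2))) = t ^ m0 * f t i"
        proof (cases "m < m0")
          case True
          then show ?thesis using least[of m] \<open>i \<in> I\<close> by (auto simp: P_def i f_def)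
        next
          case False
          then have "t ^ m = t ^ m0 * t ^ (m - m0)" by (simp flip: power_add)
          then show ?thesis by (simp add: i f_def mult_ac)
        qed
      qed simp
      finally show ?thesis using t by (simp flip: sum_distrib_left)
    qed
    have "((\<lambda>t. sum (f t) I) \<longlongrightarrow> (\<Sum>i\<in>I. f 0 i)) (at_right 0)"
    proof (rule tendsto_sum)
      fix i assume "i \<in> I"
      have "isCont (\<lambda>t. f t i) 0"
        unfolding f_def by (cases i)
         (auto intro!: continuous_intros isCont_o2[OF _ DERIV_isCont[OF bessel_clifford_deriv]])
      then show "((\<lambda>t. f t i) \<longlongrightarrow> f 0 i) (at_right 0)"
        unfolding isCont_def by (rule filterlim_mono) (auto simp: at_within_le_at)
    qed
    moreover have "\<forall>\<^sub>F t in at_right 0. sum (f t) I = 0"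
      using f0 by (auto simp: eventually_at_right_field intro: exI[of _ 1])
    ultimately have "(\<Sum>i\<in>I. f 0 i) = 0"
      by (metis tendsto_eventually tendsto_unique trivial_limit_at_right_real)
    moreover have "(\<Sum>i\<in>I. f 0 i) = (\<Sum>(m, p)\<in>I. if m = m0 then c (m, p) * tr p m \<theta> / fact m else 0)"
    proof (rule sum.cong)
      fix i assume "i \<in> I"
      obtain m p where i: "i = (m, p)" by (cases i)
      show "f 0 i = (case i of (m, p) \<Rightarrow> if m = m0 then c (m, p) * tr p m \<theta> / fact m else 0)"
        using least[of m] \<open>i \<in> I\<close> by (cases "m < m0") (auto simp: P_def i f_def bessel_clifford_0 power_0_left)
    qed simp
    ultimately show ?thesis by simp
  qed
  define cf where "cf p = (if (m0, p) \<in> I then c (m0, p) else 0)" for p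
  have split: "(\<Sum>(m, p)\<in>I. if m = m0 then c (m, p) * tr p m \<theta> / fact m else 0) =
      (cf False * cos (real m0 * \<theta>) + cf True * sin (real m0 * \<theta>)) / fact m0" for \<theta>
  proof -
    have "(\<Sum>(m, p)\<in>I. if m = m0 then c (m, p) * tr p m \<theta> / fact m else 0) =
      (\<Sum>i\<in>I \<union> {(m0, False), (m0, True)}. if i \<in> I \<and> fst i = m0 then c i * tr (snd i) m0 \<theta> / fact m0 else 0)"
      using I(1) by (intro sum.mono_neutral_cong_left) (auto)
    also have "\<dots> = (\<Sum>i\<in>{(m0, False), (m0, True)}. if i \<in> I \<and> fst i = m0 then c i * tr (snd i) m0 \<theta> / fact m0 else 0)"
      using I(1) by (intro sum.mono_neutral_cong_right) (auto)
    also have "\<dots> = (cf False * cos (real m0 * \<theta>) + cf True * sin (real m0 * \<theta>)) / fact m0"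
      by (simp add: cf_def tr_def add_divide_distrib)
    finally show ?thesis .
  qed
  have eq: "cf False * cos (real m0 * \<theta>) + cf True * sin (real m0 * \<theta>) = 0" for \<theta>
    using lim0[of \<theta>] unfolding split by simp
  have F: "cf False = 0" using eq[of 0] by simp
  have T: "cf True = 0"
  proof (cases "m0 = 0")
    case True
    then show ?thesis using I(2) by (auto simp: cf_def disk_modes_def)
  next
    case False
    then show ?thesis using eq[of "pi / (2 * real m0)"] by simp
  qed
  obtain p where "(m0, p) \<in> I" "c (m0, p) \<noteq> 0" using m0 by (auto simp: P_def)
  then show False using F T by (cases p) (auto simp: cf_def)
qed

lemma card_disk_modes_le_multiplicity:
  assumes I: "finite I" "I \<subseteq> disk_modes \<kappa>"
  shows "enat (card I) \<le> neumann_multiplicity unit_disk (4 * \<kappa>)"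
proof -
  obtain h where h: "bij_betw h {..<card I} I"
    using ex_bij_betw_nat_finite[OF I(1)] by (auto simp: atLeast0LessThan)
  define u where "u j = (case h j of (m, p) \<Rightarrow> disk_mode (mode_coeff p) m \<kappa>)" for j
  have "u j \<in> neumann_eigenspace unit_disk (4 * \<kappa>)" if "j < card I" for j
  proof -
    obtain m p where mp: "h j = (m, p)" by (cases "h j")
    then have "(m, p) \<in> disk_modes \<kappa>" using bij_betwE[OF h] that I(2) by auto
    then show ?thesis by (auto simp: u_def mp disk_modes_def intro: disk_mode_neumann_eigenspace)
  qed
  moreover have "ae_independent unit_disk (card I) u"
    unfolding ae_independent_def
  proof (intro allI impI)
    fix c :: "nat \<Rightarrow> real" and j
    assume AE: "AE x in lebesgue_on unit_disk. (\<Sum>i<card I. c i * u i x) = 0" and j: "j < card I"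
    define d where "d i = c (inv_into {..<card I} h i)" for i
    have hinv: "inv_into {..<card I} h (h i) = i" if "i < card I" for i
      using h that by (simp add: bij_betw_def inv_into_f_f)
    have eq: "(\<Sum>(m, p)\<in>I. d (m, p) * disk_mode (mode_coeff p) m \<kappa> x) = (\<Sum>i<card I. c i * u i x)" for x
    proof -
      have "(\<Sum>i<card I. c i * u i x) = (\<Sum>i<card I. (case h i of (m, p) \<Rightarrow> d (m, p) * disk_mode (mode_coeff p) m \<kappa> x))"
        by (intro sum.cong) (auto simp: u_def d_def split_beta hinv)
      also have "\<dots> = (\<Sum>(m, p)\<in>I. d (m, p) * disk_mode (mode_coeff p) m \<kappa> x)"
        by (rule sum.reindex_bij_betw[OF h, of "\<lambda>i. case i of (m, p) \<Rightarrow> d (m, p) * disk_mode (mode_coeff p) m \<kappa> x"])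
      finally show ?thesis by simp
    qed
    have "d (h j) = 0"
    proof (rule disk_modes_independent[OF I, where c = d])
      show "h j \<in> I" using bij_betwE[OF h] j by auto
      fix x assume x: "x \<in> unit_disk"
      have "continuous_on UNIV (\<lambda>x. \<Sum>(m, p)\<in>I. d (m, p) * disk_mode (mode_coeff p) m \<kappa> x)"
        by (auto intro!: continuous_intros smoothD(3)[OF smooth_disk_mode] simp: split_beta)
      then show "(\<Sum>(m, p)\<in>I. d (m, p) * disk_mode (mode_coeff p) m \<kappa> x) = 0"
        using AE x unfolding eq unit_disk_def by (rule continuous_AE_eq_0)
    qed
    then show "c j = 0" using hinv[OF j] by (simp add: d_def)
  qed
  ultimately show ?thesis unfolding neumann_multiplicity_def by (intro Sup_upper) blast
qed

section \<open>From multiplicities to the counting function\<close>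

lemma sum_multiplicity_le_infsum:
  assumes "finite T" "T \<subseteq> {..t}"
  shows "(\<Sum>\<mu>\<in>T. neumann_multiplicity \<Omega> \<mu>) \<le> (\<Sum>\<^sub>\<infinity>\<mu>\<in>{..t}. neumann_multiplicity \<Omega> \<mu>)"
  using assms by (subst nonneg_infsum_complete) (auto intro: SUP_upper)

text \<open>If the total multiplicity up to \<open>\<Lambda>\<^sup>2\<close> is at least N, then
  \<open>\<Lambda>\<^sup>2\<close> belongs to the set whose infimum defines the n-th eigenvalue, for
  each n up to N.\<close>

lemma neumann_counting_ge:
  assumes "enat N \<le> (\<Sum>\<^sub>\<infinity>\<mu>\<in>{..\<Lambda>\<^sup>2}. neumann_multiplicity \<Omega> \<mu>)"
  shows "of_nat N \<le> neumann_counting \<Omega> \<Lambda>"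
proof -
  have sub: "{1..N} \<subseteq> {n. 1 \<le> n \<and> neumann_eigenvalue \<Omega> n \<le> ereal (\<Lambda>\<^sup>2)}"
  proof safe
    fix n assume n: "n \<in> {1..N}"
    then have "enat n \<le> enat N" by simp
    also note assms
    finally show "neumann_eigenvalue \<Omega> n \<le> ereal (\<Lambda>\<^sup>2)"
      unfolding neumann_eigenvalue_def by (intro Inf_lower) blast
  qed auto
  have "emeasure (count_space UNIV) {1..N} \<le> neumann_counting \<Omega> \<Lambda>"
    unfolding neumann_counting_def using sub by (intro emeasure_mono) auto
  then show ?thesis by (simp add: emeasure_count_space)
qed

text \<open>The triples are grouped by \<kappa>: multiplicities of different eigenvalues are added,
  so independence only concerns the modes with a common \<kappa>.\<close>

lemma neumann_counting_unit_disk_ge: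
  assumes Z: "finite Z" "\<And>m p \<kappa>. (m, p, \<kappa>) \<in> Z \<Longrightarrow> (m, p) \<in> disk_modes \<kappa> \<and> 4 * \<kappa> \<le> \<Lambda>\<^sup>2"
  shows "of_nat (card Z) \<le> neumann_counting unit_disk \<Lambda>"
proof (rule neumann_counting_ge)
  define K where "K = (\<lambda>(m, p, \<kappa>). \<kappa>) ` Z"
  define I where "I \<kappa> = {(m, p). (m, p, \<kappa>) \<in> Z}" for \<kappa>
  have finK: "finite K" using Z(1) by (simp add: K_def)
  have finI: "finite (I \<kappa>)" for \<kappa>
    by (rule finite_subset[of _ "(\<lambda>(m, p, \<kappa>). (m, p)) ` Z"]) (use Z(1) in \<open>force simp: I_def\<close>)+
  have "card Z = card (SIGMA \<kappa>:K. I \<kappa>)"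
    by (rule bij_betw_same_card[of "\<lambda>(m, p, \<kappa>). (\<kappa>, m, p)"])
      (force simp: bij_betw_def inj_on_def K_def I_def image_iff)
  also have "\<dots> = (\<Sum>\<kappa>\<in>K. card (I \<kappa>))" using finK finI by (intro card_SigmaI) auto
  finally have "enat (card Z) = (\<Sum>\<kappa>\<in>K. enat (card (I \<kappa>)))"
    by (simp add: of_nat_eq_enat[symmetric])
  also have "\<dots> \<le> (\<Sum>\<kappa>\<in>K. neumann_multiplicity unit_disk (4 * \<kappa>))"
    by (intro sum_mono card_disk_modes_le_multiplicity finI) (use Z(2) in \<open>auto simp: I_def\<close>)
  also have "\<dots> = (\<Sum>\<mu>\<in>(*) 4 ` K. neumann_multiplicity unit_disk \<mu>)"
    by (subst sum.reindex) (auto simp: inj_on_def)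
  also have "\<dots> \<le> (\<Sum>\<^sub>\<infinity>\<mu>\<in>{..\<Lambda>\<^sup>2}. neumann_multiplicity unit_disk \<mu>)"
    using finK Z(2) by (intro sum_multiplicity_le_infsum) (auto simp: K_def)
  finally show "enat (card Z) \<le> (\<Sum>\<^sub>\<infinity>\<mu>\<in>{..\<Lambda>\<^sup>2}. neumann_multiplicity unit_disk \<mu>)" .
qed

section \<open>Bessel functions and their derivatives\<close>

definition bessel_J :: "nat \<Rightarrow> real \<Rightarrow> real" where
  "bessel_J m x = (x / 2) ^ m * bessel_clifford m (- (x\<^sup>2 / 4))"

text \<open>This is x J_m'(x), expressed through J_(m+1). The factor x keeps it continuous at 0 and
  gives Bessel's equation a first-order form.\<close>

definition bessel_D :: "nat \<Rightarrow> real \<Rightarrow> real" where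
  "bessel_D m x = real m * bessel_J m x - x * bessel_J (Suc m) x"

lemma bessel_J_rec:
  assumes "x \<noteq> 0"
  shows "bessel_J (m + 2) x = 2 * (real m + 1) / x * bessel_J (m + 1) x - bessel_J m x"
proof -
  define h where "h = x / 2"
  have h: "h \<noteq> 0" "x = 2 * h" using assms by (auto simp: h_def)
  have C: "bessel_clifford m (- h\<^sup>2) = (real m + 1) * bessel_clifford (m + 1) (- h\<^sup>2) - h\<^sup>2 * bessel_clifford (m + 2) (- h\<^sup>2)"
    using bessel_clifford_rec[of m "- h\<^sup>2"] by simp
  have J: "bessel_J k x = h ^ k * bessel_clifford k (- h\<^sup>2)" for k
    by (simp add: bessel_J_def h_def power_divide)
  show ?thesis using h(1)
    unfolding J C unfolding h(2) by (simp add: field_simps power2_eq_square)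
qed

lemma bessel_clifford_sq_deriv:
  "((\<lambda>x. bessel_clifford m (- (x\<^sup>2 / 4))) has_real_derivative
     - (x / 2) * bessel_clifford (Suc m) (- (x\<^sup>2 / 4))) (at x)"
proof -
  have "((\<lambda>x. - (x\<^sup>2 / 4)) has_real_derivative - (x / 2)) (at x)"
    by (auto intro!: derivative_eq_intros)
  from DERIV_chain2[OF bessel_clifford_deriv this] show ?thesis by (simp add: mult.commute)
qed

lemma bessel_J_deriv:
  assumes "x \<noteq> 0"
  shows "(bessel_J m has_real_derivative bessel_D m x / x) (at x)"
proof -
  have d: "((\<lambda>x. (x / 2) ^ m * bessel_clifford m (- (x\<^sup>2 / 4))) has_real_derivative
     real m * (x / 2) ^ (m - 1) * (1 / 2) * bessel_clifford m (- (x\<^sup>2 / 4))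
     + - (x / 2) * bessel_clifford (Suc m) (- (x\<^sup>2 / 4)) * (x / 2) ^ m) (at x)"
    by (intro DERIV_mult bessel_clifford_sq_deriv) (auto intro!: derivative_eq_intros)
  have e1: "real m * (x / 2) ^ (m - 1) * (1 / 2) = real m * (x / 2) ^ m / x"
    using assms by (cases m) (auto simp: field_simps)
  have e2: "real m * (x / 2) ^ m / x * bessel_clifford m (- (x\<^sup>2 / 4))
     + - (x / 2) * bessel_clifford (Suc m) (- (x\<^sup>2 / 4)) * (x / 2) ^ m = bessel_D m x / x"
    using assms by (simp add: bessel_J_def bessel_D_def diff_divide_distrib mult_ac)
  from d show ?thesis unfolding e1 e2 by (simp only: bessel_J_def[abs_def])
qed

text \<open>Bessel's equation in the form x (x J_m')' = (m^2 - x^2) J_m.\<close>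

lemma bessel_D_deriv:
  assumes "x \<noteq> 0"
  shows "(bessel_D m has_real_derivative ((real m)\<^sup>2 - x\<^sup>2) / x * bessel_J m x) (at x)"
proof -
  have "(bessel_D m has_real_derivative
      real m * (bessel_D m x / x) - (bessel_J (Suc m) x + bessel_D (Suc m) x / x * x)) (at x)"
    unfolding bessel_D_def[abs_def]
    by (rule derivative_eq_intros bessel_J_deriv[unfolded bessel_D_def[abs_def]] assms refl)+ (simp add: bessel_D_def)
  moreover have "real m * (bessel_D m x / x) - (bessel_J (Suc m) x + bessel_D (Suc m) x / x * x)
      = ((real m)\<^sup>2 - x\<^sup>2) / x * bessel_J m x"
  proof -
    have J: "bessel_J (Suc (Suc m)) x = 2 * (real m + 1) / x * bessel_J (Suc m) x - bessel_J m x"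
      using bessel_J_rec[OF assms, of m] by simp
    show ?thesis using assms unfolding bessel_D_def J by (simp add: field_simps power2_eq_square)
  qed
  ultimately show ?thesis by simp
qed

lemma continuous_on_bessel_J: "continuous_on S (bessel_J m)"
  unfolding bessel_J_def[abs_def]
  by (intro continuous_intros continuous_on_compose2[OF continuous_on_bessel_clifford[of UNIV]]) auto

lemma continuous_on_bessel_D: "continuous_on S (bessel_D m)"
  unfolding bessel_D_def[abs_def] by (intro continuous_intros continuous_on_bessel_J)

lemma neumann_condition_iff_bessel_D:
  assumes "x > 0" shows "neumann_condition m (x\<^sup>2 / 4) \<longleftrightarrow> bessel_D m x = 0"
proof -
  have "bessel_D m x = (x / 2) ^ m * (real m * bessel_clifford m (- (x\<^sup>2 / 4))
      - 2 * (x\<^sup>2 / 4) * bessel_clifford (Suc m) (- (x\<^sup>2 / 4)))"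
    by (simp add: bessel_D_def bessel_J_def field_simps power2_eq_square)
  then show ?thesis using assms by (simp add: neumann_condition_def)
qed

text \<open>By the recurrence a common zero would propagate to all higher orders, contradicting
  \<open>M! C\<^sub>M t \<longrightarrow> 1\<close>.\<close>

lemma bessel_clifford_no_common_zero:
  assumes "t \<noteq> 0" "bessel_clifford m t = 0" "bessel_clifford (Suc m) t = 0"
  shows False
proof -
  have "bessel_clifford (m + k) t = 0 \<and> bessel_clifford (Suc (m + k)) t = 0" for k
  proof (induction k)
    case (Suc k)
    then show ?case using bessel_clifford_rec[of "m + k" t] assms(1) by auto
  qed (use assms in auto)
  then have z: "bessel_clifford (m + k) t = 0" for k by blast
  \<comment> \<open>At order M the terms after the first are at most (exp |t| - 1)/(M + 1) times the
    first term 1/M!, so M at least exp |t| leaves no room for a zero.\<close>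
  define M where "M = m + nat \<lceil>exp \<bar>t\<bar>\<rceil>"
  have M: "exp \<bar>t\<bar> \<le> real M" unfolding M_def by linarith
  let ?f = "\<lambda>k. 1 / (fact k * fact (k + M)) * t ^ k"
  have s: "summable ?f" by (rule summable_bessel_clifford)
  have eq: "(\<Sum>k. ?f (Suc k)) = - (1 / fact M)"
    using suminf_split_head[OF s] z[of "M - m"] by (simp add: bessel_clifford_def M_def)
  have g: "(\<lambda>k. (1 / (fact M * (real M + 1))) * (\<bar>t\<bar> ^ Suc k /\<^sub>R fact (Suc k))) sums
      ((1 / (fact M * (real M + 1))) * (exp \<bar>t\<bar> - 1))"
  proof (intro sums_mult)
    have "(\<lambda>k. \<bar>t\<bar> ^ k /\<^sub>R fact k) sums exp \<bar>t\<bar>" by (rule exp_converges)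
    then show "(\<lambda>k. \<bar>t\<bar> ^ Suc k /\<^sub>R fact (Suc k)) sums (exp \<bar>t\<bar> - 1)"
      by (subst sums_Suc_iff) simp
  qed
  have le: "norm (?f (Suc k)) \<le> (1 / (fact M * (real M + 1))) * (\<bar>t\<bar> ^ Suc k /\<^sub>R fact (Suc k))" for k
  proof -
    have "fact (Suc M) \<le> (fact (Suc k + M) :: real)" by (intro fact_mono) simp
    then have "fact M * (real M + 1) \<le> (fact (Suc k + M) :: real)" by (simp add: algebra_simps)
    then have "1 / (fact (Suc k + M) :: real) \<le> 1 / (fact M * (real M + 1))"
      by (intro divide_left_mono mult_pos_pos) auto
    then have "1 / (fact (Suc k + M)) * (\<bar>t\<bar> ^ Suc k / fact (Suc k)) \<le> 1 / (fact M * (real M + 1)) * (\<bar>t\<bar> ^ Suc k / fact (Suc k))"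
      by (intro mult_right_mono) auto
    then show ?thesis by (simp add: abs_mult power_abs divide_inverse mult_ac del: fact_Suc power_Suc)
  qed
  have "norm (\<Sum>k. ?f (Suc k)) \<le> (\<Sum>k. (1 / (fact M * (real M + 1))) * (\<bar>t\<bar> ^ Suc k /\<^sub>R fact (Suc k)))"
    by (rule norm_suminf_le[OF le]) (use g in \<open>simp add: sums_iff\<close>)
  also have "\<dots> = (1 / (fact M * (real M + 1))) * (exp \<bar>t\<bar> - 1)" using g by (simp add: sums_iff)
  also have "\<dots> < 1 / fact M" using M by (simp add: divide_simps)
  finally show False unfolding eq by simp
qed

lemma bessel_J_no_double_zero:
  assumes "x > 0" "bessel_J m x = 0" "bessel_D m x = 0"
  shows False
proof (rule bessel_clifford_no_common_zero)
  show "- (x\<^sup>2 / 4) \<noteq> 0" using assms by simp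
  show "bessel_clifford m (- (x\<^sup>2 / 4)) = 0" using assms by (simp add: bessel_J_def)
  have "bessel_J (Suc m) x = 0" using assms by (simp add: bessel_D_def)
  then show "bessel_clifford (Suc m) (- (x\<^sup>2 / 4)) = 0" using assms by (simp add: bessel_J_def)
qed

text \<open>The product of J_m and x J_m' vanishes at 0 and has derivative (D^2 + (m^2 - x^2)
  J^2)/x, which is positive for 0 < x < m. All positive zeros of D therefore lie beyond m, where the
  phase is defined and increasing.\<close>

lemma bessel_D_nonzero:
  assumes "0 < x" "x \<le> real m"
  shows "bessel_D m x \<noteq> 0"
proof -
  have "bessel_J m 0 * bessel_D m 0 < bessel_J m x * bessel_D m x"
  proof (rule DERIV_pos_imp_increasing_open[OF assms(1)])
    fix y assume y: "0 < y" "y < x"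
    have "((\<lambda>y. bessel_J m y * bessel_D m y) has_real_derivative
       (bessel_D m y)\<^sup>2 / y + ((real m)\<^sup>2 - y\<^sup>2) / y * (bessel_J m y)\<^sup>2) (at y)"
      using y by (auto intro!: derivative_eq_intros bessel_J_deriv bessel_D_deriv simp: field_simps power2_eq_square)
    moreover have "(bessel_D m y)\<^sup>2 / y + ((real m)\<^sup>2 - y\<^sup>2) / y * (bessel_J m y)\<^sup>2 > 0"
    proof -
      have "(real m)\<^sup>2 - y\<^sup>2 > 0" using y assms by (simp add: power_strict_mono)
      moreover have "bessel_J m y \<noteq> 0 \<or> bessel_D m y \<noteq> 0" using bessel_J_no_double_zero y by blast
      ultimately show ?thesis using y
        by (cases "bessel_J m y = 0") (auto intro!: add_nonneg_pos)
    qed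
    ultimately show "\<exists>z. ((\<lambda>y. bessel_J m y * bessel_D m y) has_real_derivative z) (at y) \<and> 0 < z" by blast
  qed (intro continuous_intros continuous_on_bessel_J continuous_on_bessel_D)
  moreover have "m \<noteq> 0" using assms by auto
  then have "bessel_J m 0 = 0" by (simp add: bessel_J_def)
  ultimately show ?thesis by auto
qed

section \<open>Asymptotic phase\<close>

text \<open>The bound M/x^2 is integrable at infinity: f - M/x increases, f + M/x decreases, and
  their difference tends to 0.\<close>

lemma tendsto_at_top_of_deriv_bound:
  fixes f f' :: "real \<Rightarrow> real"
  assumes d: "\<And>x. x \<ge> 1 \<Longrightarrow> (f has_real_derivative f' x) (at x)"
    and b: "\<And>x. x \<ge> 1 \<Longrightarrow> \<bar>f' x\<bar> \<le> M / x\<^sup>2"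
  shows "\<exists>L. (f \<longlongrightarrow> L) at_top"
proof -
  define g where "g x = f x - M / x" for x
  have M: "M \<ge> 0" using b[of 1] by simp
  have g_mono: "g x \<le> g y" if "1 \<le> x" "x \<le> y" for x y
  proof (rule DERIV_nonneg_imp_nondecreasing[OF that(2)])
    fix z assume "x \<le> z" "z \<le> y"
    then have "(g has_real_derivative f' z + M / z\<^sup>2) (at z)" "0 \<le> f' z + M / z\<^sup>2"
      unfolding g_def using that b[of z]
      by (auto intro!: derivative_eq_intros d simp: power2_eq_square)
    then show "\<exists>d. (g has_real_derivative d) (at z) \<and> 0 \<le> d" by blast
  qed
  have h_mono: "f x + M / x \<ge> f y + M / y" if "1 \<le> x" "x \<le> y" for x y
  proof (rule DERIV_nonpos_imp_nonincreasing[OF that(2)])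
    fix z assume "x \<le> z" "z \<le> y"
    then have "((\<lambda>x. f x + M / x) has_real_derivative f' z - M / z\<^sup>2) (at z)" "f' z - M / z\<^sup>2 \<le> 0"
      using that b[of z] by (auto intro!: derivative_eq_intros d simp: power2_eq_square)
    then show "\<exists>d. ((\<lambda>x. f x + M / x) has_real_derivative d) (at z) \<and> d \<le> 0" by blast
  qed
  have g_bound: "g x \<le> f 1 + M" if "x \<ge> 1" for x
  proof -
    have "0 \<le> M / x" using M that by simp
    then show ?thesis using h_mono[of 1 x] that by (simp add: g_def)
  qed
  have bdd: "bdd_above (g ` {1..})" using g_bound by (auto intro!: bdd_aboveI)
  define L where "L = Sup (g ` {1..})"
  have "(g \<longlongrightarrow> L) at_top"
  proof (rule increasing_tendsto)
    show "\<forall>\<^sub>F x in at_top. g x \<le> L"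
      using eventually_ge_at_top[of 1] by eventually_elim (auto simp: L_def intro!: cSup_upper bdd)
    fix l assume "l < L"
    then obtain x where x: "x \<ge> 1" "l < g x"
      unfolding L_def using less_cSup_iff[OF _ bdd] by auto
    show "\<forall>\<^sub>F x in at_top. l < g x"
      using eventually_ge_at_top[of x] by eventually_elim (use g_mono x in force)
  qed
  moreover have "((\<lambda>x. M / x) \<longlongrightarrow> 0) at_top" by real_asymp
  ultimately have "((\<lambda>x. g x + M / x) \<longlongrightarrow> L + 0) at_top" by (rule tendsto_add)
  then show ?thesis by (auto simp: g_def)
qed

text \<open>The factor \<open>sqrt x\<close> removes the first-order term of Bessel's equation: u''
  + (1 + 1/(4 x^2)) u = 0.\<close>

definition bessel_u :: "real \<Rightarrow> real" where "bessel_u x = sqrt x * bessel_J 0 x"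
definition bessel_u' :: "real \<Rightarrow> real" where
  "bessel_u' x = bessel_J 0 x / (2 * sqrt x) - sqrt x * bessel_J 1 x"

lemma bessel_u_deriv:
  assumes "x > 0" shows "(bessel_u has_real_derivative bessel_u' x) (at x)"
  unfolding bessel_u_def[abs_def]
  by (rule derivative_eq_intros bessel_J_deriv DERIV_real_sqrt refl assms less_imp_neq[OF assms, symmetric])+
    (use assms in \<open>simp add: bessel_u'_def bessel_D_def field_simps\<close>)

lemma bessel_u'_deriv:
  assumes "x > 0" shows "(bessel_u' has_real_derivative - (1 + 1 / (4 * x\<^sup>2)) * bessel_u x) (at x)"
proof -
  have x: "x \<noteq> 0" and s: "sqrt x > 0" "x = sqrt x * sqrt x" using assms by auto
  have "(bessel_u' has_real_derivative
     ((bessel_D 0 x / x * (2 * sqrt x) - bessel_J 0 x * (2 * (inverse (sqrt x) / 2))) / ((2 * sqrt x) * (2 * sqrt x))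
     - (inverse (sqrt x) / 2 * bessel_J 1 x + bessel_D 1 x / x * sqrt x))) (at x)"
    unfolding bessel_u'_def[abs_def] using s
    by (intro DERIV_diff DERIV_divide DERIV_mult DERIV_cmult bessel_J_deriv x DERIV_real_sqrt assms) auto
  moreover have "((bessel_D 0 x / x * (2 * sqrt x) - bessel_J 0 x * (2 * (inverse (sqrt x) / 2))) / ((2 * sqrt x) * (2 * sqrt x))
     - (inverse (sqrt x) / 2 * bessel_J 1 x + bessel_D 1 x / x * sqrt x)) = - (1 + 1 / (4 * x\<^sup>2)) * bessel_u x"
  proof -
    define s where "s = sqrt x"
    have s: "s > 0" "x = s * s" "sqrt x = s" using assms by (auto simp: s_def)
    have D: "bessel_D 0 x = - (s * s) * bessel_J 1 x" "bessel_D 1 x = s * s * bessel_J 0 x - bessel_J 1 x"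
      using bessel_J_rec[OF x, of 0] x by (auto simp: bessel_D_def field_simps numeral_2_eq_2 simp flip: s(2))
    show ?thesis unfolding bessel_u_def D s(3) unfolding s(2) using s(1)
      by (simp add: field_simps power2_eq_square)
  qed
  ultimately show ?thesis by simp
qed

text \<open>The logarithmic derivative of the energy is at most 1/(4 x^2) in absolute value, so the
  energy times exp(-1/(4x)) increases and the energy times exp(1/(4x)) decreases. The lower bound
  later ensures a nonzero amplitude.\<close>

lemma bessel_u_energy:
  obtains c M where "c > 0" "M > 0" "\<And>x. x \<ge> 1 \<Longrightarrow> c \<le> (bessel_u x)\<^sup>2 + (bessel_u' x)\<^sup>2"
    "\<And>x. x \<ge> 1 \<Longrightarrow> (bessel_u x)\<^sup>2 + (bessel_u' x)\<^sup>2 \<le> M\<^sup>2"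
proof -
  define E where "E x = (bessel_u x)\<^sup>2 + (bessel_u' x)\<^sup>2" for x
  define E' where "E' x = - (bessel_u x * bessel_u' x) / (2 * x\<^sup>2)" for x
  have dE: "(E has_real_derivative E' x) (at x)" if "x > 0" for x
    unfolding E_def E'_def using that
    by (auto intro!: derivative_eq_intros bessel_u_deriv bessel_u'_deriv simp: field_simps power2_eq_square)
  have E'_bound: "\<bar>E' x\<bar> \<le> E x / (4 * x\<^sup>2)" if "x > 0" for x
  proof -
    have "2 * \<bar>bessel_u x * bessel_u' x\<bar> \<le> E x"
      using sum_squares_bound[of "\<bar>bessel_u x\<bar>" "\<bar>bessel_u' x\<bar>"] by (simp add: E_def abs_mult)
    then have "2 * \<bar>bessel_u x * bessel_u' x\<bar> / (4 * x\<^sup>2) \<le> E x / (4 * x\<^sup>2)"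
      by (rule divide_right_mono) simp
    then show ?thesis by (simp add: E'_def abs_mult)
  qed
  have lower: "E 1 * exp (- (1 / 4)) \<le> E x * exp (- (1 / (4 * x)))" if "x \<ge> 1" for x
  proof (rule DERIV_nonneg_imp_nondecreasing[of 1 x "\<lambda>x. E x * exp (- (1 / (4 * x)))", simplified, OF that])
    fix z :: real assume z: "1 \<le> z" "z \<le> x"
    have "((\<lambda>x. E x * exp (- (1 / (4 * x)))) has_real_derivative
        (E' z + E z / (4 * z\<^sup>2)) * exp (- (1 / (4 * z)))) (at z)"
      using z by (auto intro!: derivative_eq_intros dE simp: field_simps power2_eq_square)
    moreover have "0 \<le> (E' z + E z / (4 * z\<^sup>2)) * exp (- (1 / (4 * z)))"
      using E'_bound[of z] z by (intro mult_nonneg_nonneg) auto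
    ultimately show "\<exists>y. ((\<lambda>x. E x * exp (- (1 / (4 * x)))) has_real_derivative y) (at z) \<and> 0 \<le> y" by blast
  qed
  have upper: "E x * exp (1 / (4 * x)) \<le> E 1 * exp (1 / 4)" if "x \<ge> 1" for x
  proof (rule DERIV_nonpos_imp_nonincreasing[of 1 x "\<lambda>x. E x * exp (1 / (4 * x))", simplified, OF that])
    fix z :: real assume z: "1 \<le> z" "z \<le> x"
    have "((\<lambda>x. E x * exp (1 / (4 * x))) has_real_derivative
        (E' z - E z / (4 * z\<^sup>2)) * exp (1 / (4 * z))) (at z)"
      using z by (auto intro!: derivative_eq_intros dE simp: field_simps power2_eq_square)
    moreover have "(E' z - E z / (4 * z\<^sup>2)) * exp (1 / (4 * z)) \<le> 0"
      using E'_bound[of z] z by (intro mult_nonpos_nonneg) auto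
    ultimately show "\<exists>y. ((\<lambda>x. E x * exp (1 / (4 * x))) has_real_derivative y) (at z) \<and> y \<le> 0" by blast
  qed
  have E1: "E 1 > 0"
  proof (rule ccontr)
    assume "\<not> E 1 > 0"
    then have "bessel_u 1 = 0" "bessel_u' 1 = 0"
      by (auto simp: E_def not_less sum_power2_le_zero_iff)
    then have "bessel_J 0 1 = 0" "bessel_D 0 1 = 0" by (auto simp: bessel_u_def bessel_u'_def bessel_D_def)
    then show False using bessel_J_no_double_zero[of 1 0] by simp
  qed
  show thesis
  proof (rule that[of "E 1 * exp (- (1 / 4))" "sqrt (E 1 * exp (1 / 4))"])
    fix x :: real assume x: "x \<ge> 1"
    have E0: "E x \<ge> 0" by (simp add: E_def)
    have "E x * exp (- (1 / (4 * x))) \<le> E x * 1" using x E0 by (intro mult_left_mono) auto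
    then show "E 1 * exp (- (1 / 4)) \<le> (bessel_u x)\<^sup>2 + (bessel_u' x)\<^sup>2" using lower[OF x] by (simp add: E_def)
    have "E x * 1 \<le> E x * exp (1 / (4 * x))" using x E0 by (intro mult_left_mono) auto
    then show "(bessel_u x)\<^sup>2 + (bessel_u' x)\<^sup>2 \<le> (sqrt (E 1 * exp (1 / 4)))\<^sup>2"
      using upper[OF x] E1 by (simp add: E_def)
  qed (use E1 in auto)
qed

text \<open>As G may have either sign, the angle matters only modulo pi and can be moved into any
  prescribed half-open interval of that length.\<close>

lemma polar_half_open:
  assumes "a \<noteq> 0 \<or> b \<noteq> (0::real)"
  obtains G \<beta> where "G \<noteq> 0" "\<beta>0 \<le> \<beta>" "\<beta> < \<beta>0 + pi" "a = G * cos \<beta>" "b = G * sin \<beta>"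
proof -
  define z where "z = Complex a b"
  define \<phi> where "\<phi> = Arg z"
  have z: "a = cmod z * cos \<phi>" "b = cmod z * sin \<phi>" "cmod z \<noteq> 0"
    using assms rcis_cmod_Arg[of z] by (auto simp: z_def \<phi>_def rcis_def complex_eq_iff)
  define k where "k = - \<lfloor>(\<phi> - \<beta>0) / pi\<rfloor>"
  define \<beta> where "\<beta> = \<phi> + of_int k * pi"
  have "\<beta> - \<beta>0 = pi * frac ((\<phi> - \<beta>0) / pi)"
    by (simp add: \<beta>_def k_def frac_def field_simps)
  moreover have "0 \<le> pi * frac ((\<phi> - \<beta>0) / pi)" by simp
  moreover have "pi * frac ((\<phi> - \<beta>0) / pi) < pi * 1"
    by (intro mult_strict_left_mono frac_lt_1) simp
  ultimately have 1: "\<beta>0 \<le> \<beta>" "\<beta> < \<beta>0 + pi" by linarith+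
  have s: "sin (of_int k * pi) = 0" using sin_npi_int[of k] by (simp add: mult.commute)
  define c where "c = cos (of_int k * pi)"
  have c: "c * c = 1" using sin_cos_squared_add[of "of_int k * pi"] s by (simp add: c_def power2_eq_square)
  have "cos \<beta> = c * cos \<phi>" "sin \<beta> = c * sin \<phi>"
    using s by (auto simp: \<beta>_def cos_add sin_add c_def)
  then have "(cmod z * c) * cos \<beta> = (c * c) * (cmod z * cos \<phi>)"
    "(cmod z * c) * sin \<beta> = (c * c) * (cmod z * sin \<phi>)" by simp_all
  then have "a = (cmod z * c) * cos \<beta>" "b = (cmod z * c) * sin \<beta>"
    using z(1,2) unfolding c mult_1_left by metis+
  moreover have "cmod z * c \<noteq> 0" using z(3) c by auto
  ultimately show thesis using 1 that by blast
qed

text \<open>Variation of constants for \<open>sqrt x\<close> J_0, then the three-term recurrence: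
  its 1/x term dies out, so J_(m+2) behaves like -J_m. All orders thus share G and \<beta>, up to
  quarter turns. The value \<beta>0 selects the representative of the phase modulo pi.\<close>

lemma bessel_J_asymptotic:
  obtains G \<beta> where "G \<noteq> 0" "\<beta>0 \<le> \<beta>" "\<beta> < \<beta>0 + pi"
    "\<And>m. ((\<lambda>x. sqrt x * bessel_J m x - G * sin (x + \<beta> - real m * (pi / 2))) \<longlongrightarrow> 0) at_top"
proof -
  obtain c M where cM: "c > 0" "M > 0" "\<And>x. x \<ge> 1 \<Longrightarrow> c \<le> (bessel_u x)\<^sup>2 + (bessel_u' x)\<^sup>2"
    "\<And>x. x \<ge> 1 \<Longrightarrow> (bessel_u x)\<^sup>2 + (bessel_u' x)\<^sup>2 \<le> M\<^sup>2" using bessel_u_energy by blast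
  have ub: "\<bar>bessel_u x\<bar> \<le> M" if "x \<ge> 1" for x
    
  proof -
    have "(bessel_u x)\<^sup>2 \<le> M\<^sup>2" using cM(4)[OF that] zero_le_power2[of "bessel_u' x"] by linarith
    then show ?thesis using cM(2) abs_le_square_iff[of "bessel_u x" M] by simp
  qed
  \<comment> \<open>Coefficients of u with respect to sine and cosine. For u'' + u = 0 they would be
    constant; the perturbation u/(4 x^2) makes their derivatives integrable.\<close>
  define A where "A x = bessel_u x * sin x + bessel_u' x * cos x" for x
  define B where "B x = bessel_u x * cos x - bessel_u' x * sin x" for x
  have dA: "(A has_real_derivative - (bessel_u x / (4 * x\<^sup>2)) * cos x) (at x)"
    and dB: "(B has_real_derivative (bessel_u x / (4 * x\<^sup>2)) * sin x) (at x)" if "x \<ge> 1" for x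
    using that unfolding A_def B_def
    by (auto intro!: derivative_eq_intros bessel_u_deriv bessel_u'_deriv simp: algebra_simps)
  have b: "\<bar>(bessel_u x / (4 * x\<^sup>2)) * t\<bar> \<le> M / x\<^sup>2" if "x \<ge> 1" "\<bar>t\<bar> \<le> 1" for x t
  proof -
    have "\<bar>bessel_u x\<bar> * \<bar>t\<bar> \<le> M * 1" using ub[OF that(1)] that(2) cM(2) by (intro mult_mono) auto
    then have "\<bar>bessel_u x\<bar> * \<bar>t\<bar> / x\<^sup>2 \<le> M / x\<^sup>2" by (intro divide_right_mono) auto
    moreover have "\<bar>bessel_u x\<bar> * \<bar>t\<bar> / (4 * x\<^sup>2) \<le> \<bar>bessel_u x\<bar> * \<bar>t\<bar> / x\<^sup>2"
      using that(1) by (intro divide_left_mono) auto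
    ultimately show ?thesis by (simp add: abs_mult)
  qed
  have "\<exists>L. (A \<longlongrightarrow> L) at_top"
    by (rule tendsto_at_top_of_deriv_bound[OF dA, where M = M]) (use b[of _ "cos _"] in auto)
  then obtain a where a: "(A \<longlongrightarrow> a) at_top" by blast
  have "\<exists>L. (B \<longlongrightarrow> L) at_top"
    by (rule tendsto_at_top_of_deriv_bound[OF dB, where M = M]) (use b[of _ "sin _"] in auto)
  then obtain b' where b': "(B \<longlongrightarrow> b') at_top" by blast
  have E: "(A x)\<^sup>2 + (B x)\<^sup>2 = (bessel_u x)\<^sup>2 + (bessel_u' x)\<^sup>2" for x
  proof -
    have "(A x)\<^sup>2 + (B x)\<^sup>2 = ((bessel_u x)\<^sup>2 + (bessel_u' x)\<^sup>2) * ((sin x)\<^sup>2 + (cos x)\<^sup>2)"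
      unfolding A_def B_def by algebra
    then show ?thesis by simp
  qed
  have "((\<lambda>x. (A x)\<^sup>2 + (B x)\<^sup>2) \<longlongrightarrow> a\<^sup>2 + b'\<^sup>2) at_top" by (intro tendsto_intros a b')
  moreover have "\<forall>\<^sub>F x in at_top. c \<le> (A x)\<^sup>2 + (B x)\<^sup>2"
    using eventually_ge_at_top[of 1] by eventually_elim (use cM(3) E in auto)
  ultimately have "c \<le> a\<^sup>2 + b'\<^sup>2" by (rule tendsto_lowerbound) simp
  then have "a \<noteq> 0 \<or> b' \<noteq> 0" using cM(1) by auto
  then obtain G \<beta> where G: "G \<noteq> 0" "\<beta>0 \<le> \<beta>" "\<beta> < \<beta>0 + pi" "a = G * cos \<beta>" "b' = G * sin \<beta>"
    using polar_half_open by blast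
  have bounded_mult: "((\<lambda>x. f x * g x) \<longlongrightarrow> 0) at_top"
    if "(f \<longlongrightarrow> 0) at_top" "\<And>x. \<bar>g x\<bar> \<le> 1" for f g :: "real \<Rightarrow> real"
  proof (rule Lim_null_comparison)
    show "((\<lambda>x. \<bar>f x\<bar>) \<longlongrightarrow> 0) at_top" using that(1) by (rule tendsto_rabs_zero)
    show "\<forall>\<^sub>F x in at_top. norm (f x * g x) \<le> \<bar>f x\<bar>"
      using that(2) by (auto simp: abs_mult intro!: mult_left_le always_eventually)
  qed
  have A0: "((\<lambda>x. A x - a) \<longlongrightarrow> 0) at_top" and B0: "((\<lambda>x. B x - b') \<longlongrightarrow> 0) at_top"
    using a b' by (auto simp: LIM_zero_iff)
  have pq: "bessel_u x = A x * sin x + B x * cos x" "bessel_u' x = A x * cos x - B x * sin x" for x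
  proof -
    have "A x * sin x + B x * cos x = bessel_u x * ((sin x)\<^sup>2 + (cos x)\<^sup>2)"
      "A x * cos x - B x * sin x = bessel_u' x * ((sin x)\<^sup>2 + (cos x)\<^sup>2)"
      unfolding A_def B_def by algebra+
    then show "bessel_u x = A x * sin x + B x * cos x" "bessel_u' x = A x * cos x - B x * sin x" by auto
  qed
  have u: "((\<lambda>x. bessel_u x - G * sin (x + \<beta>)) \<longlongrightarrow> 0) at_top"
  proof -
    have "((\<lambda>x. (A x - a) * sin x + (B x - b') * cos x) \<longlongrightarrow> 0 + 0) at_top"
      by (intro tendsto_add bounded_mult A0 B0) auto
    moreover have "(A x - a) * sin x + (B x - b') * cos x = bessel_u x - G * sin (x + \<beta>)" for x
      unfolding pq G(4,5) by (simp add: sin_add algebra_simps)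
    ultimately show ?thesis by simp
  qed
  have u': "((\<lambda>x. bessel_u' x - G * cos (x + \<beta>)) \<longlongrightarrow> 0) at_top"
  proof -
    have "((\<lambda>x. (A x - a) * cos x - (B x - b') * sin x) \<longlongrightarrow> 0 - 0) at_top"
      by (intro tendsto_diff bounded_mult A0 B0) auto
    moreover have "(A x - a) * cos x - (B x - b') * sin x = bessel_u' x - G * cos (x + \<beta>)" for x
      unfolding pq G(4,5) by (simp add: cos_add algebra_simps)
    ultimately show ?thesis by simp
  qed
  have small: "((\<lambda>x. k / x * (sqrt x * bessel_J m x)) \<longlongrightarrow> 0) at_top"
    if m: "((\<lambda>x. sqrt x * bessel_J m x - G * sin (x + \<beta> - real m * (pi / 2))) \<longlongrightarrow> 0) at_top" for m k
  proof -
    have k: "((\<lambda>x. k / x) \<longlongrightarrow> 0) at_top" by real_asymp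
    have "((\<lambda>x. k / x * (sqrt x * bessel_J m x - G * sin (x + \<beta> - real m * (pi / 2)))
         + (G * (k / x)) * sin (x + \<beta> - real m * (pi / 2))) \<longlongrightarrow> 0 * 0 + 0) at_top"
      by (intro tendsto_add tendsto_mult bounded_mult k m tendsto_mult_right_zero) auto
    then show ?thesis by (simp add: algebra_simps)
  qed
  have asymp: "((\<lambda>x. sqrt x * bessel_J m x - G * sin (x + \<beta> - real m * (pi / 2))) \<longlongrightarrow> 0) at_top" for m
  proof (induction m rule: induct_nat_012)
    case 0
    then show ?case using u by (simp add: bessel_u_def)
  next
    case 1
    have h: "((\<lambda>x. (1 / 2) / x * (sqrt x * bessel_J 0 x)) \<longlongrightarrow> 0) at_top"
      by (rule small) (use u in \<open>simp add: bessel_u_def\<close>)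
    have "((\<lambda>x. (1 / 2) / x * (sqrt x * bessel_J 0 x) - (bessel_u' x - G * cos (x + \<beta>))) \<longlongrightarrow> 0 - 0) at_top"
      by (intro tendsto_diff h u')
    moreover have "\<forall>\<^sub>F x in at_top. (1 / 2) / x * (sqrt x * bessel_J 0 x) - (bessel_u' x - G * cos (x + \<beta>))
        = sqrt x * bessel_J (Suc 0) x - G * sin (x + \<beta> - real (Suc 0) * (pi / 2))"
      using eventually_gt_at_top[of 0]
    proof eventually_elim
      case (elim x)
      have "(1 / 2) / x * (sqrt x * bessel_J 0 x) = bessel_J 0 x / (2 * sqrt x)"
      proof -
        define s where "s = sqrt x"
        have "s > 0" "x = s * s" "sqrt x = s" using elim by (auto simp: s_def)
        then show ?thesis unfolding \<open>sqrt x = s\<close> unfolding \<open>x = s * s\<close> by (simp add: field_simps)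
      qed
      moreover have "sin (x + \<beta> - real (Suc 0) * (pi / 2)) = - cos (x + \<beta>)"
        by (simp add: sin_diff)
      ultimately show ?case by (simp add: bessel_u'_def)
    qed
    ultimately show ?case by (simp add: tendsto_cong)
  next
    case (ge2 m)
    have "((\<lambda>x. 2 * (real m + 1) / x * (sqrt x * bessel_J (Suc m) x)
       - (sqrt x * bessel_J m x - G * sin (x + \<beta> - real m * (pi / 2)))) \<longlongrightarrow> 0 - 0) at_top"
      by (intro tendsto_diff small ge2)
    moreover have "\<forall>\<^sub>F x in at_top. 2 * (real m + 1) / x * (sqrt x * bessel_J (Suc m) x)
       - (sqrt x * bessel_J m x - G * sin (x + \<beta> - real m * (pi / 2)))
        = sqrt x * bessel_J (Suc (Suc m)) x - G * sin (x + \<beta> - real (Suc (Suc m)) * (pi / 2))"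
      using eventually_gt_at_top[of 0]
    proof eventually_elim
      case (elim x)
      have "x + \<beta> - real (Suc (Suc m)) * (pi / 2) = x + \<beta> - real m * (pi / 2) - pi"
        by (simp add: field_simps)
      then have S: "sin (x + \<beta> - real (Suc (Suc m)) * (pi / 2)) = - sin (x + \<beta> - real m * (pi / 2))"
        by (simp only: sin_diff) simp
      have J: "bessel_J (Suc (Suc m)) x = 2 * (real m + 1) / x * bessel_J (Suc m) x - bessel_J m x"
        using bessel_J_rec[of x m] elim by simp
      show ?case unfolding S J by (simp add: algebra_simps)
    qed
    ultimately show ?case by (simp add: tendsto_cong)
  qed
  show thesis using that[OF G(1-3) asymp] .
qed

section \<open>Counting zeros\<close>

text \<open>An increasing enumeration rather than a cardinality, so that single zeros stay
  accessible for interlacing and for comparison of phases. Zeros at the origin are not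
  counted.\<close>

definition has_zeros :: "(real \<Rightarrow> real) \<Rightarrow> nat \<Rightarrow> real \<Rightarrow> bool" where
  "has_zeros f n X \<longleftrightarrow> (\<exists>z::nat \<Rightarrow> real. strict_mono_on {..<n} z \<and> (\<forall>i<n. 0 < z i \<and> z i \<le> X \<and> f (z i) = 0))"

lemma has_zeros_0: "has_zeros f 0 X"
  by (auto simp: has_zeros_def strict_mono_on_def)

lemma has_zeros_mono: "has_zeros f n X \<Longrightarrow> X \<le> Y \<Longrightarrow> has_zeros f n Y"
  unfolding has_zeros_def by (meson order_trans)

lemma strict_mono_on_lessThan_extend:
  fixes z :: "nat \<Rightarrow> real"
  assumes "strict_mono_on {..<n} z" "n > 0 \<Longrightarrow> z (n - 1) < y"
  shows "strict_mono_on {..<Suc n} (z(n := y))"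
proof (rule strict_mono_onI)
  fix i j assume ij: "i \<in> {..<Suc n}" "j \<in> {..<Suc n}" "i < j"
  show "(z(n := y)) i < (z(n := y)) j"
  proof (cases "j = n")
    case True
    have "z i \<le> z (n - 1)"
      using assms(1) ij True by (cases "i = n - 1") (auto simp: strict_mono_on_def intro: less_imp_le)
    then show ?thesis using assms(2) ij True by auto
  next
    case False
    then show ?thesis using assms(1) ij by (auto simp: strict_mono_on_def)
  qed
qed

lemma has_zeros_Suc:
  assumes "has_zeros f n X" "X < y" "0 < y" "f y = 0" "y \<le> Y"
  shows "has_zeros f (Suc n) Y"
proof -
  obtain z where z: "strict_mono_on {..<n} z" "\<And>i. i < n \<Longrightarrow> 0 < z i \<and> z i \<le> X \<and> f (z i) = 0"
    using assms(1) by (auto simp: has_zeros_def)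
  have "strict_mono_on {..<Suc n} (z(n := y))"
    using z(2)[of "n - 1"] assms(2) by (intro strict_mono_on_lessThan_extend z(1)) auto
  moreover have "0 < (z(n := y)) i \<and> (z(n := y)) i \<le> Y \<and> f ((z(n := y)) i) = 0" if "i < Suc n" for i
    using z(2)[of i] assms that by (cases "i = n") auto
  ultimately show ?thesis unfolding has_zeros_def by blast
qed

lemma has_zeros_step:
  assumes "has_zeros f n X" "n > 0" and next_zero: "\<And>p. 0 < p \<Longrightarrow> f p = 0 \<Longrightarrow> \<exists>q. p < q \<and> q \<le> p + d \<and> f q = 0"
  shows "has_zeros f (Suc n) (X + d)"
proof -
  obtain z where z: "strict_mono_on {..<n} z" "\<And>i. i < n \<Longrightarrow> 0 < z i \<and> z i \<le> X \<and> f (z i) = 0"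
    using assms(1) by (auto simp: has_zeros_def)
  obtain q where q: "z (n - 1) < q" "q \<le> z (n - 1) + d" "f q = 0"
    using next_zero[of "z (n - 1)"] z(2)[of "n - 1"] assms(2) by auto
  have "strict_mono_on {..<Suc n} (z(n := q))"
    using q by (intro strict_mono_on_lessThan_extend z(1)) auto
  moreover have "0 < (z(n := q)) i \<and> (z(n := q)) i \<le> X + d \<and> f ((z(n := q)) i) = 0" if "i < Suc n" for i
    using z(2)[of i] z(2)[of "n - 1"] q assms(2) that by (cases "i = n") auto
  ultimately show ?thesis unfolding has_zeros_def by blast
qed

text \<open>The first node may be 0, so that a zero at the origin can be used. The function g is
  separate from f' because only a multiple of the derivative is of interest.\<close>

lemma rolle_interlacing:
  fixes z :: "nat \<Rightarrow> real"
  assumes z: "strict_mono_on {..<Suc n} z" "0 \<le> z 0" "\<And>i. i < Suc n \<Longrightarrow> f (z i) = 0"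
    and cont: "continuous_on {0..} f"
    and d: "\<And>x. 0 < x \<Longrightarrow> (f has_real_derivative f' x) (at x)"
    and g: "\<And>x. 0 < x \<Longrightarrow> f' x = 0 \<Longrightarrow> g x = 0"
  shows "has_zeros g n (z n)"
proof -
  have mono: "z i \<le> z j" if "i \<le> j" "j \<le> n" for i j
    using z(1) that by (cases "i = j") (auto simp: strict_mono_on_def intro: less_imp_le)
  have "\<exists>y. z i < y \<and> y < z (Suc i) \<and> f' y = 0" if "i < n" for i
  proof -
    have lt: "z i < z (Suc i)" using z(1) that by (auto simp: strict_mono_on_def)
    have pos: "0 \<le> z i" using mono[of 0 i] that z(2) by simp
    have "continuous_on {z i..z (Suc i)} f" using pos by (intro continuous_on_subset[OF cont]) auto
    moreover have "f differentiable (at x)" if "z i < x" for x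
      using d[of x] that pos real_differentiable_def by force
    ultimately obtain l y where "z i < y" "y < z (Suc i)" "(f has_real_derivative l) (at y)"
      "f (z (Suc i)) - f (z i) = (z (Suc i) - z i) * l"
      using MVT[OF lt, of f] by blast
    moreover have "l = f' y" using calculation pos d[of y] DERIV_unique by force
    ultimately show ?thesis using lt z(3)[of i] z(3)[of "Suc i"] that by auto
  qed
  then obtain y where y: "\<And>i. i < n \<Longrightarrow> z i < y i \<and> y i < z (Suc i) \<and> f' (y i) = 0" by metis
  have "strict_mono_on {..<n} y"
  proof (rule strict_mono_onI)
    fix i j assume ij: "i \<in> {..<n}" "j \<in> {..<n}" "i < j"
    then show "y i < y j" using y[of i] y[of j] mono[of "Suc i" j] by auto
  qed
  moreover have "0 < y i \<and> y i \<le> z n \<and> g (y i) = 0" if "i < n" for i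
    using y[of i] mono[of 0 i] mono[of "Suc i" n] z(2) g[of "y i"] that by auto
  ultimately show ?thesis unfolding has_zeros_def by blast
qed

lemma has_zeros_rolle:
  assumes "has_zeros f (Suc n) X" and "continuous_on {0..} f"
    and "\<And>x. 0 < x \<Longrightarrow> (f has_real_derivative f' x) (at x)"
    and "\<And>x. 0 < x \<Longrightarrow> f' x = 0 \<Longrightarrow> g x = 0"
  shows "has_zeros g n X"
proof -
  obtain z where z: "strict_mono_on {..<Suc n} z" "\<And>i. i < Suc n \<Longrightarrow> 0 < z i \<and> z i \<le> X \<and> f (z i) = 0"
    using assms(1) by (auto simp: has_zeros_def)
  have "has_zeros g n (z n)"
    by (rule rolle_interlacing[OF z(1) _ _ assms(2-4)]) (use z(2) in \<open>auto intro: less_imp_le\<close>)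
  then show ?thesis using z(2)[of n] has_zeros_mono by blast
qed

text \<open>The origin serves as an additional node, so the usual loss of one zero in Rolle's
  theorem does not occur.\<close>

lemma has_zeros_rolle_0:
  assumes "has_zeros f n X" "f 0 = 0" "0 \<le> X" and "continuous_on {0..} f"
    and "\<And>x. 0 < x \<Longrightarrow> (f has_real_derivative f' x) (at x)"
    and "\<And>x. 0 < x \<Longrightarrow> f' x = 0 \<Longrightarrow> g x = 0"
  shows "has_zeros g n X"
proof -
  obtain z where z: "strict_mono_on {..<n} z" "\<And>i. i < n \<Longrightarrow> 0 < z i \<and> z i \<le> X \<and> f (z i) = 0"
    using assms(1) by (auto simp: has_zeros_def)
  define z' where "z' i = (case i of 0 \<Rightarrow> 0 | Suc j \<Rightarrow> z j)" for i
  have "has_zeros g n (z' n)"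
  proof (rule rolle_interlacing[OF _ _ _ assms(4-6)])
    show "strict_mono_on {..<Suc n} z'"
      using z by (auto simp: strict_mono_on_def z'_def split: nat.splits)
    show "f (z' i) = 0" if "i < Suc n" for i
      using z(2) assms(2) that by (auto simp: z'_def split: nat.splits)
  qed (simp add: z'_def)
  moreover have "z' n \<le> X" using z(2) assms(3) by (auto simp: z'_def split: nat.splits)
  ultimately show ?thesis using has_zeros_mono by blast
qed

lemma has_zeros_cong:
  assumes "has_zeros f n X" "\<And>x. 0 < x \<Longrightarrow> f x = 0 \<Longrightarrow> g x = 0"
  shows "has_zeros g n X"
  using assms unfolding has_zeros_def by meson

section \<open>Zeros of functions asymptotic to a sine\<close>

lemma sin_shift_int: "sin (of_int k * pi + \<theta>) = cos (of_int k * pi) * sin \<theta>" "(cos (of_int k * pi))\<^sup>2 = 1"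
proof -
  have s: "sin (of_int k * pi) = 0" using sin_npi_int[of k] by (simp add: mult.commute)
  then show "sin (of_int k * pi + \<theta>) = cos (of_int k * pi) * sin \<theta>" by (simp add: sin_add)
  show "(cos (of_int k * pi))\<^sup>2 = 1" using sin_cos_squared_add[of "of_int k * pi"] s by simp
qed

text \<open>The hypothesis on \<open>f\<close> forces a sign change near each large zero of the sine.\<close>

lemma asymptotic_zero_exists:
  assumes lim: "((\<lambda>x. h x * f x - G * sin (x + \<gamma>)) \<longlongrightarrow> 0) at_top" and G: "G \<noteq> (0::real)"
    and cont: "continuous_on {0<..} f" and h: "\<And>x. x > 0 \<Longrightarrow> h x > (0::real)"
    and \<epsilon>: "0 < \<epsilon>" "\<epsilon> < pi / 2"
  shows "\<forall>\<^sub>F n in sequentially. \<exists>y>0. real n * pi - \<gamma> - \<epsilon> \<le> y \<and> y \<le> real n * pi - \<gamma> + \<epsilon> \<and> f y = 0"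
proof -
  have s: "sin \<epsilon> > 0" using \<epsilon> by (intro sin_gt_zero) auto
  have "\<forall>\<^sub>F x in at_top. \<bar>h x * f x - G * sin (x + \<gamma>)\<bar> < \<bar>G\<bar> * sin \<epsilon>"
    using tendstoD[OF lim, of "\<bar>G\<bar> * sin \<epsilon>"] G s by (simp add: dist_real_def)
  then obtain X where X: "\<And>x. x \<ge> X \<Longrightarrow> \<bar>h x * f x - G * sin (x + \<gamma>)\<bar> < \<bar>G\<bar> * sin \<epsilon>"
    by (auto simp: eventually_at_top_linorder)
  have "\<forall>\<^sub>F n in sequentially. real n * pi - \<gamma> - \<epsilon> \<ge> max X 1"
    by (rule filterlim_at_top[THEN iffD1, rule_format]) real_asymp
  then show ?thesis
  proof eventually_elim
    case (elim n)
    define a b where "a = real n * pi - \<gamma> - \<epsilon>" and "b = real n * pi - \<gamma> + \<epsilon>"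
    define c where "c = cos (real_of_int (int n) * pi)"
    have c2: "c\<^sup>2 = 1" unfolding c_def by (rule sin_shift_int)
    have ab: "a \<ge> X" "b \<ge> X" "a > 0" "a \<le> b" using elim \<epsilon> by (auto simp: a_def b_def)
    have sa: "sin (a + \<gamma>) = - (c * sin \<epsilon>)" and sb: "sin (b + \<gamma>) = c * sin \<epsilon>"
      using sin_shift_int(1)[of "int n" "- \<epsilon>"] sin_shift_int(1)[of "int n" \<epsilon>] by (auto simp: a_def b_def c_def)
    have c1: "c = 1 \<or> c = -1" using c2 by (simp add: power2_eq_1_iff)
    define t where "t = G * c"
    have t: "t \<noteq> 0" "\<bar>t\<bar> = \<bar>G\<bar>" using c1 G by (auto simp: t_def)
    have A: "\<bar>h a * f a + t * sin \<epsilon>\<bar> < \<bar>t\<bar> * sin \<epsilon>" and B: "\<bar>h b * f b - t * sin \<epsilon>\<bar> < \<bar>t\<bar> * sin \<epsilon>"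
      using X[OF ab(1)] X[OF ab(2)] unfolding sa sb t(2) by (auto simp: t_def mult.assoc)
    have ha: "h a > 0" "h b > 0" using h ab by auto
    have "(f a < 0 \<and> f b > 0) \<or> (f a > 0 \<and> f b < 0)"
    proof (cases "t > 0")
      case True
      then have "h a * f a < 0" "h b * f b > 0" using A B by (auto simp: abs_if split: if_splits)
      then show ?thesis using ha by (auto simp: mult_less_0_iff zero_less_mult_iff)
    next
      case False
      then have "h a * f a > 0" "h b * f b < 0" using A B t by (auto simp: abs_if split: if_splits)
      then show ?thesis using ha by (auto simp: mult_less_0_iff zero_less_mult_iff)
    qed
    moreover have "continuous_on {a..b} f" using ab by (intro continuous_on_subset[OF cont]) auto
    ultimately obtain y where "a \<le> y" "y \<le> b" "f y = 0"
      using IVT'[of f a 0 b] IVT2'[of f b 0 a] ab by (metis less_imp_le)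
    then show ?case using ab by (intro exI[of _ y]) (auto simp: a_def b_def)
  qed
qed

text \<open>At a large zero of f the sine is smaller than sin \<epsilon> in absolute value; after
  subtracting the nearest multiple of pi this bounds the angle itself.\<close>

lemma asymptotic_zero_location:
  assumes lim: "((\<lambda>x. h x * f x - G * sin (x + \<gamma>)) \<longlongrightarrow> 0) at_top" and G: "G \<noteq> (0::real)"
    and \<epsilon>: "0 < \<epsilon>" "\<epsilon> < pi / 2"
  shows "\<forall>\<^sub>F x in at_top. f x = 0 \<longrightarrow> (\<exists>k::int. \<bar>x + \<gamma> - of_int k * pi\<bar> < \<epsilon>)"
proof -
  have s: "sin \<epsilon> > 0" using \<epsilon> by (intro sin_gt_zero) auto
  have "\<forall>\<^sub>F x in at_top. \<bar>h x * f x - G * sin (x + \<gamma>)\<bar> < \<bar>G\<bar> * sin \<epsilon>"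
    using tendstoD[OF lim, of "\<bar>G\<bar> * sin \<epsilon>"] G s by (simp add: dist_real_def)
  then show ?thesis
  proof eventually_elim
    case (elim x)
    show ?case
    proof
      assume "f x = 0"
      then have "\<bar>sin (x + \<gamma>)\<bar> < sin \<epsilon>" using elim G by (simp add: abs_mult)
      define k where "k = round ((x + \<gamma>) / pi)"
      define \<theta> where "\<theta> = x + \<gamma> - of_int k * pi"
      have "\<bar>of_int k - (x + \<gamma>) / pi\<bar> \<le> 1 / 2" unfolding k_def by (rule of_int_round_abs_le)
      then have "\<bar>of_int k - (x + \<gamma>) / pi\<bar> * pi \<le> 1 / 2 * pi" by (intro mult_right_mono) auto
      moreover have "\<bar>\<theta>\<bar> = \<bar>of_int k - (x + \<gamma>) / pi\<bar> * pi"
      proof -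
        have "(of_int k - (x + \<gamma>) / pi) * pi = - \<theta>" by (simp add: \<theta>_def field_simps)
        then have "\<bar>(of_int k - (x + \<gamma>) / pi) * pi\<bar> = \<bar>\<theta>\<bar>" by simp
        then show ?thesis by (simp add: abs_mult)
      qed
      ultimately have \<theta>: "\<bar>\<theta>\<bar> \<le> pi / 2" by simp
      have "\<bar>sin (x + \<gamma>)\<bar> = \<bar>sin \<theta>\<bar>"
      proof -
        have "sin (x + \<gamma>) = cos (of_int k * pi) * sin \<theta>"
          using sin_shift_int(1)[of k \<theta>] by (simp add: \<theta>_def)
        moreover have "\<bar>cos (of_int k * pi)\<bar> = 1" using sin_shift_int(2)[of k] by (simp add: power2_eq_1_iff) auto
        ultimately show ?thesis by (simp add: abs_mult)
      qed
      also have "\<bar>sin \<theta>\<bar> = sin \<bar>\<theta>\<bar>"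
      proof -
        have "0 \<le> sin \<bar>\<theta>\<bar>" using \<theta> by (intro sin_ge_zero) auto
        then show ?thesis by (cases "\<theta> \<ge> 0") auto
      qed
      finally have "sin \<bar>\<theta>\<bar> < sin \<epsilon>" using \<open>\<bar>sin (x + \<gamma>)\<bar> < sin \<epsilon>\<close> by simp
      then have "\<bar>\<theta>\<bar> < \<epsilon>" using sin_mono_le_eq[of \<epsilon> "\<bar>\<theta>\<bar>"] \<theta> \<epsilon> by (auto simp: not_le[symmetric])
      then show "\<exists>k::int. \<bar>x + \<gamma> - of_int k * pi\<bar> < \<epsilon>" unfolding \<theta>_def by blast
    qed
  qed
qed

text \<open>Sturm comparison with sin(x - p): the coefficient 1 + 1/(4 x^2) exceeds 1. If u kept its
  sign up to p + pi, the Wronskian \<open>W\<close> would decrease from 0, yet at p + pi it equals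
  \<sigma> u > 0.\<close>

lemma bessel_J_0_next_zero:
  assumes p: "0 < p" "bessel_J 0 p = 0"
  shows "\<exists>q. p < q \<and> q \<le> p + pi \<and> bessel_J 0 q = 0"
proof (rule ccontr)
  assume "\<not> ?thesis"
  then have nz: "bessel_J 0 x \<noteq> 0" if "p < x" "x \<le> p + pi" for x using that by auto
  define \<sigma> where "\<sigma> = sgn (bessel_J 0 (p + pi))"
  have \<sigma>: "\<sigma> * bessel_J 0 x > 0" if x: "p < x" "x \<le> p + pi" for x
  proof (rule ccontr)
    assume neg: "\<not> ?thesis"
    have "\<sigma> * bessel_J 0 (p + pi) > 0" using nz[of "p + pi"] by (simp add: \<sigma>_def sgn_if mult_neg_neg)
    moreover have "continuous_on {x..p + pi} (\<lambda>x. \<sigma> * bessel_J 0 x)"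
      by (intro continuous_intros continuous_on_bessel_J)
    ultimately obtain y where "x \<le> y" "y \<le> p + pi" "\<sigma> * bessel_J 0 y = 0"
      using IVT'[of "\<lambda>x. \<sigma> * bessel_J 0 x" x 0 "p + pi"] neg x by auto
    then show False using nz[of y] x nz[of "p + pi"] by (auto simp: \<sigma>_def sgn_if split: if_splits)
  qed
  define W where "W x = \<sigma> * (bessel_u' x * sin (x - p) - bessel_u x * cos (x - p))" for x
  have "W (p + pi) < W p"
  proof (rule DERIV_neg_imp_decreasing_open[where f = W])
    show "p < p + pi" by simp
    fix x assume x: "p < x" "x < p + pi"
    have "(W has_real_derivative - (\<sigma> * bessel_u x) * (1 / (4 * x\<^sup>2)) * sin (x - p)) (at x)"
      unfolding W_def using x p
      by (auto intro!: derivative_eq_intros bessel_u_deriv bessel_u'_deriv simp: algebra_simps)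
    moreover have "- (\<sigma> * bessel_u x) * (1 / (4 * x\<^sup>2)) * sin (x - p) < 0"
    proof -
      have "\<sigma> * bessel_u x = sqrt x * (\<sigma> * bessel_J 0 x)" by (simp add: bessel_u_def)
      moreover have "0 < sqrt x * (\<sigma> * bessel_J 0 x)" using x p by (intro mult_pos_pos[OF _ \<sigma>]) auto
      ultimately have "\<sigma> * bessel_u x > 0" by (simp only:)
      moreover have "sin (x - p) > 0" using x by (intro sin_gt_zero) auto
      ultimately show ?thesis using x p by simp
    qed
    ultimately show "\<exists>y. (W has_real_derivative y) (at x) \<and> y < 0" by blast
  next
    show "continuous_on {p..p + pi} W"
      unfolding W_def bessel_u_def bessel_u'_def using p(1)
      by (intro continuous_intros continuous_on_bessel_J) auto
  qed
  moreover have "W p = 0" by (simp add: W_def bessel_u_def p)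
  moreover have "W (p + pi) = sqrt (p + pi) * (\<sigma> * bessel_J 0 (p + pi))"
    by (simp add: W_def bessel_u_def)
  moreover have "0 < sqrt (p + pi) * (\<sigma> * bessel_J 0 (p + pi))"
    using p by (intro mult_pos_pos \<sigma>) (auto intro: add_pos_pos)
  ultimately show False by linarith
qed

text \<open>From index K on, each term is at most half of the previous one, so the tail is at most
  twice its first term.\<close>

lemma bessel_clifford_0_approx:
  assumes t: "0 \<le> t" "2 * t \<le> (real K + 1)\<^sup>2"
  shows "\<bar>bessel_clifford 0 (- t) - (\<Sum>k<K. (- t) ^ k / (fact k)\<^sup>2)\<bar> \<le> 2 * (t ^ K / (fact K)\<^sup>2)"
proof -
  let ?f = "\<lambda>k. (- t) ^ k / (fact k)\<^sup>2"
  have f: "1 / (fact k * fact (k + 0)) * (- t) ^ k = ?f k" for k by (simp add: power2_eq_square)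
  have s: "summable ?f" using summable_bessel_clifford[of 0 "- t"] unfolding f .
  have "bessel_clifford 0 (- t) = suminf ?f" unfolding bessel_clifford_def f ..
  also have "\<dots> = (\<Sum>k. ?f (k + K)) + sum ?f {..<K}" by (rule suminf_split_initial_segment[OF s])
  finally have eq: "bessel_clifford 0 (- t) - sum ?f {..<K} = (\<Sum>k. ?f (k + K))" by simp
  define a where "a = t ^ K / (fact K)\<^sup>2"
  have le: "norm (?f (k + K)) \<le> a * (1 / 2) ^ k" for k
  proof (induction k)
    case (Suc k)
    have "norm (?f (Suc k + K)) = norm (?f (k + K)) * (t / (real (Suc (k + K)))\<^sup>2)"
      using t by (simp add: power_mult_distrib abs_mult power_abs field_simps del: of_nat_Suc)
    also have "\<dots> \<le> (a * (1 / 2) ^ k) * (1 / 2)"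
    proof (rule mult_mono[OF Suc])
      have "(real K + 1)\<^sup>2 \<le> (real (Suc (k + K)))\<^sup>2" by (intro power_mono) auto
      then have "2 * t \<le> (real (Suc (k + K)))\<^sup>2" using t(2) by linarith
      then show "t / (real (Suc (k + K)))\<^sup>2 \<le> 1 / 2" by (simp add: divide_simps)
    qed (use t in \<open>auto simp: a_def\<close>)
    finally show ?case by simp
  qed (use t in \<open>simp add: a_def power_abs\<close>)
  have g: "(\<lambda>k. a * (1 / 2) ^ k) sums (a * 2)"
    using sums_mult[OF geometric_sums[of "1 / 2 :: real"], of a] by simp
  have "norm (\<Sum>k. ?f (k + K)) \<le> (\<Sum>k. a * (1 / 2) ^ k)"
    by (rule norm_suminf_le[OF le]) (use g in \<open>simp add: sums_iff\<close>)
  also have "\<dots> = 2 * a" using g by (simp add: sums_iff)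
  finally show ?thesis unfolding eq a_def by simp
qed

text \<open>In t = x^2/4 the first three zeros of J_0 are near 1.446, 7.618 and 18.722. The last
  point, 18.725, is chosen tightly since it determines the phase constant.\<close>

lemma bessel_clifford_0_signs:
  "bessel_clifford 0 (- 4) < 0" "bessel_clifford 0 (- 12) > 0" "bessel_clifford 0 (- (749 / 40)) < 0"
proof -
  have "\<bar>bessel_clifford 0 (- 4) - (\<Sum>k<8. (- 4) ^ k / (fact k)\<^sup>2)\<bar> \<le> 2 * (4 ^ 8 / (fact 8)\<^sup>2)"
    by (rule bessel_clifford_0_approx) auto
  then show "bessel_clifford 0 (- 4) < 0"
    unfolding abs_le_iff by (simp add: eval_nat_numeral lessThan_Suc atLeast0LessThan fact_numeral)
next
  have "\<bar>bessel_clifford 0 (- 12) - (\<Sum>k<12. (- 12) ^ k / (fact k)\<^sup>2)\<bar> \<le> 2 * (12 ^ 12 / (fact 12)\<^sup>2)"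
    by (rule bessel_clifford_0_approx) auto
  then show "bessel_clifford 0 (- 12) > 0"
    unfolding abs_le_iff by (simp add: eval_nat_numeral lessThan_Suc atLeast0LessThan fact_numeral)
next
  have "\<bar>bessel_clifford 0 (- (749/40)) - (\<Sum>k<16. (- (749/40)) ^ k / (fact k)\<^sup>2)\<bar> \<le> 2 * ((749/40) ^ 16 / (fact 16)\<^sup>2)"
    by (rule bessel_clifford_0_approx) auto
  then show "bessel_clifford 0 (- (749/40)) < 0"
    unfolding abs_le_iff by (simp add: eval_nat_numeral lessThan_Suc atLeast0LessThan fact_numeral)
qed

text \<open>The k-th zero of J_0 lags behind k pi by an amount that grows with k towards pi/4.
  Starting from the third zero, with a lag above 0.7697, loses little of it; later zeros follow at
  steps of at most pi.\<close>

lemma bessel_J_0_zeros: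
  assumes "n \<ge> 3"
  shows "has_zeros (bessel_J 0) n (real n * pi - (3 * pi - 8655 / 1000))"
  using assms
proof (induction n rule: dec_induct)
  case base
  let ?f = "\<lambda>t. bessel_clifford 0 (- t)"
  have c: "continuous_on {a..b} ?f" for a b
    by (intro continuous_on_compose2[OF continuous_on_bessel_clifford[of UNIV]] continuous_intros) auto
  have f0: "?f 0 > 0" by (simp add: bessel_clifford_0)
  obtain t1 where t1: "0 \<le> t1" "t1 \<le> 4" "?f t1 = 0"
    using IVT2'[of ?f 4 0 0] f0 bessel_clifford_0_signs c by (metis less_imp_le zero_le_numeral)
  obtain t2 where t2: "4 \<le> t2" "t2 \<le> 12" "?f t2 = 0"
    using IVT'[of ?f 4 0 12] bessel_clifford_0_signs c by (metis less_imp_le numeral_le_iff semiring_norm(69,72,68,71))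
  obtain t3 where t3: "12 \<le> t3" "t3 \<le> 749 / 40" "?f t3 = 0"
    using IVT2'[of ?f "749 / 40" 0 12] bessel_clifford_0_signs c by auto
  have ne: "t1 \<noteq> 0" "t2 \<noteq> 4" "t3 \<noteq> 12" using t1 t2 t3 f0 bessel_clifford_0_signs by auto
  have J: "bessel_J 0 (2 * sqrt t) = ?f t" if "t \<ge> 0" for t
    using that by (simp add: bessel_J_def power_mult_distrib)
  have s4: "2 * sqrt 4 = (4::real)" by simp
  have 1: "has_zeros (bessel_J 0) (Suc 0) (2 * sqrt 4)"
    by (rule has_zeros_Suc[OF has_zeros_0[of _ 0], of "2 * sqrt t1"])
      (use t1 ne J real_sqrt_le_mono[OF t1(2)] in auto)
  have 2: "has_zeros (bessel_J 0) (Suc (Suc 0)) (2 * sqrt 12)"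
    by (rule has_zeros_Suc[OF 1, of "2 * sqrt t2"])
      (use t2 ne J real_sqrt_less_mono[of 4 t2] in auto)
  have "2 * sqrt t3 \<le> 8655 / 1000"
  proof -
    have "sqrt t3 \<le> sqrt ((8655 / 2000)\<^sup>2)"
      using t3 by (intro real_sqrt_le_mono) (simp add: power2_eq_square)
    then show ?thesis by simp
  qed
  then have "has_zeros (bessel_J 0) (Suc (Suc (Suc 0))) (8655 / 1000)"
    by (intro has_zeros_Suc[OF 2, of "2 * sqrt t3"]) (use t3 ne J in \<open>auto simp: less_le\<close>)
  then show ?case by (simp add: numeral_3_eq_3)
next
  case (step n)
  have "has_zeros (bessel_J 0) (Suc n) (real n * pi - (3 * pi - 8655 / 1000) + pi)"
    using step by (intro has_zeros_step bessel_J_0_next_zero) auto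
  then show ?case by (simp add: algebra_simps)
qed

text \<open>The interval for \<beta> has length pi, so prescribing it is a mere normalisation. Its
  lower end is the lag 3 pi - 8.655 from \<open>bessel_J_0_zeros\<close>, which lets the explicit
  zeros and the asymptotic ones be numbered consistently.\<close>

locale bessel_phase =
  fixes G \<beta> :: real
  assumes G: "G \<noteq> 0" and \<beta>: "3 * pi - 8655 / 1000 \<le> \<beta>" "\<beta> < 3 * pi - 8655 / 1000 + pi"
    and asymptotic: "\<And>m. ((\<lambda>x. sqrt x * bessel_J m x - G * sin (x + \<beta> - real m * (pi / 2))) \<longlongrightarrow> 0) at_top"
begin

lemma zeros_J_0:
  assumes "\<epsilon> > 0"
  shows "\<forall>\<^sub>F n in sequentially. has_zeros (bessel_J 0) n (real n * pi - \<beta> + \<epsilon>)"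
proof -
  \<comment> \<open>The last term is the distance of \<beta> from the open end of its interval. With
    it, a large zero near k pi - \<beta> among the first n satisfies k < n + 1, hence k \<le>
    n.\<close>
  define \<delta> where "\<delta> = min (min \<epsilon> 1) (3 * pi - 8655 / 1000 + pi - \<beta>)"
  have "\<delta> \<le> 1" by (simp add: \<delta>_def)
  then have \<delta>: "0 < \<delta>" "\<delta> < pi / 2" "\<delta> \<le> \<epsilon>" "\<delta> \<le> 3 * pi - 8655 / 1000 + pi - \<beta>"
    using \<beta> assms pi_gt3 by (auto simp: \<delta>_def)
  have "((\<lambda>x. sqrt x * bessel_J 0 x - G * sin (x + \<beta>)) \<longlongrightarrow> 0) at_top"
    using asymptotic[of 0] by simp
  from asymptotic_zero_location[OF this G \<delta>(1,2)]
  obtain X where X: "\<And>x. x \<ge> X \<Longrightarrow> bessel_J 0 x = 0 \<Longrightarrow> \<exists>k::int. \<bar>x + \<beta> - of_int k * pi\<bar> < \<delta>"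
    by (auto simp: eventually_at_top_linorder)
  have "\<forall>\<^sub>F n in sequentially. real n * pi - \<beta> \<ge> X"
    by (rule filterlim_at_top[THEN iffD1, rule_format]) real_asymp
  then show ?thesis using eventually_ge_at_top[of 3]
  proof eventually_elim
    case (elim n)
    obtain z where z: "strict_mono_on {..<n} z"
      "\<And>i. i < n \<Longrightarrow> 0 < z i \<and> z i \<le> real n * pi - (3 * pi - 8655 / 1000) \<and> bessel_J 0 (z i) = 0"
      using bessel_J_0_zeros[OF elim(2)] by (auto simp: has_zeros_def)
    have "z i \<le> real n * pi - \<beta> + \<epsilon>" if i: "i < n" for i
    proof (cases "z i \<ge> X")
      case True
      then obtain k :: int where k: "\<bar>z i + \<beta> - of_int k * pi\<bar> < \<delta>" using X z(2)[OF i] by blast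
      then have "of_int k * pi < (real n + 1) * pi"
        using z(2)[OF i] \<delta>(4) k unfolding abs_less_iff by (simp add: algebra_simps)
      then have "real_of_int k < real n + 1" by (simp add: mult_less_cancel_right)
      then have "real_of_int k < real_of_int (int n + 1)" by simp
      then have "k \<le> int n" by (simp only: of_int_less_iff)
      then have "of_int k \<le> real n" by (metis of_int_le_iff of_int_of_nat_eq)
      then have "of_int k * pi \<le> real n * pi" by (intro mult_right_mono) auto
      then show ?thesis using k \<delta>(3) by linarith
    next
      case False
      then show ?thesis using elim(1) assms by linarith
    qed
    then show ?case using z unfolding has_zeros_def by blast
  qed
qed

text \<open>The derivative of C_m(-x^2/4) is a multiple of C_(m+1), so Rolle costs one zero in
  passing from m to m + 1. It is regained from the asymptotic zero of J_(m+1), which lies beyond the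
  old range because the phase has moved by pi/2 and \<delta> < pi/4.\<close>

lemma zeros_J:
  assumes "\<epsilon> > 0"
  shows "\<forall>\<^sub>F n in sequentially. has_zeros (bessel_J m) n (real n * pi - \<beta> + real m * (pi / 2) + \<epsilon>)"
  using assms
proof (induction m arbitrary: \<epsilon>)
  case 0
  then show ?case using zeros_J_0[of \<epsilon>] by simp
next
  case (Suc m)
  define \<delta> where "\<delta> = min \<epsilon> (1 / 2)"
  have "\<delta> \<le> 1 / 2" by (simp add: \<delta>_def)
  then have \<delta>: "0 < \<delta>" "\<delta> < pi / 4" "\<delta> < pi / 2" "\<delta> \<le> \<epsilon>" using Suc.prems pi_gt3 by (auto simp: \<delta>_def)
  define \<gamma> where "\<gamma> = \<beta> - real (Suc m) * (pi / 2)"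
  have lim: "((\<lambda>x. sqrt x * bessel_J (Suc m) x - G * sin (x + \<gamma>)) \<longlongrightarrow> 0) at_top"
    using asymptotic[of "Suc m"] by (simp add: \<gamma>_def add_diff_eq)
  have "\<forall>\<^sub>F n in sequentially. \<exists>y>0. real n * pi - \<gamma> - \<delta> \<le> y \<and> y \<le> real n * pi - \<gamma> + \<delta> \<and> bessel_J (Suc m) y = 0"
    by (rule asymptotic_zero_exists[OF lim G continuous_on_bessel_J _ \<delta>(1,3)]) simp
  then show ?case using Suc.IH[OF \<delta>(1)] eventually_gt_at_top[of 0]
  proof eventually_elim
    case (elim n)
    then obtain y where y: "y > 0" "real n * pi - \<gamma> - \<delta> \<le> y" "y \<le> real n * pi - \<gamma> + \<delta>" "bessel_J (Suc m) y = 0"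
      by blast
    obtain k where k: "n = Suc k" using elim(3) gr0_implies_Suc by blast
    let ?X = "real n * pi - \<beta> + real m * (pi / 2) + \<delta>"
    have "has_zeros (\<lambda>x. bessel_clifford m (- (x\<^sup>2 / 4))) (Suc k) ?X"
      using elim(2) unfolding k by (rule has_zeros_cong) (simp add: bessel_J_def)
    then have "has_zeros (bessel_J (Suc m)) k ?X"
      by (rule has_zeros_rolle[OF _ _ bessel_clifford_sq_deriv])
        (auto simp: bessel_J_def intro!: continuous_intros continuous_on_compose2[OF continuous_on_bessel_clifford[of UNIV]])
    then show ?case unfolding k
      by (rule has_zeros_Suc[of _ _ _ y]) (use y \<delta> in \<open>auto simp: \<gamma>_def k field_simps\<close>)
  qed
qed

text \<open>For m > 0 the zero of J_m at the origin makes Rolle lossless, and one further zero comes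
  from the asymptotics of -x J_(m+1), the dominant part of D.\<close>

lemma zeros_D:
  assumes "\<epsilon> > 0" "m > 0"
  shows "\<forall>\<^sub>F n in sequentially. has_zeros (bessel_D m) (Suc n) (real n * pi - \<beta> + (real m + 1) * (pi / 2) + \<epsilon>)"
proof -
  define \<delta> where "\<delta> = min \<epsilon> (1 / 2)"
  have "\<delta> \<le> 1 / 2" by (simp add: \<delta>_def)
  then have \<delta>: "0 < \<delta>" "\<delta> < pi / 4" "\<delta> < pi / 2" "\<delta> \<le> \<epsilon>" using assms pi_gt3 by (auto simp: \<delta>_def)
  define \<gamma> where "\<gamma> = \<beta> - (real m + 1) * (pi / 2)"
  have l1: "((\<lambda>x. sqrt x * bessel_J (Suc m) x - G * sin (x + \<gamma>)) \<longlongrightarrow> 0) at_top"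
    using asymptotic[of "Suc m"] by (simp add: \<gamma>_def add_diff_eq add.commute[of 1])
  have l2: "((\<lambda>x. real m / x * (sqrt x * bessel_J m x)) \<longlongrightarrow> 0) at_top"
  proof -
    have 1: "((\<lambda>x. real m / x * (sqrt x * bessel_J m x - G * sin (x + \<beta> - real m * (pi / 2)))) \<longlongrightarrow> 0 * 0) at_top"
      by (intro tendsto_mult asymptotic) real_asymp
    have 2: "((\<lambda>x. (real m / x) * (G * sin (x + \<beta> - real m * (pi / 2)))) \<longlongrightarrow> 0) at_top"
    proof (rule Lim_null_comparison)
      show "\<forall>\<^sub>F x in at_top. norm ((real m / x) * (G * sin (x + \<beta> - real m * (pi / 2)))) \<le> real m * \<bar>G\<bar> / x"
        using eventually_gt_at_top[of 0]
      proof eventually_elim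
        case (elim x)
        have "real m / x * (\<bar>G\<bar> * \<bar>sin (x + \<beta> - real m * (pi / 2))\<bar>) \<le> real m / x * (\<bar>G\<bar> * 1)"
          using elim by (intro mult_left_mono) auto
        then show ?case using elim by (simp add: abs_mult)
      qed
      show "((\<lambda>x. real m * \<bar>G\<bar> / x) \<longlongrightarrow> 0) at_top" by real_asymp
    qed
    show ?thesis using tendsto_add[OF 1 2] by (simp add: algebra_simps)
  qed
  have "((\<lambda>x. real m / x * (sqrt x * bessel_J m x) - (sqrt x * bessel_J (Suc m) x - G * sin (x + \<gamma>))) \<longlongrightarrow> 0 - 0) at_top"
    by (intro tendsto_diff l1 l2)
  moreover have "\<forall>\<^sub>F x in at_top. real m / x * (sqrt x * bessel_J m x) - (sqrt x * bessel_J (Suc m) x - G * sin (x + \<gamma>))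
     = (1 / sqrt x) * bessel_D m x - (- G) * sin (x + \<gamma>)"
    using eventually_gt_at_top[of 0]
  proof eventually_elim
    case (elim x)
    define s where "s = sqrt x"
    have "s > 0" "x = s * s" "sqrt x = s" using elim by (auto simp: s_def)
    then show ?case unfolding bessel_D_def \<open>sqrt x = s\<close>
      by (simp add: field_simps)
  qed
  ultimately have lim: "((\<lambda>x. (1 / sqrt x) * bessel_D m x - (- G) * sin (x + \<gamma>)) \<longlongrightarrow> 0) at_top"
    unfolding diff_0_right by (rule Lim_transform_eventually)
  have "\<forall>\<^sub>F n in sequentially. \<exists>y>0. real n * pi - \<gamma> - \<delta> \<le> y \<and> y \<le> real n * pi - \<gamma> + \<delta> \<and> bessel_D m y = 0"
    by (rule asymptotic_zero_exists[OF lim _ continuous_on_bessel_D _ \<delta>(1,3)]) (use G in auto)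
  moreover have "\<forall>\<^sub>F n in sequentially. 0 \<le> real n * pi - \<beta> + real m * (pi / 2) + \<delta>"
    by (rule filterlim_at_top[THEN iffD1, rule_format]) real_asymp
  ultimately show ?thesis using zeros_J[OF \<delta>(1), of m]
  proof eventually_elim
    case (elim n)
    then obtain y where y: "y > 0" "real n * pi - \<gamma> - \<delta> \<le> y" "y \<le> real n * pi - \<gamma> + \<delta>" "bessel_D m y = 0"
      by blast
    have "has_zeros (bessel_D m) n (real n * pi - \<beta> + real m * (pi / 2) + \<delta>)"
      by (rule has_zeros_rolle_0[OF elim(3) _ elim(2) continuous_on_bessel_J bessel_J_deriv])
        (use assms(2) in \<open>auto simp: bessel_J_def\<close>)
    then show ?case
      by (rule has_zeros_Suc[of _ _ _ y]) (use y \<delta> in \<open>auto simp: \<gamma>_def field_simps\<close>)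
  qed
qed

text \<open>Here D is -x J_1. Since J_0 does not vanish at the origin, there is one zero less than
  for m > 0; the constant eigenfunction will make up for it.\<close>

lemma zeros_D_0:
  assumes "\<epsilon> > 0"
  shows "\<forall>\<^sub>F n in sequentially. has_zeros (bessel_D 0) n (real n * pi - \<beta> + pi / 2 + \<epsilon>)"
  using zeros_J[OF assms, of 1]
proof eventually_elim
  case (elim n)
  then show ?case using has_zeros_cong[OF elim, of "bessel_D 0"] by (simp add: bessel_D_def)
qed

end

section \<open>Spacing of the zeros\<close>

text \<open>The WKB phase of Bessel's equation: the integral of sqrt(t^2 - m^2)/t from m to
  x.\<close>

definition debye_phase :: "real \<Rightarrow> real \<Rightarrow> real" where
  "debye_phase m x = sqrt (x\<^sup>2 - m\<^sup>2) - m * arccos (m / x)"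

lemma debye_phase_deriv:
  assumes "0 \<le> m" "m < x"
  shows "(debye_phase m has_real_derivative sqrt (x\<^sup>2 - m\<^sup>2) / x) (at x)"
proof -
  define r where "r = sqrt (x\<^sup>2 - m\<^sup>2)"
  have pos: "x\<^sup>2 - m\<^sup>2 > 0" using assms by (simp add: power_strict_mono)
  have r: "r > 0" "r * r = x * x - m * m" using pos by (auto simp: r_def power2_eq_square)
  have x: "x > 0" using assms by linarith
  have 1: "((\<lambda>x. sqrt (x\<^sup>2 - m\<^sup>2)) has_real_derivative x / r) (at x)"
    unfolding r_def using pos by (auto intro!: derivative_eq_intros simp: field_simps)
  have "sqrt (1 - (m / x)\<^sup>2) = r / x"
  proof -
    have "(r / x)\<^sup>2 = 1 - (m / x)\<^sup>2"
      using x r by (simp add: power_divide diff_divide_distrib power2_eq_square)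
    moreover have "sqrt ((r / x)\<^sup>2) = r / x" using r x by (simp add: real_sqrt_abs)
    ultimately show ?thesis by simp
  qed
  moreover have "((\<lambda>x. arccos (m / x)) has_real_derivative inverse (- sqrt (1 - (m / x)\<^sup>2)) * (- (m / x\<^sup>2))) (at x)"
  proof (rule DERIV_chain2[of arccos])
    have "-1 < m / x" using assms x by (smt (verit) divide_nonneg_pos)
    then show "(arccos has_real_derivative inverse (- sqrt (1 - (m / x)\<^sup>2))) (at (m / x))"
      using assms x by (intro DERIV_arccos) auto
    show "((\<lambda>x. m / x) has_real_derivative - (m / x\<^sup>2)) (at x)"
      using x by (auto intro!: derivative_eq_intros simp: power2_eq_square)
  qed
  ultimately have 2: "((\<lambda>x. arccos (m / x)) has_real_derivative m / (x * r)) (at x)"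
    using x r by (simp add: field_simps power2_eq_square)
  have "(debye_phase m has_real_derivative x / r - m * (m / (x * r))) (at x)"
    unfolding debye_phase_def by (intro DERIV_diff 1 DERIV_cmult 2)
  moreover have "x / r - m * (m / (x * r)) = r / x"
    using r x by (simp add: divide_simps)
  ultimately show ?thesis by (simp add: r_def)
qed

lemma debye_phase_strict_mono:
  assumes "0 \<le> m" "m < x" "x < y" shows "debye_phase m x < debye_phase m y"
proof (rule DERIV_pos_imp_increasing[OF assms(3)])
  fix z assume z: "x \<le> z" "z \<le> y"
  have "sqrt (z\<^sup>2 - m\<^sup>2) / z > 0" using assms z by (auto intro!: divide_pos_pos simp: power_strict_mono)
  then show "\<exists>d. (debye_phase m has_real_derivative d) (at z) \<and> 0 < d"
    using debye_phase_deriv[of m z] assms z by auto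
qed

lemma debye_phase_mono:
  assumes "0 \<le> m" "m < x" "x \<le> y" shows "debye_phase m x \<le> debye_phase m y"
  using debye_phase_strict_mono[of m x y] assms by (cases "x = y") auto

text \<open>In the variable \<open>s = debye_phase m x\<close> the function \<open>v = x J\<^sub>m' / r\<^sup>1\<^sup>/\<^sup>2\<close>, \<open>r = (x\<^sup>2 - m\<^sup>2)\<^sup>1\<^sup>/\<^sup>2\<close>, satisfies
  \<open>v'' + (1 - Q) v = 0\<close> with \<open>Q = x\<^sup>2 (7 x\<^sup>2 / 4 - r\<^sup>2) / r\<^sup>6 > 0\<close>. The quantity below is the Wronskian of \<open>v\<close> and
  a shifted sine, up to the factor \<open>r\<^sup>1\<^sup>/\<^sup>2\<close>.\<close>

definition phase_wronskian :: "nat \<Rightarrow> real \<Rightarrow> real \<Rightarrow> real" where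
  "phase_wronskian m p x =
     (let r = sqrt (x\<^sup>2 - (real m)\<^sup>2); \<phi> = debye_phase m x - debye_phase m p in
      (- (r * bessel_J m x) - x\<^sup>2 / (2 * r ^ 3) * bessel_D m x) * sin \<phi> - bessel_D m x * cos \<phi>)"

text \<open>The first summand is the Wronskian times the logarithmic derivative x/(2 r^2) of sqrt r,
  so it disappears on division by sqrt r. The second carries the sign of Q.\<close>

lemma phase_wronskian_deriv:
  assumes "real m < x"
  defines "r \<equiv> sqrt (x\<^sup>2 - (real m)\<^sup>2)"
  shows "(phase_wronskian m p has_real_derivative
     x / (2 * r\<^sup>2) * phase_wronskian m p x
     + bessel_D m x * sin (debye_phase m x - debye_phase m p) * (x * (7 / 4 * x\<^sup>2 - r\<^sup>2) / r ^ 5)) (at x)"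
proof -
  have pos: "x\<^sup>2 - (real m)\<^sup>2 > 0" using assms by (simp add: power_strict_mono)
  have r: "r > 0" "(real m)\<^sup>2 = x\<^sup>2 - r\<^sup>2" using pos by (auto simp: r_def)
  have x: "x > 0" "x \<noteq> 0" using assms by linarith+
  have dr: "((\<lambda>x. sqrt (x\<^sup>2 - (real m)\<^sup>2)) has_real_derivative x / r) (at x)"
    unfolding r_def using pos by (auto intro!: derivative_eq_intros simp: field_simps)
  have d\<phi>: "((\<lambda>x. debye_phase m x - debye_phase m p) has_real_derivative r / x) (at x)"
    unfolding r_def using debye_phase_deriv[of "real m" x] assms by (auto intro!: derivative_eq_intros)
  define S C J D where "S = sin (debye_phase m x - debye_phase m p)"
    and "C = cos (debye_phase m x - debye_phase m p)" and "J = bessel_J m x" and "D = bessel_D m x"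
  have dS: "((\<lambda>x. sin (debye_phase m x - debye_phase m p)) has_real_derivative C * (r / x)) (at x)"
    unfolding C_def by (rule DERIV_chain2[OF DERIV_sin d\<phi>])
  have dC: "((\<lambda>x. cos (debye_phase m x - debye_phase m p)) has_real_derivative - S * (r / x)) (at x)"
    unfolding S_def by (rule DERIV_chain2[OF DERIV_cos d\<phi>])
  have dJ: "(bessel_J m has_real_derivative D / x) (at x)"
    unfolding D_def by (rule bessel_J_deriv[OF x(2)])
  have dD: "(bessel_D m has_real_derivative - (r\<^sup>2 / x) * J) (at x)"
    using bessel_D_deriv[OF x(2), of m] unfolding r(2) J_def by simp
  have da: "((\<lambda>x. x\<^sup>2 / (2 * sqrt (x\<^sup>2 - (real m)\<^sup>2) ^ 3)) has_real_derivative
      x / r ^ 3 - 3 * x ^ 3 / (2 * r ^ 5)) (at x)"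
  proof -
    have "((\<lambda>x. x\<^sup>2 / (2 * sqrt (x\<^sup>2 - (real m)\<^sup>2) ^ 3)) has_real_derivative
        ((2 * x) * (2 * r ^ 3) - x\<^sup>2 * (2 * (3 * r\<^sup>2 * (x / r)))) / ((2 * r ^ 3) * (2 * r ^ 3))) (at x)"
    proof (rule DERIV_cong[OF DERIV_divide[OF _ DERIV_cmult[OF DERIV_power[OF dr]]]])
      show "((\<lambda>x. x\<^sup>2) has_real_derivative 2 * x) (at x)" by (auto intro!: derivative_eq_intros)
    qed (use r(1) in \<open>auto simp: r_def[symmetric] mult_ac numeral_2_eq_2[symmetric]\<close>)
    moreover have "((2 * x) * (2 * r ^ 3) - x\<^sup>2 * (2 * (3 * r\<^sup>2 * (x / r)))) / ((2 * r ^ 3) * (2 * r ^ 3))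
       = x / r ^ 3 - 3 * x ^ 3 / (2 * r ^ 5)"
      using r(1) by (simp add: field_simps eval_nat_numeral)
    ultimately show ?thesis by simp
  qed
  have "(phase_wronskian m p has_real_derivative
     ((- (x / r * J + D / x * r) - ((x / r ^ 3 - 3 * x ^ 3 / (2 * r ^ 5)) * D + - (r\<^sup>2 / x) * J * (x\<^sup>2 / (2 * r ^ 3)))) * S
       + C * (r / x) * (- (r * J) - x\<^sup>2 / (2 * r ^ 3) * D))
     - (- (r\<^sup>2 / x) * J * C + - S * (r / x) * D)) (at x)"
    unfolding phase_wronskian_def Let_def
    unfolding S_def C_def
    by (rule DERIV_cong[OF DERIV_diff[OF DERIV_mult[OF DERIV_diff[OF DERIV_minus[OF DERIV_mult[OF dr dJ]] DERIV_mult[OF da dD]] dS]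
          DERIV_mult[OF dD dC]]])
      (simp add: r_def J_def D_def S_def C_def)
  moreover have "((- (x / r * J + D / x * r) - ((x / r ^ 3 - 3 * x ^ 3 / (2 * r ^ 5)) * D + - (r\<^sup>2 / x) * J * (x\<^sup>2 / (2 * r ^ 3)))) * S
       + C * (r / x) * (- (r * J) - x\<^sup>2 / (2 * r ^ 3) * D))
     - (- (r\<^sup>2 / x) * J * C + - S * (r / x) * D)
     = x / (2 * r\<^sup>2) * ((- (r * J) - x\<^sup>2 / (2 * r ^ 3) * D) * S - D * C) + D * S * (x * (7 / 4 * x\<^sup>2 - r\<^sup>2) / r ^ 5)"
    using r(1) x(1) by (simp add: field_simps eval_nat_numeral)
  ultimately show ?thesis
    by (simp add: phase_wronskian_def Let_def S_def C_def J_def D_def r_def[symmetric])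
qed

text \<open>With a gap below pi the sine stays positive, so the normalised Wronskian
  \<open>F\<close> increases from 0 and \<open>F q\<close> > 0. This forces \<sigma> J_m(q) < 0, and
  by Bessel's equation \<sigma> D has positive slope at q > m, impossible for a positive function
  that descends to 0 there.\<close>

lemma bessel_D_zero_gap_aux:
  assumes mp: "real m < p" "p < q" and z: "bessel_D m p = 0" "bessel_D m q = 0"
    and gap: "debye_phase m q - debye_phase m p < pi"
    and pos: "\<And>x. p < x \<Longrightarrow> x < q \<Longrightarrow> \<sigma> * bessel_D m x > 0"
  shows False
proof -
  define F where "F x = \<sigma> * (phase_wronskian m p x / sqrt (sqrt (x\<^sup>2 - (real m)\<^sup>2)))" for x
  have rpos: "sqrt (x\<^sup>2 - (real m)\<^sup>2) > 0" if "p \<le> x" for x using that mp by (simp add: power_strict_mono)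
  have dF: "(F has_real_derivative (\<sigma> * bessel_D m x) * sin (debye_phase m x - debye_phase m p) *
      (x * (7 / 4 * x\<^sup>2 - (sqrt (x\<^sup>2 - (real m)\<^sup>2))\<^sup>2) / sqrt (x\<^sup>2 - (real m)\<^sup>2) ^ 5) / sqrt (sqrt (x\<^sup>2 - (real m)\<^sup>2))) (at x)"
    if x: "p \<le> x" for x
  proof -
    define r s where "r = sqrt (x\<^sup>2 - (real m)\<^sup>2)" and "s = sqrt r"
    define T where "T = bessel_D m x * sin (debye_phase m x - debye_phase m p) * (x * (7 / 4 * x\<^sup>2 - r\<^sup>2) / r ^ 5)"
    have r: "r > 0" using rpos[OF x] by (simp add: r_def)
    have s: "s > 0" "r = s * s" using r by (auto simp: s_def)
    have dr: "((\<lambda>x. sqrt (x\<^sup>2 - (real m)\<^sup>2)) has_real_derivative x / r) (at x)"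
      unfolding r_def using rpos[OF x] by (auto intro!: derivative_eq_intros simp: field_simps)
    have ds: "((\<lambda>x. sqrt (sqrt (x\<^sup>2 - (real m)\<^sup>2))) has_real_derivative inverse s / 2 * (x / r)) (at x)"
      unfolding s_def r_def
      by (rule DERIV_chain2[OF DERIV_real_sqrt dr[unfolded r_def]]) (use rpos[OF x] in simp)
    have dN: "(phase_wronskian m p has_real_derivative x / (2 * r\<^sup>2) * phase_wronskian m p x + T) (at x)"
      using phase_wronskian_deriv[of m x p] mp x by (simp add: r_def T_def)
    have "(F has_real_derivative \<sigma> * (((x / (2 * r\<^sup>2) * phase_wronskian m p x + T) * s
        - phase_wronskian m p x * (inverse s / 2 * (x / r))) / (s * s))) (at x)"
      unfolding F_def
      by (rule DERIV_cong[OF DERIV_cmult[OF DERIV_divide[OF dN ds]]]) (use s(1) in \<open>auto simp: s_def r_def\<close>)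
    moreover have "\<sigma> * (((x / (2 * r\<^sup>2) * phase_wronskian m p x + T) * s
        - phase_wronskian m p x * (inverse s / 2 * (x / r))) / (s * s)) = \<sigma> * T / s"
      unfolding s(2) using s(1) by (simp add: field_simps eval_nat_numeral)
    ultimately show ?thesis by (simp add: T_def s_def r_def mult_ac)
  qed
  have "F p < F q"
  proof (rule DERIV_pos_imp_increasing_open[OF mp(2)])
    fix x assume x: "p < x" "x < q"
    have "debye_phase m p < debye_phase m x" "debye_phase m x < debye_phase m q"
      using debye_phase_strict_mono[of "real m" p x] debye_phase_strict_mono[of "real m" x q] mp x by auto
    then have "sin (debye_phase m x - debye_phase m p) > 0" using gap by (intro sin_gt_zero) auto
    moreover have "7 / 4 * x\<^sup>2 - (sqrt (x\<^sup>2 - (real m)\<^sup>2))\<^sup>2 > 0"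
    proof -
      have "(sqrt (x\<^sup>2 - (real m)\<^sup>2))\<^sup>2 = x\<^sup>2 - (real m)\<^sup>2" using rpos[of x] x by simp
      moreover have "x\<^sup>2 > 0" using mp x by (simp add: zero_less_power2)
      moreover have "(real m)\<^sup>2 \<ge> 0" by simp
      ultimately show ?thesis by linarith
    qed
    moreover have "x > 0" using mp x by linarith
    ultimately have "(\<sigma> * bessel_D m x) * sin (debye_phase m x - debye_phase m p) *
      (x * (7 / 4 * x\<^sup>2 - (sqrt (x\<^sup>2 - (real m)\<^sup>2))\<^sup>2) / sqrt (x\<^sup>2 - (real m)\<^sup>2) ^ 5) / sqrt (sqrt (x\<^sup>2 - (real m)\<^sup>2)) > 0"
      using rpos[of x] x by (intro divide_pos_pos mult_pos_pos[OF mult_pos_pos[OF pos]] mult_pos_pos zero_less_power) auto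
    then show "\<exists>d. (F has_real_derivative d) (at x) \<and> 0 < d" using dF[of x] x by auto
  next
    show "continuous_on {p..q} F" using dF by (intro DERIV_continuous_on[of _ F]) (auto intro: has_field_derivative_at_within)
  qed
  moreover have "F p = 0" by (simp add: F_def phase_wronskian_def z)
  moreover have "F q = - (sqrt (q\<^sup>2 - (real m)\<^sup>2) / sqrt (sqrt (q\<^sup>2 - (real m)\<^sup>2)) * sin (debye_phase m q - debye_phase m p)) * (\<sigma> * bessel_J m q)"
    by (simp add: F_def phase_wronskian_def z Let_def)
  moreover have "sqrt (q\<^sup>2 - (real m)\<^sup>2) / sqrt (sqrt (q\<^sup>2 - (real m)\<^sup>2)) * sin (debye_phase m q - debye_phase m p) > 0"
    using rpos[of q] mp gap debye_phase_strict_mono[of "real m" p q]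
    by (intro mult_pos_pos divide_pos_pos sin_gt_zero) auto
  ultimately have neg: "\<sigma> * bessel_J m q < 0"
    by (metis mult_less_0_iff neg_less_0_iff_less mult_minus_left less_asym)
  have "((\<lambda>x. \<sigma> * bessel_D m x) has_real_derivative \<sigma> * (((real m)\<^sup>2 - q\<^sup>2) / q * bessel_J m q)) (at q)"
    using mp by (intro DERIV_cmult bessel_D_deriv) auto
  moreover have "\<sigma> * (((real m)\<^sup>2 - q\<^sup>2) / q * bessel_J m q) > 0"
  proof -
    have "((real m)\<^sup>2 - q\<^sup>2) / q < 0" using mp by (intro divide_neg_pos) (auto simp: power_strict_mono)
    then have "((real m)\<^sup>2 - q\<^sup>2) / q * (\<sigma> * bessel_J m q) > 0" using neg by (rule mult_neg_neg)
    then show ?thesis by (simp add: mult_ac)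
  qed
  ultimately obtain d where d: "d > 0" "\<And>h. 0 < h \<Longrightarrow> h < d \<Longrightarrow> \<sigma> * bessel_D m (q - h) < \<sigma> * bessel_D m q"
    using DERIV_pos_inc_left by blast
  define h where "h = min (d / 2) ((q - p) / 2)"
  have "0 < h" "h < d" "p < q - h" "q - h < q" using d(1) mp by (auto simp: h_def min_def field_simps)
  then show False using d(2)[of h] pos[of "q - h"] z by simp
qed

text \<open>Reduction to consecutive zeros: D cannot vanish on a whole interval, since then J_m
  would have a double zero, and around a point with D nonzero the nearest zeros exist by
  compactness.\<close>

lemma bessel_D_zero_gap:
  assumes mp: "real m < p" "p < q" and z: "bessel_D m p = 0" "bessel_D m q = 0"
  shows "debye_phase m q - debye_phase m p \<ge> pi"
proof (rule ccontr)
  assume gap: "\<not> ?thesis"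
  have "\<exists>c. p < c \<and> c < q \<and> bessel_D m c \<noteq> 0"
  proof (rule ccontr)
    assume "\<not> ?thesis"
    then have zero: "bessel_D m x = 0" if "p < x" "x < q" for x using that by auto
    define c where "c = (p + q) / 2"
    have c: "p < c" "c < q" using mp by (auto simp: c_def)
    have "((\<lambda>x. 0) has_real_derivative ((real m)\<^sup>2 - c\<^sup>2) / c * bessel_J m c) (at c)"
      by (rule has_field_derivative_transform_within_open[OF bessel_D_deriv, where S = "{p<..<q}"])
        (use mp c zero in auto)
    then have "((real m)\<^sup>2 - c\<^sup>2) / c * bessel_J m c = 0" using DERIV_unique DERIV_const by blast
    moreover have "(real m)\<^sup>2 < c\<^sup>2" using mp c by (intro power_strict_mono) auto
    ultimately have "bessel_J m c = 0" using mp c by auto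
    then show False using bessel_J_no_double_zero[of c m] zero[OF c] mp c by auto
  qed
  then obtain c where c: "p < c" "c < q" "bessel_D m c \<noteq> 0" by blast
  have closed: "compact {x \<in> {a..b}. bessel_D m x = 0}" for a b
  proof -
    have "closed {x \<in> {a..b}. bessel_D m x = 0}"
      by (intro continuous_closed_preimage_constant continuous_on_bessel_D) auto
    moreover have "bounded {x \<in> {a..b}. bessel_D m x = 0}"
      by (rule bounded_subset[OF bounded_closed_interval[of a b]]) auto
    ultimately show ?thesis by (simp add: compact_eq_bounded_closed)
  qed
  obtain p' where p': "p \<le> p'" "p' \<le> c" "bessel_D m p' = 0" "\<And>x. p \<le> x \<Longrightarrow> x \<le> c \<Longrightarrow> bessel_D m x = 0 \<Longrightarrow> x \<le> p'"
  proof -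
    have "p \<in> {x \<in> {p..c}. bessel_D m x = 0}" using z c by simp
    then show ?thesis using compact_attains_sup[OF closed[of p c]] that by force
  qed
  obtain q' where q': "c \<le> q'" "q' \<le> q" "bessel_D m q' = 0" "\<And>x. c \<le> x \<Longrightarrow> x \<le> q \<Longrightarrow> bessel_D m x = 0 \<Longrightarrow> q' \<le> x"
  proof -
    have "q \<in> {x \<in> {c..q}. bessel_D m x = 0}" using z c by simp
    then show ?thesis using compact_attains_inf[OF closed[of c q]] that by force
  qed
  have lt: "p' < c" "c < q'" using p' q' c by (auto simp: less_le)
  define \<sigma> where "\<sigma> = sgn (bessel_D m c)"
  have nz: "bessel_D m x \<noteq> 0" if "p' < x" "x < q'" for x
  proof
    assume D: "bessel_D m x = 0"
    show False
    proof (cases "x \<le> c")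
      case True
      have "x \<le> p'" using p'(1) that(1) True D by (intro p'(4)) auto
      then show False using that(1) by simp
    next
      case False
      have "q' \<le> x" using q'(2) that(2) False D by (intro q'(4)) auto
      then show False using that(2) by simp
    qed
  qed
  have pos: "\<sigma> * bessel_D m x > 0" if x: "p' < x" "x < q'" for x
  proof (rule ccontr)
    assume neg: "\<not> ?thesis"
    have cpos: "\<sigma> * bessel_D m c > 0" using c(3) by (simp add: \<sigma>_def sgn_if mult_neg_neg)
    have "\<exists>y. p' < y \<and> y < q' \<and> \<sigma> * bessel_D m y = 0"
    proof (cases "x \<le> c")
      case True
      have "continuous_on {x..c} (\<lambda>x. \<sigma> * bessel_D m x)" by (intro continuous_intros continuous_on_bessel_D)
      then obtain y where "x \<le> y" "y \<le> c" "\<sigma> * bessel_D m y = 0"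
        using IVT'[of "\<lambda>x. \<sigma> * bessel_D m x" x 0 c] neg cpos True by auto
      then show ?thesis using x lt by (intro exI[of _ y]) auto
    next
      case False
      have "continuous_on {c..x} (\<lambda>x. \<sigma> * bessel_D m x)" by (intro continuous_intros continuous_on_bessel_D)
      then obtain y where "c \<le> y" "y \<le> x" "\<sigma> * bessel_D m y = 0"
        using IVT2'[of "\<lambda>x. \<sigma> * bessel_D m x" x 0 c] neg cpos False by auto
      then show ?thesis using x lt by (intro exI[of _ y]) auto
    qed
    then show False using nz c(3) by (auto simp: \<sigma>_def sgn_if split: if_splits)
  qed
  have "debye_phase m q' \<le> debye_phase m q" "debye_phase m p \<le> debye_phase m p'"
    using mp(1) p'(1) q'(1,2) c(1) by (auto intro!: debye_phase_mono)
  then have "debye_phase m q' - debye_phase m p' < pi" using gap by linarith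
  then show False
    using bessel_D_zero_gap_aux[of m p' q' \<sigma>] mp p' q' lt pos by auto
qed

lemma bessel_D_zero_gaps:
  assumes z: "strict_mono_on {..<N} z" "\<And>i. i < N \<Longrightarrow> real m < z i \<and> bessel_D m (z i) = 0"
    and "i + d < N"
  shows "debye_phase m (z i) + real d * pi \<le> debye_phase m (z (i + d))"
  using assms(3)
proof (induction d)
  case (Suc d)
  have "z (i + d) < z (i + Suc d)" using z(1) Suc.prems by (auto simp: strict_mono_on_def)
  then have "debye_phase m (z (i + Suc d)) - debye_phase m (z (i + d)) \<ge> pi"
    using z(2)[of "i + d"] z(2)[of "i + Suc d"] Suc.prems by (intro bessel_D_zero_gap) auto
  then show ?case using Suc by (simp add: algebra_simps)
qed simp

text \<open>Each step down from the N-th zero lowers the phase by at least pi. After N - j steps the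
  j-th zero has a phase not above that of \<Lambda>, hence lies at or below \<Lambda>.\<close>

lemma has_zeros_bessel_D_descend:
  assumes hz: "has_zeros (bessel_D m) N X" and "j \<le> N" and lam: "real m < \<Lambda>"
    and X: "real m < X" "debye_phase m X \<le> debye_phase m \<Lambda> + real (N - j) * pi"
  shows "has_zeros (bessel_D m) j \<Lambda>"
proof (cases j)
  case 0
  then show ?thesis by (simp add: has_zeros_0)
next
  case (Suc k)
  obtain z where z: "strict_mono_on {..<N} z" "\<And>i. i < N \<Longrightarrow> 0 < z i \<and> z i \<le> X \<and> bessel_D m (z i) = 0"
    using hz by (auto simp: has_zeros_def)
  have zm: "real m < z i \<and> bessel_D m (z i) = 0" if "i < N" for i
    using z(2)[OF that] bessel_D_nonzero[of "z i" m] by (cases "z i \<le> real m") auto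
  have N: "N - 1 = k + (N - j)" "k + (N - j) < N" using Suc assms(2) by auto
  have "debye_phase m (z k) + real (N - j) * pi \<le> debye_phase m (z (N - 1))"
    unfolding N(1) by (rule bessel_D_zero_gaps[OF z(1) zm N(2)])
  also have "\<dots> \<le> debye_phase m X"
    using z(2)[of "N - 1"] zm[of "N - 1"] Suc assms(2) by (intro debye_phase_mono) auto
  finally have "debye_phase m (z k) \<le> debye_phase m \<Lambda>" using X(2) by simp
  then have "z k \<le> \<Lambda>" using debye_phase_strict_mono[of m \<Lambda> "z k"] lam by (cases "z k \<le> \<Lambda>") auto
  moreover have "z i \<le> z k" if "i < j" for i
    using z(1) that Suc assms(2) by (cases "i = k") (auto simp: strict_mono_on_def intro: less_imp_le)
  ultimately have "0 < z i \<and> z i \<le> \<Lambda> \<and> bessel_D m (z i) = 0" if "i < j" for i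
    using z(2)[of i] that assms(2) by fastforce
  moreover have "strict_mono_on {..<j} z" using z(1) assms(2) by (auto simp: strict_mono_on_def)
  ultimately show ?thesis unfolding has_zeros_def by blast
qed

lemma debye_phase_upper:
  assumes "\<epsilon> > 0"
  shows "\<forall>\<^sub>F x in at_top. debye_phase (real m) x \<le> x - real m * (pi / 2) + \<epsilon>"
proof -
  have "((\<lambda>x. real m * arccos (real m / x)) \<longlongrightarrow> real m * arccos 0) at_top"
  proof (intro tendsto_mult tendsto_const isCont_tendsto_compose[of _ arccos])
    show "isCont arccos 0" by (rule isCont_arccos) auto
    show "((\<lambda>x. real m / x) \<longlongrightarrow> 0) at_top" by real_asymp
  qed
  then have "\<forall>\<^sub>F x in at_top. real m * arccos (real m / x) > real m * (pi / 2) - \<epsilon>"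
    using assms by (intro order_tendstoD) auto
  then show ?thesis using eventually_ge_at_top[of "real m"]
  proof eventually_elim
    case (elim x)
    have "sqrt (x\<^sup>2 - (real m)\<^sup>2) \<le> sqrt (x\<^sup>2)" by (intro real_sqrt_le_mono) simp
    also have "\<dots> = x" using elim by (simp add: real_sqrt_abs)
    finally show ?case using elim by (simp add: debye_phase_def)
  qed
qed

text \<open>Here \<open>149/200\<close> is a rational lower bound for the sharp constant \<open>3/4\<close>, obtained from a numerical upper bound
  for the third zero of \<open>J\<^sub>0\<close>.\<close>

lemma bessel_D_zeros:
  assumes "n \<ge> 1" "real m < \<Lambda>" and ph: "(real n - 149 / 200) * pi \<le> debye_phase m \<Lambda>"
  shows "has_zeros (bessel_D m) (if m = 0 then n - 1 else n) \<Lambda>"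
proof -
  obtain G \<beta> where "bessel_phase G \<beta>"
    by (rule bessel_J_asymptotic[of "3 * pi - 8655 / 1000"]) (rule that, rule bessel_phase.intro)
  then interpret bessel_phase G \<beta> .
  \<comment> \<open>The lower bound 3 pi - 8.655 for \<beta> exceeds 49/200 pi by less than 0.0001.
    Half of the excess of \<beta> goes into \<open>X\<close>, half into the estimate of the phase at
    \<open>X k\<close>.\<close>
  define \<epsilon> where "\<epsilon> = (\<beta> - 49 / 200 * pi) / 2"
  have \<epsilon>: "\<epsilon> > 0" using \<beta>(1) pi_approx by (simp add: \<epsilon>_def)
  define X where "X k = real k * pi - \<beta> + (real m + 1) * (pi / 2) + \<epsilon>" for k :: nat
  have Xlim: "filterlim X at_top sequentially" unfolding X_def by real_asymp
  have "\<forall>\<^sub>F k in sequentially. has_zeros (bessel_D m) (if m = 0 then k else Suc k) (X k)"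
    using zeros_D[OF \<epsilon>, of m] zeros_D_0[OF \<epsilon>] by (cases "m = 0") (auto simp: X_def)
  moreover have "\<forall>\<^sub>F k in sequentially. debye_phase m (X k) \<le> X k - real m * (pi / 2) + \<epsilon>"
    by (rule eventually_compose_filterlim[OF debye_phase_upper[OF \<epsilon>] Xlim])
  moreover have "\<forall>\<^sub>F k in sequentially. real m < X k"
    by (rule filterlim_at_top_dense[THEN iffD1, OF Xlim, rule_format])
  ultimately have "\<forall>\<^sub>F k in sequentially. has_zeros (bessel_D m) (if m = 0 then n - 1 else n) \<Lambda>"
    using eventually_ge_at_top[of n]
  proof eventually_elim
    case (elim k)
    show ?case
    proof (rule has_zeros_bessel_D_descend[OF elim(1) _ assms(2) elim(3)])
      \<comment> \<open>For m = 0 one zero less is known and one zero less is claimed, so the number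
        of steps down is the same.\<close>
      have "(if m = 0 then k else Suc k) - (if m = 0 then n - 1 else n) = Suc k - n"
        using elim(4) assms(1) by auto
      moreover have "debye_phase m (X k) \<le> debye_phase m \<Lambda> + real (Suc k - n) * pi"
      proof -
        \<comment> \<open>As 1/2 - 49/200 = 1 - 149/200, this is the threshold phase belonging to n
          = Suc k.\<close>
        have "X k - real m * (pi / 2) + \<epsilon> = real k * pi + pi / 2 - 49 / 200 * pi"
          by (simp add: X_def \<epsilon>_def field_simps)
        also have "\<dots> = (real n - 149 / 200) * pi + real (Suc k - n) * pi"
          using elim(4) by (simp add: of_nat_diff Suc_diff_le algebra_simps)
        finally show ?thesis using ph elim(2) by linarith
      qed
      ultimately show "debye_phase m (X k) \<le> debye_phase m \<Lambda> +
          real ((if m = 0 then k else Suc k) - (if m = 0 then n - 1 else n)) * pi" by simp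
    qed (use elim(4) in auto)
  qed
  then show ?thesis by (simp add: eventually_const)
qed

section \<open>Counting lattice points\<close>

lemma le_of_deriv_le:
  fixes f g f' g' :: "real \<Rightarrow> real"
  assumes "a \<le> u" "f a \<le> g a"
    and "\<And>x. (f has_real_derivative f' x) (at x)" "\<And>x. (g has_real_derivative g' x) (at x)"
    and "\<And>x. a \<le> x \<Longrightarrow> x \<le> u \<Longrightarrow> f' x \<le> g' x"
  shows "f u \<le> g u"
proof -
  have "g a - f a \<le> g u - f u"
  proof (rule DERIV_nonneg_imp_nondecreasing[OF assms(1), of "\<lambda>x. g x - f x"])
    fix x assume "a \<le> x" "x \<le> u"
    then show "\<exists>y. ((\<lambda>x. g x - f x) has_real_derivative y) (at x) \<and> 0 \<le> y"
      using assms(5)[of x] by (intro exI[of _ "g' x - f' x"]) (auto intro!: DERIV_diff assms(3,4))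
  qed
  then show ?thesis using assms(2) by simp
qed

text \<open>With m = \<Lambda> cos t the phase of \<Lambda> is \<Lambda> times
  \<open>spiral t\<close>, so the boundary of the lattice region is parametrised by the angle
  t.\<close>

definition spiral :: "real \<Rightarrow> real" where "spiral t = sin t - t * cos t"

lemma spiral_deriv: "(spiral has_real_derivative t * sin t) (at t)"
  unfolding spiral_def[abs_def] by (auto intro!: derivative_eq_intros)

lemma spiral_strict_mono:
  assumes "0 \<le> a" "a < b" "b \<le> pi / 2" shows "spiral a < spiral b"
proof (rule DERIV_pos_imp_increasing_open[OF assms(2)])
  fix t assume t: "a < t" "t < b"
  have "sin t > 0" using t assms by (intro sin_gt_zero) auto
  then have "t * sin t > 0" using t assms by simp
  then show "\<exists>y. (spiral has_real_derivative y) (at t) \<and> 0 < y" using spiral_deriv by blast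
qed (auto simp: spiral_def[abs_def] intro!: continuous_intros)

text \<open>Each bound integrates the previous one, alternating between sine and cosine; those for
  \<open>spiral\<close> come from its derivative t sin t.\<close>

lemma taylor_bounds:
  assumes "0 \<le> (u::real)"
  shows "1 - u\<^sup>2 / 2 + u ^ 4 / 24 - u ^ 6 / 720 \<le> cos u"
    "u ^ 3 / 3 - u ^ 5 / 30 \<le> spiral u" "spiral u \<le> u ^ 3 / 3 - u ^ 5 / 30 + u ^ 7 / 840"
proof -
  have s1: "sin u \<le> u" if "0 \<le> u" for u :: real
    by (rule le_of_deriv_le[OF that, of sin "\<lambda>x. x" cos "\<lambda>x. 1"]) (auto intro!: derivative_eq_intros)
  have c1: "1 - u\<^sup>2 / 2 \<le> cos u" if "0 \<le> u" for u :: real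
    by (rule le_of_deriv_le[OF that, of "\<lambda>x. 1 - x\<^sup>2 / 2" cos "\<lambda>x. - x" "\<lambda>x. - sin x"])
      (auto intro!: derivative_eq_intros s1)
  have s2: "u - u ^ 3 / 6 \<le> sin u" if "0 \<le> u" for u :: real
    by (rule le_of_deriv_le[OF that, of "\<lambda>x. x - x ^ 3 / 6" sin "\<lambda>x. 1 - x\<^sup>2 / 2" cos])
      (auto intro!: derivative_eq_intros c1)
  have c2: "cos u \<le> 1 - u\<^sup>2 / 2 + u ^ 4 / 24" if "0 \<le> u" for u :: real
    by (rule le_of_deriv_le[OF that, of cos "\<lambda>x. 1 - x\<^sup>2 / 2 + x ^ 4 / 24" "\<lambda>x. - sin x" "\<lambda>x. - (x - x ^ 3 / 6)"])
      (use s2 in \<open>auto intro!: derivative_eq_intros simp: field_simps\<close>)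
  have s3: "sin u \<le> u - u ^ 3 / 6 + u ^ 5 / 120" if "0 \<le> u" for u :: real
    by (rule le_of_deriv_le[OF that, of sin "\<lambda>x. x - x ^ 3 / 6 + x ^ 5 / 120" cos "\<lambda>x. 1 - x\<^sup>2 / 2 + x ^ 4 / 24"])
      (auto intro!: derivative_eq_intros c2)
  show "1 - u\<^sup>2 / 2 + u ^ 4 / 24 - u ^ 6 / 720 \<le> cos u"
    by (rule le_of_deriv_le[OF assms, of "\<lambda>x. 1 - x\<^sup>2 / 2 + x ^ 4 / 24 - x ^ 6 / 720" cos "\<lambda>x. - (x - x ^ 3 / 6 + x ^ 5 / 120)" "\<lambda>x. - sin x"])
      (use s3 in \<open>auto intro!: derivative_eq_intros simp: field_simps\<close>)
  show "u ^ 3 / 3 - u ^ 5 / 30 \<le> spiral u"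
  proof (rule le_of_deriv_le[OF assms, of "\<lambda>x. x ^ 3 / 3 - x ^ 5 / 30" spiral "\<lambda>x. x * (x - x ^ 3 / 6)" "\<lambda>x. x * sin x"])
    show "((\<lambda>x. x ^ 3 / 3 - x ^ 5 / 30) has_real_derivative x * (x - x ^ 3 / 6)) (at x)" for x :: real
      by (auto intro!: derivative_eq_intros simp: field_simps eval_nat_numeral)
  qed (auto intro!: spiral_deriv mult_left_mono s2 simp: spiral_def)
  show "spiral u \<le> u ^ 3 / 3 - u ^ 5 / 30 + u ^ 7 / 840"
  proof (rule le_of_deriv_le[OF assms, of spiral "\<lambda>x. x ^ 3 / 3 - x ^ 5 / 30 + x ^ 7 / 840" "\<lambda>x. x * sin x" "\<lambda>x. x * (x - x ^ 3 / 6 + x ^ 5 / 120)"])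
    show "((\<lambda>x. x ^ 3 / 3 - x ^ 5 / 30 + x ^ 7 / 840) has_real_derivative x * (x - x ^ 3 / 6 + x ^ 5 / 120)) (at x)" for x :: real
      by (auto intro!: derivative_eq_intros simp: field_simps eval_nat_numeral)
  qed (auto intro!: spiral_deriv mult_left_mono s3 simp: spiral_def)
qed

text \<open>\<open>spiral (2 t) / 8\<close> is the antiderivative of \<open>cos t\<close> with respect to \<open>spiral t\<close>, and the curve
  \<open>(spiral t, cos t)\<close> is the graph of a convex function since its slope is \<open>- 1 / t\<close>; so this is the
  trapezoidal rule for that function.\<close>

lemma trapezoid_bound:
  assumes "0 \<le> a" "a \<le> b" "b \<le> pi / 2"
  shows "spiral (2 * b) / 8 - spiral (2 * a) / 8 \<le> (cos a + cos b) / 2 * (spiral b - spiral a)"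
proof -
  \<comment> \<open>The convexity used: the chord from a to x has slope of absolute value at least
    1/x, the value for the tangent at x.\<close>
  have E: "spiral x - spiral a \<le> x * (cos a - cos x)" if x: "a \<le> x" "x \<le> b" for x
  proof (rule le_of_deriv_le[OF x(1), of "\<lambda>x. spiral x - spiral a" "\<lambda>x. x * (cos a - cos x)"
        "\<lambda>x. x * sin x" "\<lambda>x. (cos a - cos x) + x * sin x"])
    show "((\<lambda>x. spiral x - spiral a) has_real_derivative x * sin x) (at x)" for x
      using DERIV_diff[OF spiral_deriv DERIV_const] by simp
    show "((\<lambda>x. x * (cos a - cos x)) has_real_derivative cos a - cos x + x * sin x) (at x)" for x
      by (auto intro!: derivative_eq_intros)
    show "y * sin y \<le> cos a - cos y + y * sin y" if "a \<le> y" "y \<le> x" for y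
      using that x assms cos_monotone_0_pi_le[of a y] by simp
  qed simp
  have "(\<lambda>x. spiral (2 * x) / 8 - spiral (2 * a) / 8) b \<le> (\<lambda>x. (cos a + cos x) / 2 * (spiral x - spiral a)) b"
  proof (rule le_of_deriv_le[OF assms(2)])
    show "((\<lambda>x. spiral (2 * x) / 8 - spiral (2 * a) / 8) has_real_derivative x * sin x * cos x) (at x)" for x
    proof -
      have "((\<lambda>x. spiral (2 * x)) has_real_derivative (2 * x) * sin (2 * x) * 2) (at x)"
        by (rule DERIV_chain2[OF spiral_deriv]) (auto intro!: derivative_eq_intros)
      from DERIV_diff[OF DERIV_cdivide[OF this, of 8] DERIV_const[of "spiral (2 * a) / 8"]] show ?thesis by (simp add: sin_double mult.assoc)
    qed
    show "((\<lambda>x. (cos a + cos x) / 2 * (spiral x - spiral a)) has_real_derivative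
        - sin x / 2 * (spiral x - spiral a) + (cos a + cos x) / 2 * (x * sin x)) (at x)" for x
    proof -
      have "((\<lambda>x. (cos a + cos x) / 2) has_real_derivative - sin x / 2) (at x)"
        by (auto intro!: derivative_eq_intros)
      from DERIV_mult[OF this DERIV_diff[OF spiral_deriv DERIV_const]] show ?thesis by (simp add: mult.commute)
    qed
    show "x * sin x * cos x \<le> - sin x / 2 * (spiral x - spiral a) + (cos a + cos x) / 2 * (x * sin x)"
      if x: "a \<le> x" "x \<le> b" for x
    proof -
      have "0 \<le> sin x" using x assms by (intro sin_ge_zero) auto
      then have "sin x * (spiral x - spiral a) \<le> sin x * (x * (cos a - cos x))"
        by (intro mult_left_mono E x)
      then show ?thesis by (simp add: field_simps)
    qed
  qed simp
  then show ?thesis .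
qed

lemma spiral_0: "spiral 0 = 0" and spiral_pi_half: "spiral (pi / 2) = 1" and spiral_pi: "spiral pi = pi"
  by (auto simp: spiral_def)

lemma spiral_inverse:
  assumes "0 < y" "y \<le> 1" obtains t where "0 < t" "t \<le> pi / 2" "spiral t = y"
proof -
  have "continuous_on {0..pi / 2} spiral" unfolding spiral_def[abs_def] by (intro continuous_intros)
  then obtain t where t: "0 \<le> t" "t \<le> pi / 2" "spiral t = y"
    using IVT'[of spiral 0 y "pi / 2"] assms by (auto simp: spiral_0 spiral_pi_half)
  then have "t \<noteq> 0" using assms(1) spiral_0 by auto
  then show thesis using t that[of t] by (simp add: less_le)
qed

lemma Lambda1_bounds: "Lambda1 > 13" "1 / Lambda1 = 1 / 2 - 4 / (3 * pi)"
proof -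
  have p: "3 * pi - 8 > 0" using pi_gt3 by simp
  show "1 / Lambda1 = 1 / 2 - 4 / (3 * pi)" using p by (simp add: Lambda1_def field_simps)
  have "13 * (3 * pi - 8) < 6 * pi" using pi_approx by simp
  then show "Lambda1 > 13" using p by (simp add: Lambda1_def field_simps)
qed

lemma first_strip_bound:
  assumes \<Lambda>: "\<Lambda> \<ge> Lambda1" and t: "0 < t" "t \<le> pi / 2" "\<Lambda> / pi * spiral t = 51 / 200"
  shows "0 \<le> \<Lambda> * cos t - \<Lambda>\<^sup>2 / pi * (spiral (2 * t) / 4) - \<Lambda> / pi - 149 / 200"
proof -
  have \<Lambda>0: "\<Lambda> > 13" "\<Lambda> > 0" using \<Lambda> Lambda1_bounds(1) by linarith+
  have inv: "1 / \<Lambda> \<le> 1 / 2 - 4 / (3 * pi)"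
    unfolding Lambda1_bounds(2)[symmetric] using \<Lambda> Lambda1_bounds(1) by (intro divide_left_mono) auto
  have S: "spiral t = 51 / 200 * (pi / \<Lambda>)" using t(3) \<Lambda>0 by (simp add: field_simps)
  \<comment> \<open>23/40 lies just above the angle that belongs to \<open>Lambda1\<close>; larger
    \<Lambda> give smaller t.\<close>
  have t0: "t \<le> 23 / 40"
  proof (rule ccontr)
    assume "\<not> ?thesis"
    then have "spiral (23 / 40) < spiral t" using t(2) by (intro spiral_strict_mono) auto
    moreover have "spiral (23 / 40) \<ge> (23 / 40) ^ 3 / 3 - (23 / 40) ^ 5 / 30" by (rule taylor_bounds) simp
    moreover have "spiral t \<le> 51 / 200 * (pi * (1 / 2 - 4 / (3 * pi)))"
      unfolding S using mult_left_mono[OF inv, of pi] by simp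
    moreover have "pi * (1 / 2 - 4 / (3 * pi)) = pi / 2 - 4 / 3" by (simp add: field_simps)
    ultimately show False using pi_approx by (simp add: eval_nat_numeral)
  qed
  define w where "w = t\<^sup>2"
  have w: "0 < w" "w \<le> 529 / 1600"
    using t(1) power_mono[OF t0, of 2] by (auto simp: w_def power2_eq_square)
  have Sp: "spiral t > 0" using spiral_strict_mono[of 0 t] t by (simp add: spiral_0)
  \<comment> \<open>After division by \<Lambda>, the equation for t turns the area term into this
    ratio, which depends on t alone and tends to 2 at 0.\<close>
  have R: "spiral (2 * t) / (4 * spiral t) \<le> (2 - 4 / 5 * w + 4 / 35 * w\<^sup>2) / (1 - w / 10)"
  proof -
    have d: "1 - w / 10 > 0" using w by simp
    have t3: "t ^ 3 > 0" using t(1) by simp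
    have lo: "t ^ 3 / 3 * (1 - w / 10) \<le> spiral t"
      using taylor_bounds(2)[of t] t(1) by (simp add: w_def algebra_simps eval_nat_numeral)
    have "spiral (2 * t) \<le> (2 * t) ^ 3 / 3 - (2 * t) ^ 5 / 30 + (2 * t) ^ 7 / 840"
      using t(1) by (intro taylor_bounds) simp
    also have "\<dots> = 4 * (t ^ 3 / 3) * (2 - 4 / 5 * w + 4 / 35 * w\<^sup>2)"
      by (simp add: w_def power_mult_distrib field_simps eval_nat_numeral)
    finally have hi: "spiral (2 * t) \<le> 4 * (t ^ 3 / 3) * (2 - 4 / 5 * w + 4 / 35 * w\<^sup>2)" .
    have q: "0 \<le> 2 - 4 / 5 * w + 4 / 35 * w\<^sup>2" using w zero_le_power2[of w] by linarith
    have "spiral (2 * t) / (4 * spiral t) \<le> (4 * (t ^ 3 / 3) * (2 - 4 / 5 * w + 4 / 35 * w\<^sup>2)) / (4 * (t ^ 3 / 3 * (1 - w / 10)))"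
    proof (rule frac_le)
      show "0 \<le> 4 * (t ^ 3 / 3) * (2 - 4 / 5 * w + 4 / 35 * w\<^sup>2)" using t3 q by simp
      show "0 < 4 * (t ^ 3 / 3 * (1 - w / 10))" using t3 d by simp
    qed (use hi lo in auto)
    also have "\<dots> = (2 - 4 / 5 * w + 4 / 35 * w\<^sup>2) / (1 - w / 10)" using t3 d by (simp add: field_simps)
    finally show ?thesis .
  qed
  have poly: "51 / 200 * ((2 - 4 / 5 * w + 4 / 35 * w\<^sup>2) / (1 - w / 10))
     \<le> 1 - w / 2 + w\<^sup>2 / 24 - w ^ 3 / 720 - 3748 / 10000"
  proof -
    have d: "1 - w / 10 > 0" using w by simp
    \<comment> \<open>The square is replaced by its tangent at the right end 529/1600 = (23/40)^2,
      where the inequality is tightest. With w^3 bounded linearly as well, a linear inequality in w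
      remains.\<close>
    have w2: "w\<^sup>2 \<ge> 2 * (529 / 1600) * w - (529 / 1600)\<^sup>2"
      using zero_le_power2[of "w - 529 / 1600"] by (simp add: power2_eq_square algebra_simps)
    have w3: "w ^ 3 \<le> (529 / 1600)\<^sup>2 * w"
    proof -
      have "w * w \<le> 529 / 1600 * (529 / 1600)" using w by (intro mult_mono) auto
      then have "w * w * w \<le> 529 / 1600 * (529 / 1600) * w" using w by (intro mult_right_mono) auto
      then show ?thesis by (simp add: eval_nat_numeral)
    qed
    have w4: "w ^ 4 \<ge> 0" by simp
    have "(1 - w / 2 + w\<^sup>2 / 24 - w ^ 3 / 720 - 3748 / 10000) * (1 - w / 10) - 51 / 200 * (2 - 4 / 5 * w + 4 / 35 * w\<^sup>2)
      = (1 - 3748 / 10000 - 51 / 100) + (- 1 / 2 - (1 - 3748 / 10000) / 10 + 51 / 250) * w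
        + (1 / 24 + 1 / 20 - 51 / 1750) * w\<^sup>2 - (1 / 720 + 1 / 240) * w ^ 3 + 1 / 7200 * w ^ 4"
      by (simp add: field_simps eval_nat_numeral)
    also have "\<dots> \<ge> 0" using w w2 w3 w4 by (simp add: power2_eq_square)
    finally have "51 / 200 * (2 - 4 / 5 * w + 4 / 35 * w\<^sup>2) \<le> (1 - w / 2 + w\<^sup>2 / 24 - w ^ 3 / 720 - 3748 / 10000) * (1 - w / 10)"
      by simp
    then show ?thesis by (simp only: times_divide_eq_right pos_divide_le_eq[OF d])
  qed
  have cosb: "1 - w / 2 + w\<^sup>2 / 24 - w ^ 3 / 720 \<le> cos t"
    using taylor_bounds(1)[of t] t(1) by (simp add: w_def flip: power_mult)
  \<comment> \<open>At \<open>Lambda1\<close> the sum 1/pi + (149/200)/\<Lambda> equals 149/400 +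
    1/(150 pi), slightly below 0.3748; this is where the size of \<open>Lambda1\<close> enters
    sharply.\<close>
  have "149 / 200 * (1 / \<Lambda>) \<le> 149 / 200 * (1 / 2 - 4 / (3 * pi))" using inv by (intro mult_left_mono) auto
  moreover have "1 / pi < 1 / 3" using pi_gt3 by (simp add: field_simps)
  ultimately have "1 / pi + 149 / 200 * (1 / \<Lambda>) \<le> 3748 / 10000"
    by (simp add: field_simps)
  then have "0 \<le> cos t - 51 / 200 * (spiral (2 * t) / (4 * spiral t)) - 1 / pi - 149 / 200 * (1 / \<Lambda>)"
    using poly cosb R by linarith
  then have "0 \<le> \<Lambda> * (cos t - 51 / 200 * (spiral (2 * t) / (4 * spiral t)) - 1 / pi - 149 / 200 * (1 / \<Lambda>))"
    using \<Lambda>0 by simp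
  also have "\<dots> = \<Lambda> * cos t - \<Lambda>\<^sup>2 / pi * (spiral (2 * t) / 4) - \<Lambda> / pi - 149 / 200"
  proof -
    have "51 / 200 * (spiral (2 * t) / (4 * spiral t)) = \<Lambda> / pi * (spiral (2 * t) / 4)"
      using t(3) Sp by (simp add: field_simps)
    then show ?thesis using \<Lambda>0 by (simp add: algebra_simps power2_eq_square)
  qed
  finally show ?thesis .
qed

text \<open>The summand 2 z - 1 is a lower bound for the odd number of modes in a row. Between the
  first and the last row the trapezoids have width 1, as the rows are equally spaced in the phase;
  the two end strips are treated separately.\<close>

lemma sum_floor_bound:
  assumes \<Lambda>: "\<Lambda> \<ge> Lambda1" and N: "real N \<le> \<Lambda> / pi + 149 / 200" "\<Lambda> / pi + 149 / 200 < real N + 1"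
    and t: "\<And>n. 1 \<le> n \<Longrightarrow> n \<le> N \<Longrightarrow> 0 < t n \<and> t n \<le> pi / 2 \<and> \<Lambda> / pi * spiral (t n) = real n - 149 / 200"
  shows "\<Lambda>\<^sup>2 / 4 \<le> (\<Sum>n=1..N. 2 * (\<Lambda> * cos (t n)) - 1)"
proof -
  have \<Lambda>0: "\<Lambda> > 13" "\<Lambda> > 0" using \<Lambda> Lambda1_bounds(1) by linarith+
  have "\<Lambda> / pi > 1" using \<Lambda>0 pi_less_4 by (simp add: field_simps)
  then have N1: "1 \<le> N" using N by linarith
  define z where "z n = \<Lambda> * cos (t n)" for n
  \<comment> \<open>Area under the boundary curve up to the angle s. The total is
    \<open>\<Lambda>\<^sup>2 / 8\<close>, half of what is claimed, because modes with m > 0 come in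
    pairs.\<close>
  define A where "A s = \<Lambda>\<^sup>2 / pi * (spiral (2 * s) / 8)" for s
  have trap: "A b - A a \<le> (\<Lambda> * cos a + \<Lambda> * cos b) / 2 * (\<Lambda> / pi * spiral b - \<Lambda> / pi * spiral a)"
    if "0 \<le> a" "a \<le> b" "b \<le> pi / 2" for a b
  proof -
    have "\<Lambda>\<^sup>2 / pi * (spiral (2 * b) / 8 - spiral (2 * a) / 8) \<le> \<Lambda>\<^sup>2 / pi * ((cos a + cos b) / 2 * (spiral b - spiral a))"
      using that \<Lambda>0 by (intro mult_left_mono trapezoid_bound) auto
    then show ?thesis by (simp add: A_def field_simps power2_eq_square)
  qed
  have sums: "A (t k) - A (t 1) \<le> (\<Sum>n=1..k. z n) - z 1 / 2 - z k / 2" if "1 \<le> k" "k \<le> N" for k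
    using that
  proof (induction k rule: dec_induct)
    case base
    then show ?case by simp
  next
    case (step k)
    note tk = t[of k] t[of "Suc k"]
    have "t k \<le> t (Suc k)"
    proof (rule ccontr)
      assume "\<not> ?thesis"
      then have "spiral (t (Suc k)) < spiral (t k)" using tk step by (intro spiral_strict_mono) auto
      then have "\<Lambda> / pi * spiral (t (Suc k)) < \<Lambda> / pi * spiral (t k)" using \<Lambda>0 by (intro mult_strict_left_mono) auto
      then show False using tk step by simp
    qed
    then have "A (t (Suc k)) - A (t k) \<le> (z k + z (Suc k)) / 2 * (\<Lambda> / pi * spiral (t (Suc k)) - \<Lambda> / pi * spiral (t k))"
      unfolding z_def using tk step by (intro trap) auto
    also have "\<Lambda> / pi * spiral (t (Suc k)) - \<Lambda> / pi * spiral (t k) = 1" using tk step by simp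
    finally have "A (t (Suc k)) - A (t k) \<le> (z k + z (Suc k)) / 2" by simp
    moreover have "A (t k) - A (t 1) \<le> (\<Sum>n=1..k. z n) - z 1 / 2 - z k / 2" using step by simp
    moreover have "(\<Sum>n=1..Suc k. z n) = (\<Sum>n=1..k. z n) + z (Suc k)" using step(1) by simp
    ultimately show ?case by (simp add: field_simps)
  qed
  \<comment> \<open>Width of the strip after the last row. The curve ends at height cos(pi/2) = 0,
    so its trapezoid has area \<open>z N / 2 * l\<close>, within the half weight left at the last
    row.\<close>
  define l where "l = \<Lambda> / pi + 149 / 200 - real N"
  have l: "0 \<le> l" "l \<le> 1" using N by (auto simp: l_def)
  note tN = t[of N] and t1 = t[of 1]
  have "A (pi / 2) - A (t N) \<le> (z N + \<Lambda> * cos (pi / 2)) / 2 * (\<Lambda> / pi * spiral (pi / 2) - \<Lambda> / pi * spiral (t N))"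
    unfolding z_def using tN N1 by (intro trap) auto
  also have "\<dots> = z N / 2 * l" using tN N1 by (simp add: spiral_pi_half l_def)
  finally have last: "A (pi / 2) - A (t N) \<le> z N / 2 * l" .
  have zN: "z N \<ge> 0" unfolding z_def using tN N1 \<Lambda>0 by (intro mult_nonneg_nonneg cos_ge_zero) auto
  have "z N * l \<le> z N" using zN l by (simp add: mult_left_le)
  moreover have "A (pi / 2) = \<Lambda>\<^sup>2 / 8" by (simp add: A_def spiral_pi)
  moreover have "0 \<le> z 1 - 2 * A (t 1) - \<Lambda> / pi - 149 / 200"
    using first_strip_bound[OF \<Lambda>, of "t 1"] t1 N1 by (simp add: z_def A_def)
  moreover have "(\<Sum>n=1..N. 2 * (\<Lambda> * cos (t n)) - 1) = 2 * (\<Sum>n=1..N. z n) - real N"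
    by (simp add: z_def sum_subtractf sum_distrib_left)
  ultimately show ?thesis using sums[OF N1 order_refl] last N(1) by linarith
qed

text \<open>For m = 0 the value \<kappa> = 0 of the constant eigenfunction is added; it does not
  come from a positive zero.\<close>

lemma neumann_conditions_of_zeros:
  assumes "\<Lambda> > 0" "has_zeros (bessel_D m) n \<Lambda>"
  obtains K where "finite K" "card K = (if m = 0 then Suc n else n)"
    "\<And>\<kappa>. \<kappa> \<in> K \<Longrightarrow> neumann_condition m \<kappa> \<and> 4 * \<kappa> \<le> \<Lambda>\<^sup>2"
proof -
  obtain z where z: "strict_mono_on {..<n} z" "\<And>i. i < n \<Longrightarrow> 0 < z i \<and> z i \<le> \<Lambda> \<and> bessel_D m (z i) = 0"
    using assms(2) by (auto simp: has_zeros_def)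
  define K0 where "K0 = (\<lambda>i. (z i)\<^sup>2 / 4) ` {..<n}"
  have "inj_on (\<lambda>i. (z i)\<^sup>2 / 4) {..<n}"
  proof (rule inj_onI)
    fix i j assume ij: "i \<in> {..<n}" "j \<in> {..<n}" "(z i)\<^sup>2 / 4 = (z j)\<^sup>2 / 4"
    then have "z i = z j" using z(2)[of i] z(2)[of j] by (auto simp: power2_eq_iff)
    then show "i = j" using strict_mono_on_imp_inj_on[OF z(1)] ij by (auto dest: inj_onD)
  qed
  then have K0: "finite K0" "card K0 = n" by (auto simp: K0_def card_image)
  have nc: "neumann_condition m \<kappa> \<and> 4 * \<kappa> \<le> \<Lambda>\<^sup>2 \<and> \<kappa> > 0" if \<kappa>: "\<kappa> \<in> K0" for \<kappa>
  proof -
    obtain i where i: "i < n" "\<kappa> = (z i)\<^sup>2 / 4" using \<kappa> by (auto simp: K0_def)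
    have "(z i)\<^sup>2 \<le> \<Lambda>\<^sup>2" using z(2)[OF i(1)] by (intro power_mono) auto
    then show ?thesis using z(2)[OF i(1)] by (simp add: i(2) neumann_condition_iff_bessel_D)
  qed
  show thesis
  proof (cases "m = 0")
    case True
    have "0 \<notin> K0" using nc[of 0] by auto
    then show thesis using K0 nc True assms(1)
      by (intro that[of "insert 0 K0"]) (auto simp: neumann_condition_def)
  next
    case False
    then show thesis using K0 nc by (intro that[of K0]) auto
  qed
qed

theorem theorem1p4:
  fixes \<Lambda> :: real
  assumes "\<Lambda> \<ge> Lambda1"
  shows "neumann_counting unit_disk \<Lambda> \<ge> ennreal (\<Lambda>\<^sup>2 / 4)"
proof -
  have \<Lambda>: "\<Lambda> > 0" using assms Lambda1_bounds(1) by linarith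
  define N where "N = nat \<lfloor>\<Lambda> / pi + 149 / 200\<rfloor>"
  have "0 \<le> \<Lambda> / pi" using \<Lambda> by simp
  then have N: "real N \<le> \<Lambda> / pi + 149 / 200" "\<Lambda> / pi + 149 / 200 < real N + 1"
    unfolding N_def by linarith+
  have "\<exists>t. 0 < t \<and> t \<le> pi / 2 \<and> \<Lambda> / pi * spiral t = real n - 149 / 200" if n: "1 \<le> n" "n \<le> N" for n
  proof -
    define y where "y = pi / \<Lambda> * (real n - 149 / 200)"
    have "real n - 149 / 200 \<le> \<Lambda> / pi" using n N(1) by linarith
    then have "y \<le> pi / \<Lambda> * (\<Lambda> / pi)" unfolding y_def using \<Lambda> by (intro mult_left_mono) auto
    moreover have "0 < y" unfolding y_def using \<Lambda> n by (intro mult_pos_pos) auto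
    ultimately obtain t where "0 < t" "t \<le> pi / 2" "spiral t = y"
      using spiral_inverse[of y] \<Lambda> by auto
    then show ?thesis using \<Lambda> by (intro exI[of _ t]) (auto simp: y_def)
  qed
  then obtain t where t: "\<And>n. 1 \<le> n \<Longrightarrow> n \<le> N \<Longrightarrow> 0 < t n \<and> t n \<le> pi / 2 \<and> \<Lambda> / pi * spiral (t n) = real n - 149 / 200"
    by metis
  define z where "z n = \<Lambda> * cos (t n)" for n
  \<comment> \<open>Column m of the lattice. Its cardinality is at most its largest row index, so
    the phase condition of that row suffices for as many frequencies as the column has
    points.\<close>
  define I where "I m = {n \<in> {1..N}. real m \<le> z n}" for m :: nat
  have "\<exists>K. finite K \<and> card K = card (I m) \<and> (\<forall>\<kappa>\<in>K. neumann_condition m \<kappa> \<and> 4 * \<kappa> \<le> \<Lambda>\<^sup>2)" for m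
  proof (cases "I m = {}")
    case True
    then show ?thesis by (intro exI[of _ "{}"]) simp
  next
    case False
    have fin: "finite (I m)" by (simp add: I_def)
    define n where "n = Max (I m)"
    have n: "n \<in> I m" unfolding n_def using fin False by (rule Max_in)
    then have n1: "1 \<le> n" "n \<le> N" "real m \<le> z n" by (auto simp: I_def)
    note tn = t[OF n1(1,2)]
    have "card (I m) \<le> card {1..n}"
      using fin by (intro card_mono) (auto simp: n_def I_def)
    then have le: "card (I m) \<le> n" by simp
    have pos: "1 \<le> card (I m)" using fin False by (simp add: Suc_le_eq card_gt_0_iff)
    have "cos (t n) < cos 0" using tn by (intro cos_monotone_0_pi) auto
    then have "z n < \<Lambda>" using \<Lambda> by (simp add: z_def)
    then have m\<Lambda>: "real m < \<Lambda>" using n1(3) by simp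
    define \<tau> where "\<tau> = arccos (real m / \<Lambda>)"
    have m1: "0 \<le> real m / \<Lambda>" "real m / \<Lambda> \<le> cos (t n)"
      using n1(3) \<Lambda> by (auto simp: z_def field_simps)
    have "- 1 \<le> real m / \<Lambda>" "real m / \<Lambda> \<le> 1" using m1 cos_le_one[of "t n"] by linarith+
    then have \<tau>: "cos \<tau> = real m / \<Lambda>" "0 \<le> \<tau>" by (auto simp: \<tau>_def arccos_lbound)
    have \<tau>_half: "\<tau> \<le> pi / 2"
      unfolding \<tau>_def using m1(1) \<open>real m / \<Lambda> \<le> 1\<close> by (intro arccos_le_pi2)
    \<comment> \<open>The height condition m \<le> \<Lambda> cos(t n), read in angles;
      \<open>spiral\<close> then turns it into the required bound on the phase.\<close>
    have "t n \<le> \<tau>"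
    proof (rule ccontr)
      assume "\<not> ?thesis"
      then have "cos (t n) < cos \<tau>" using \<tau>(2) tn by (intro cos_monotone_0_pi) auto
      then show False using m1(2) \<tau>(1) by simp
    qed
    then have "spiral (t n) \<le> spiral \<tau>"
      using spiral_strict_mono[of "t n" \<tau>] tn \<tau>_half by (cases "t n = \<tau>") auto
    moreover have "\<Lambda> * spiral (t n) = pi * (real n - 149 / 200)" using tn by (simp add: field_simps)
    moreover have "debye_phase m \<Lambda> = \<Lambda> * spiral \<tau>"
    proof -
      have "sin \<tau> = sqrt (1 - (real m / \<Lambda>)\<^sup>2)"
        unfolding \<tau>_def using \<open>- 1 \<le> real m / \<Lambda>\<close> \<open>real m / \<Lambda> \<le> 1\<close> by (rule sin_arccos)
      then have "\<Lambda> * sin \<tau> = sqrt (\<Lambda>\<^sup>2 * (1 - (real m / \<Lambda>)\<^sup>2))"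
        using \<Lambda> by (simp add: real_sqrt_mult)
      also have "\<Lambda>\<^sup>2 * (1 - (real m / \<Lambda>)\<^sup>2) = \<Lambda>\<^sup>2 - (real m)\<^sup>2"
        using \<Lambda> by (simp add: power_divide right_diff_distrib)
      finally show ?thesis using \<Lambda> \<tau>(1) by (simp add: debye_phase_def spiral_def \<tau>_def[symmetric] right_diff_distrib)
    qed
    ultimately have "pi * (real n - 149 / 200) \<le> debye_phase m \<Lambda>" using \<Lambda> by (metis mult_le_cancel_left_pos)
    moreover have "pi * (real (card (I m)) - 149 / 200) \<le> pi * (real n - 149 / 200)"
      using le by (intro mult_left_mono) auto
    ultimately have "(real (card (I m)) - 149 / 200) * pi \<le> debye_phase m \<Lambda>"
      by (subst mult.commute) (rule order_trans)
    from neumann_conditions_of_zeros[OF \<Lambda> bessel_D_zeros[OF pos m\<Lambda> this]]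
    obtain K where "finite K" "card K = (if m = 0 then Suc (if m = 0 then card (I m) - 1 else card (I m)) else (if m = 0 then card (I m) - 1 else card (I m)))"
      "\<And>\<kappa>. \<kappa> \<in> K \<Longrightarrow> neumann_condition m \<kappa> \<and> 4 * \<kappa> \<le> \<Lambda>\<^sup>2" by blast
    \<comment> \<open>For m = 0 the two shifts by one cancel: one zero less, and \<kappa> = 0 in its
      place.\<close>
    then show ?thesis using pos by (intro exI[of _ K]) (auto split: if_splits)
  qed
  then obtain K where K: "\<And>m. finite (K m)" "\<And>m. card (K m) = card (I m)"
    "\<And>m \<kappa>. \<kappa> \<in> K m \<Longrightarrow> neumann_condition m \<kappa> \<and> 4 * \<kappa> \<le> \<Lambda>\<^sup>2"
    by metis
  define M where "M = nat \<lfloor>\<Lambda>\<rfloor>"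
  define P where "P m = (if m = 0 then {False} else UNIV)" for m :: nat
  define Z where "Z = (SIGMA m:{..M}. P m \<times> K m)"
  have "finite Z" using K(1) by (auto simp: Z_def P_def)
  then have count: "of_nat (card Z) \<le> neumann_counting unit_disk \<Lambda>"
    by (rule neumann_counting_unit_disk_ge) (use K(3) in \<open>auto simp: Z_def P_def disk_modes_def split: if_splits\<close>)
  have cardP: "card (P m) = (if m = 0 then 1 else 2)" for m by (simp add: P_def)
  have "real (card Z) = (\<Sum>m\<le>M. real (card (P m)) * real (card (I m)))"
    unfolding Z_def using K(1,2) by (subst card_SigmaI) (auto simp: card_cartesian_product P_def)
  also have "\<dots> = (\<Sum>m\<le>M. \<Sum>n=1..N. if real m \<le> z n then real (card (P m)) else 0)"
  proof (intro sum.cong refl)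
    fix m
    have "(\<Sum>n=1..N. if real m \<le> z n then real (card (P m)) else 0) = (\<Sum>n\<in>I m. real (card (P m)))"
      unfolding I_def by (rule sum.inter_filter[symmetric]) simp
    then show "real (card (P m)) * real (card (I m)) = (\<Sum>n=1..N. if real m \<le> z n then real (card (P m)) else 0)"
      by simp
  qed
  \<comment> \<open>Frequencies are found column by column, but the curve is compared row by row,
    where the abscissas are equally spaced.\<close>
  also have "\<dots> = (\<Sum>n=1..N. \<Sum>m\<le>M. if real m \<le> z n then real (card (P m)) else 0)"
    by (rule sum.swap)
  also have "\<dots> \<ge> (\<Sum>n=1..N. 2 * z n - 1)"
  proof (rule sum_mono)
    fix n assume "n \<in> {1..N}"
    then have tn: "0 < t n" "t n \<le> pi / 2" using t by auto
    define q where "q = nat \<lfloor>z n\<rfloor>"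
    have z0: "0 \<le> z n" unfolding z_def using tn \<Lambda> by (intro mult_nonneg_nonneg cos_ge_zero) auto
    have "z n \<le> \<Lambda>" using \<Lambda> by (simp add: z_def)
    then have "q \<le> M" unfolding q_def M_def by (intro nat_mono floor_mono)
    have q: "real q \<le> z n" "z n < real q + 1" using z0 by (auto simp: q_def)
    \<comment> \<open>The row contains m = 0 once and each of 1, ..., q twice.\<close>
    have "2 * z n - 1 \<le> 2 * real q + 1" using q by simp
    also have "\<dots> = (\<Sum>m\<le>q. real (card (P m)))"
      by (induction q) (auto simp: cardP)
    also have "\<dots> = (\<Sum>m\<le>q. if real m \<le> z n then real (card (P m)) else 0)"
      using q(1) by (intro sum.cong) auto
    also have "\<dots> \<le> (\<Sum>m\<le>M. if real m \<le> z n then real (card (P m)) else 0)"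
      using \<open>q \<le> M\<close> by (intro sum_mono2) auto
    finally show "2 * z n - 1 \<le> (\<Sum>m\<le>M. if real m \<le> z n then real (card (P m)) else 0)" .
  qed
  also have "(\<Sum>n=1..N. 2 * z n - 1) \<ge> \<Lambda>\<^sup>2 / 4"
    unfolding z_def by (rule sum_floor_bound[OF assms N t])
  finally have "ennreal (\<Lambda>\<^sup>2 / 4) \<le> ennreal (real (card Z))" by (intro ennreal_leI)
  also have "\<dots> = of_nat (card Z)" by (simp add: ennreal_of_nat_eq_real_of_nat)
  finally show ?thesis using count by (rule order_trans)
qed

end
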